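(* Let $s>0$, $1<p<\infty$ and $p<q_0\le q<p_s^*$. Then the imbedding of $B^{s,p,q_0}(\mathbb{R}^N)$ into $L^q(\mathbb{R}^N)$ is $\mathcal{D}_{\mathbb{Z}^N}$-cocompact.
   Context: **Critical exponent.** $p_s^*=\frac{pN}{N-sp}$ if $N>sp$ and $p_s^*=\infty$ if $N\le sp$. **Sobolev spaces.** For real $s>0$ and $p\in(1,\infty)$, $W^{s,p}(\mathbb{R}^N)$ is the space of (complex-valued) $f\in L^p(\mathbb{R}^N)$ such that $(1+|\xi|^2)^{s/2}\widehat f(\xi)$ is the Fourier transform of a function in $L^p(\mathbb{R}^N)$, normed by the $L^p$ norm of that function; $W^{0,p}=L^p$. **Real interpolation.** For a pair $(A_0,A_1)$ of Banach spaces continuously included in a common Hausdorff topological vector space, $K(t,a;A_0,A_1)=\inf\{\|a_0\|_{A_0}+t\|a_1\|_{A_1}:a=a_0+a_1,\ a_j\in A_j\}$, and $(A_0,A_1)_{\theta,q}$ is the space of $a\in A_0+A_1$ with finite norm $\left(\int_0^\infty(t^{-\theta}K(t,a;A_0,A_1))^q\frac{dt}{t}\right)^{1/q}$ (for $q=\infty$: $\sup_{t>0}t^{-\theta}K(t,a;A_0,A_1)$). **Besov spaces.** For $s\in(0,\infty)$, $p\in(1,\infty)$, $q\in[1,\infty]$, $B^{s,p,q}(\mathbb{R}^N)=\left(W^{s_0,p}(\mathbb{R}^N),W^{s_1,p}(\mathbb{R}^N)\right)_{\theta,q}$ where $0\le s_0<s<s_1$ and $\theta=\frac{s-s_0}{s_1-s_0}$;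 all such choices of $s_0,s_1$ give the same space up to equivalence of norms. **Group.** $\mathcal{D}_{\mathbb{Z}^N}=\{g_y\}_{y\in\mathbb{Z}^N}$ with $g_yu=u(\cdot-y)$. **Cocompactness.** For a Banach space $A$ and a group $\mathcal{D}$ of continuous linear bijections of $A$, a sequence $\{u_k\}$ in $A$ is $\mathcal{D}$-weakly convergent to $u\in A$ if $g_k(u_k-u)\rightharpoonup0$ weakly in $A$ for every sequence $\{g_k\}$ in $\mathcal{D}$. A continuous imbedding of $A$ into a Banach space $B$ is $\mathcal{D}$-cocompact if every $\mathcal{D}$-weakly convergent sequence in $A$ converges in the norm of $B$. *)

theory Defs
  imports "HOL-Analysis.Analysis"
begin

section \<open>Normed spaces of functions\<close>

text \<open>A space of complex-valued functions is given by its set of elements and its norm. Spaces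
  of classes modulo equality almost everywhere are represented by the set of all Borel
  representatives of their elements, so \<open>fnorm\<close> vanishes exactly on the functions that are zero
  almost everywhere. Bounded linear functionals, sums of spaces and norm convergence then are
  those of the space of classes.\<close>

record 'x fspace =
  elems :: "('x \<Rightarrow> complex) set"
  fnorm :: "('x \<Rightarrow> complex) \<Rightarrow> real"

definition bounded_functional :: "'x fspace \<Rightarrow> (('x \<Rightarrow> complex) \<Rightarrow> complex) \<Rightarrow> bool" where
  "bounded_functional A l \<longleftrightarrow>
     (\<forall>u\<in>elems A. \<forall>v\<in>elems A. l (\<lambda>x. u x + v x) = l u + l v) \<and>
     (\<forall>c. \<forall>u\<in>elems A. l (\<lambda>x. c * u x) = c * l u) \<and>
     (\<exists>C. \<forall>u\<in>elems A. norm (l u) \<le> C * fnorm A u)"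

definition weakly_convergent ::
    "'x fspace \<Rightarrow> (nat \<Rightarrow> 'x \<Rightarrow> complex) \<Rightarrow> ('x \<Rightarrow> complex) \<Rightarrow> bool" where
  "weakly_convergent A v w \<longleftrightarrow> (\<forall>l. bounded_functional A l \<longrightarrow> (\<lambda>k. l (v k)) \<longlonglongrightarrow> l w)"

definition norm_convergent ::
    "'x fspace \<Rightarrow> (nat \<Rightarrow> 'x \<Rightarrow> complex) \<Rightarrow> ('x \<Rightarrow> complex) \<Rightarrow> bool" where
  "norm_convergent A v w \<longleftrightarrow> (\<lambda>k. fnorm A (\<lambda>x. v k x - w x)) \<longlonglongrightarrow> 0"


section \<open>Cocompact imbeddings\<close>

definition D_weakly_convergent ::
    "'x fspace \<Rightarrow> (('x \<Rightarrow> complex) \<Rightarrow> ('x \<Rightarrow> complex)) set \<Rightarrow>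
     (nat \<Rightarrow> 'x \<Rightarrow> complex) \<Rightarrow> ('x \<Rightarrow> complex) \<Rightarrow> bool" where
  "D_weakly_convergent A D u w \<longleftrightarrow>
     (\<forall>g. (\<forall>k. g k \<in> D) \<longrightarrow> weakly_convergent A (\<lambda>k. g k (\<lambda>x. u k x - w x)) (\<lambda>x. 0))"

definition continuous_imbedding :: "'x fspace \<Rightarrow> 'x fspace \<Rightarrow> bool" where
  "continuous_imbedding A B \<longleftrightarrow>
     elems A \<subseteq> elems B \<and> (\<exists>C. \<forall>u\<in>elems A. fnorm B u \<le> C * fnorm A u)"

definition cocompact_imbedding ::
    "(('x \<Rightarrow> complex) \<Rightarrow> ('x \<Rightarrow> complex)) set \<Rightarrow> 'x fspace \<Rightarrow> 'x fspace \<Rightarrow> bool" where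
  "cocompact_imbedding D A B \<longleftrightarrow>
     continuous_imbedding A B \<and>
     (\<forall>u w. (\<forall>k. u k \<in> elems A) \<and> w \<in> elems A \<and> D_weakly_convergent A D u w
        \<longrightarrow> norm_convergent B u w)"

definition lattice_shifts :: "((real^'n \<Rightarrow> complex) \<Rightarrow> (real^'n \<Rightarrow> complex)) set" where
  "lattice_shifts = {(\<lambda>u x. u (x - y)) | y. \<forall>i. y $ i \<in> \<int>}"


section \<open>Lebesgue spaces and tempered distributions\<close>

definition Lp :: "real \<Rightarrow> (real^'n) fspace" where
  "Lp p = \<lparr>
     elems = {f \<in> borel_measurable lborel. integrable lborel (\<lambda>x. norm (f x) powr p)},
     fnorm = (\<lambda>f. (LINT x|lborel. norm (f x) powr p) powr (1 / p)) \<rparr>"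

primrec iterated_partial :: "'n list \<Rightarrow> (real^'n \<Rightarrow> complex) \<Rightarrow> (real^'n \<Rightarrow> complex)" where
  "iterated_partial [] f = f"
| "iterated_partial (i # is) f =
     (\<lambda>x. frechet_derivative (iterated_partial is f) (at x) (axis i 1))"

definition schwartz :: "(real^'n \<Rightarrow> complex) set" where
  "schwartz = {f.
     (\<forall>is x. iterated_partial is f differentiable (at x)) \<and>
     (\<forall>is m. \<exists>C. \<forall>x. norm x ^ m * norm (iterated_partial is f x) \<le> C)}"

definition fourier :: "(real^'n \<Rightarrow> complex) \<Rightarrow> (real^'n \<Rightarrow> complex)" where
  "fourier f \<xi> = (LINT x|lborel. cis (- (x \<bullet> \<xi>)) * f x)"

text \<open>Tempered distributions are functionals of which only the values on \<open>schwartz\<close> matter. The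
  Fourier transform of a function in \<open>Lp p\<close> is a distribution in general (for \<open>p > 2\<close>), so it has
  to be defined by duality.\<close>

type_synonym 'x dist = "('x \<Rightarrow> complex) \<Rightarrow> complex"

definition regular_dist :: "(real^'n \<Rightarrow> complex) \<Rightarrow> (real^'n) dist" where
  "regular_dist f \<phi> = (LINT x|lborel. f x * \<phi> x)"

definition fourier_dist :: "(real^'n) dist \<Rightarrow> (real^'n) dist" where
  "fourier_dist T \<phi> = T (fourier \<phi>)"

definition mult_dist :: "(real^'n \<Rightarrow> complex) \<Rightarrow> (real^'n) dist \<Rightarrow> (real^'n) dist" where
  "mult_dist m T \<phi> = T (\<lambda>\<xi>. m \<xi> * \<phi> \<xi>)"


section \<open>Sobolev and Besov spaces\<close>

definition bessel_symbol :: "real \<Rightarrow> real^'n \<Rightarrow> complex" where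
  "bessel_symbol s \<xi> = of_real ((1 + (norm \<xi>)\<^sup>2) powr (s / 2))"

definition is_bessel_derivative ::
    "real \<Rightarrow> (real^'n \<Rightarrow> complex) \<Rightarrow> (real^'n \<Rightarrow> complex) \<Rightarrow> bool" where
  "is_bessel_derivative s f g \<longleftrightarrow>
     (\<forall>\<phi>\<in>schwartz. mult_dist (bessel_symbol s) (fourier_dist (regular_dist f)) \<phi>
                   = fourier_dist (regular_dist g) \<phi>)"

text \<open>The function chosen in the norm is unique up to equality almost everywhere.\<close>

definition sobolev :: "real \<Rightarrow> real \<Rightarrow> (real^'n) fspace" where
  "sobolev s p = (if s = 0 then Lp p else \<lparr>
     elems = {f \<in> elems (Lp p). \<exists>g\<in>elems (Lp p). is_bessel_derivative s f g},
     fnorm = (\<lambda>f. fnorm (Lp p) (SOME g. g \<in> elems (Lp p) \<and> is_bessel_derivative s f g)) \<rparr>)"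

definition K_functional :: "real \<Rightarrow> ('x \<Rightarrow> complex) \<Rightarrow> 'x fspace \<Rightarrow> 'x fspace \<Rightarrow> real" where
  "K_functional t a A0 A1 = Inf {fnorm A0 a0 + t * fnorm A1 a1 | a0 a1.
     a0 \<in> elems A0 \<and> a1 \<in> elems A1 \<and> a = (\<lambda>x. a0 x + a1 x)}"

definition sum_elems :: "'x fspace \<Rightarrow> 'x fspace \<Rightarrow> ('x \<Rightarrow> complex) set" where
  "sum_elems A0 A1 = {(\<lambda>x. a0 x + a1 x) | a0 a1. a0 \<in> elems A0 \<and> a1 \<in> elems A1}"

definition interp_integral ::
    "real \<Rightarrow> real \<Rightarrow> 'x fspace \<Rightarrow> 'x fspace \<Rightarrow> ('x \<Rightarrow> complex) \<Rightarrow> ennreal" where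
  "interp_integral \<theta> q A0 A1 a =
     (\<integral>\<^sup>+t\<in>{0<..}. ennreal ((t powr (- \<theta>) * K_functional t a A0 A1) powr q / t) \<partial>lborel)"

text \<open>Only finite \<open>q\<close> is covered here.\<close>

definition real_interpolation ::
    "'x fspace \<Rightarrow> 'x fspace \<Rightarrow> real \<Rightarrow> real \<Rightarrow> 'x fspace" where
  "real_interpolation A0 A1 \<theta> q = \<lparr>
     elems = {a \<in> sum_elems A0 A1. interp_integral \<theta> q A0 A1 a < \<infinity>},
     fnorm = (\<lambda>a. enn2real (interp_integral \<theta> q A0 A1 a) powr (1 / q)) \<rparr>"

text \<open>Different \<open>s0\<close>, \<open>s1\<close> with \<open>0 \<le> s0 < s < s1\<close> give the same Besov space with an equivalent
  norm, so the choice is kept as a parameter.\<close>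

definition besov :: "real \<Rightarrow> real \<Rightarrow> real \<Rightarrow> real \<Rightarrow> real \<Rightarrow> (real^'n) fspace" where
  "besov s0 s1 s p q =
     real_interpolation (sobolev s0 p) (sobolev s1 p) ((s - s0) / (s1 - s0)) q"

definition critical_exponent :: "nat \<Rightarrow> real \<Rightarrow> real \<Rightarrow> ereal" where
  "critical_exponent N s p =
     (if real N > s * p then ereal (p * real N / (real N - s * p)) else \<infinity>)"

end

(* Write T_t = exp(-t(1 - Laplacian)), a convolution with a positive Gaussian kernel, and
   R_h = 1 - (1 - T_h)^m with m > s1/2. Since (1 - T_h)^m T_t = O((h/t)^m) on L^p and a Bessel potential
   of order sigma is a superposition of operators T_r, decomposing u according to the K-functional with
   t = h^((s1 - s0)/2) shows that (1 - T_h)^m T_{h/2} u has L^p norm O(h^(s/2)) on the Besov space.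
   The differences R_h - R_{2h} factor through this operator and a further T_{h/2}, which maps L^p to
   L^q with norm O(h^(-(N/2)(1/p - 1/q))). As q is subcritical, the telescoping series over dyadic h
   converges in L^q, and u - R_h u is small in L^q uniformly on bounded sets.
   For a sequence converging D-weakly to 0, the functions R_h u_k are bounded in L^p and converge to 0
   uniformly, because a value at an arbitrary point is moved into the unit cube by a lattice shift;
   hence they converge to 0 in L^q because q > p. The boundedness of the sequence follows from uniform
   boundedness applied to the functionals that norm these operators. *)
theory Submission
  imports Defs "HOL-Probability.Characteristic_Functions"
begin

section \<open>Powers of the Lebesgue norm\<close>

text \<open>Every operator is a polynomial in heat operators, so L^p bounds reduce to L^1 norms of
  explicit kernels and to weighted means over the time parameter. Jensen's inequality and the
  triangle inequality enter only up to fixed factors. The shape of R_h is dictated by the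
  telescoping. With X = T_h, the polynomial of R_h - R_{2h} is (1 - X)^m ((1 + X)^m - 1), which is
  divisible by X as well as by (1 - X)^m; the factor X supplies both smoothing halves T_{h/2}. The
  condition m > s1/2 makes the integral of (h/(h/2 + r))^m against r^(\<sigma>/2 - 1) dr converge
  for 0 < \<sigma> \<le> s1. Two obstacles remain. The telescoping series has to sum to u itself: it
  converges absolutely almost everywhere under an L^p majorant, and integrals over boxes identify
  its sum. And the bounds drawn from weak convergence have to be uniform in the scale h: they
  concern only images under operators into L^p, where norming functions are explicit, and they
  depend on the operator only through a bound for its norm.\<close>

definition lpow :: "real \<Rightarrow> (real^'n \<Rightarrow> complex) \<Rightarrow> ennreal" where
  "lpow p f = (\<integral>\<^sup>+x. ennreal (norm (f x) powr p) \<partial>lborel)"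

lemma Lp_elems_iff: "f \<in> elems (Lp p) \<longleftrightarrow> f \<in> borel_measurable lborel \<and> lpow p f < \<infinity>"
proof -
  have "integrable lborel (\<lambda>x. norm (f x) powr p) \<longleftrightarrow> lpow p f < \<infinity>"
    if [measurable]: "f \<in> borel_measurable lborel"
    unfolding lpow_def integrable_iff_bounded by auto
  then show ?thesis by (auto simp: Lp_def)
qed

lemma Lp_measurable: "f \<in> elems (Lp p) \<Longrightarrow> f \<in> borel_measurable borel"
  by (simp add: Lp_elems_iff)

lemma Lp_fnorm:
  assumes "f \<in> elems (Lp p)"
  shows "fnorm (Lp p) f = enn2real (lpow p f) powr (1 / p)"
proof -
  have [measurable]: "f \<in> borel_measurable lborel"
    using assms by (simp add: Lp_elems_iff)
  have "(LINT x|lborel. norm (f x) powr p) = enn2real (lpow p f)"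
    unfolding lpow_def by (intro integral_eq_nn_integral) auto
  then show ?thesis by (simp add: Lp_def)
qed

lemma Lp_fnorm_nonneg: "0 \<le> fnorm (Lp p) f"
  by (simp add: Lp_def)

lemma lpow_eq_fnorm:
  assumes "f \<in> elems (Lp p)" "0 < p"
  shows "lpow p f = ennreal (fnorm (Lp p) f powr p)"
proof -
  have "(enn2real (lpow p f) powr (1 / p)) powr p = enn2real (lpow p f)"
    using assms(2) by (simp add: powr_powr)
  moreover have "lpow p f < \<infinity>" using assms by (simp add: Lp_elems_iff)
  ultimately show ?thesis using assms by (simp add: Lp_fnorm)
qed

lemma fnorm_le_of_lpow_le:
  assumes "f \<in> elems (Lp p)" "0 < p" "lpow p f \<le> ennreal (B powr p)" "0 \<le> B"
  shows "fnorm (Lp p) f \<le> B"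
proof -
  have "ennreal (fnorm (Lp p) f powr p) \<le> ennreal (B powr p)"
    using assms lpow_eq_fnorm by metis
  then have "fnorm (Lp p) f powr p \<le> B powr p" by simp
  then show ?thesis using assms(2,4) Lp_fnorm_nonneg
    by (metis not_le powr_less_mono2)
qed

text \<open>a + b is at most 2 max(a, b). The crude constant suffices for estimates up to
  constants.\<close>

lemma powr_add_le:
  fixes a b p :: real
  assumes "0 \<le> a" "0 \<le> b" "0 \<le> p"
  shows "(a + b) powr p \<le> 2 powr p * (a powr p + b powr p)"
proof -
  have "(a + b) powr p \<le> (2 * max a b) powr p"
    using assms by (intro powr_mono2) auto
  also have "\<dots> = 2 powr p * max a b powr p"
    using assms by (simp add: powr_mult)
  also have "\<dots> \<le> 2 powr p * (a powr p + b powr p)"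
    using assms by (intro mult_left_mono) (auto simp: max_def)
  finally show ?thesis .
qed

lemma lpow_add:
  assumes [measurable]: "f \<in> borel_measurable borel" "g \<in> borel_measurable borel" and "0 \<le> p"
  shows "lpow p (\<lambda>x. f x + g x) \<le> ennreal (2 powr p) * (lpow p f + lpow p g)"
proof -
  have "lpow p (\<lambda>x. f x + g x)
      \<le> (\<integral>\<^sup>+x. ennreal (2 powr p) * (ennreal (norm (f x) powr p) + ennreal (norm (g x) powr p)) \<partial>lborel)"
    unfolding lpow_def
  proof (rule nn_integral_mono)
    fix x
    have "norm (f x + g x) powr p \<le> (norm (f x) + norm (g x)) powr p"
      using assms by (intro powr_mono2 norm_triangle_ineq) auto
    also have "\<dots> \<le> 2 powr p * (norm (f x) powr p + norm (g x) powr p)"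
      using assms by (intro powr_add_le) auto
    finally show "ennreal (norm (f x + g x) powr p)
       \<le> ennreal (2 powr p) * (ennreal (norm (f x) powr p) + ennreal (norm (g x) powr p))"
      by (simp flip: ennreal_mult ennreal_plus add: ennreal_leI)
  qed
  also have "\<dots> = ennreal (2 powr p) * (lpow p f + lpow p g)"
    unfolding lpow_def by (subst nn_integral_cmult) (auto simp: nn_integral_add)
  finally show ?thesis .
qed

lemma lpow_cmult:
  assumes [measurable]: "f \<in> borel_measurable borel" 
  shows "lpow p (\<lambda>x. c * f x) = ennreal (norm c powr p) * lpow p f"
proof -
  have "lpow p (\<lambda>x. c * f x) = (\<integral>\<^sup>+x. ennreal (norm c powr p) * ennreal (norm (f x) powr p) \<partial>lborel)"
    unfolding lpow_def
    by (intro nn_integral_cong) (simp add: norm_mult powr_mult flip: ennreal_mult)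
  then show ?thesis
    by (simp add: nn_integral_cmult lpow_def)
qed

lemma Lp_add:
  assumes "f \<in> elems (Lp p)" "g \<in> elems (Lp p)" "0 \<le> p"
  shows "(\<lambda>x. f x + g x) \<in> elems (Lp p)"
proof -
  have [measurable]: "f \<in> borel_measurable borel" "g \<in> borel_measurable borel"
    using assms Lp_measurable by auto
  have "lpow p (\<lambda>x. f x + g x) \<le> ennreal (2 powr p) * (lpow p f + lpow p g)"
    using assms by (intro lpow_add) auto
  also have "\<dots> < \<infinity>"
    using assms by (simp add: Lp_elems_iff ennreal_mult_less_top)
  finally show ?thesis by (simp add: Lp_elems_iff)
qed

lemma Lp_cmult:
  assumes "f \<in> elems (Lp p)"
  shows "(\<lambda>x. c * f x) \<in> elems (Lp p)"
proof -
  have [measurable]: "f \<in> borel_measurable borel" 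
    using assms Lp_measurable by auto
  have "lpow p (\<lambda>x. c * f x) < \<infinity>"
    using assms by (simp add: Lp_elems_iff lpow_cmult ennreal_mult_less_top)
  then show ?thesis by (simp add: Lp_elems_iff)
qed

lemma Lp_diff:
  assumes "f \<in> elems (Lp p)" "g \<in> elems (Lp p)" "0 \<le> p"
  shows "(\<lambda>x. f x - g x) \<in> elems (Lp p)"
  using Lp_add[OF assms(1) Lp_cmult[OF assms(2), of "-1"]] assms(3) by simp

lemma Lp_zero: "(\<lambda>x. 0) \<in> elems (Lp p)"
  by (simp add: Lp_elems_iff lpow_def)

text \<open>Jensen's inequality up to the factor \<open>2 powr p\<close>, which is harmless everywhere below.\<close>

lemma weighted_power_mean_nn:
  fixes k f :: "'a \<Rightarrow> real"
  assumes [measurable]: "k \<in> borel_measurable M" "f \<in> borel_measurable M"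
    and k: "\<And>y. 0 \<le> k y" and f: "\<And>y. 0 \<le> f y"
    and W: "(\<integral>\<^sup>+y. ennreal (k y) \<partial>M) \<le> ennreal W" "0 < W" and p: "1 < p"
    and a: "0 \<le> a" "ennreal a \<le> (\<integral>\<^sup>+y. ennreal (k y * f y) \<partial>M)"
  shows "ennreal (a powr p) \<le> ennreal (2 powr p * W powr (p - 1)) * (\<integral>\<^sup>+y. ennreal (k y * f y powr p) \<partial>M)"
proof (cases "(\<integral>\<^sup>+y. ennreal (k y * f y powr p) \<partial>M) = \<infinity>")
  case True
  moreover have "2 powr p * W powr (p - 1) > 0" using W by simp
  ultimately show ?thesis using W by (simp add: ennreal_mult_top)
next
  case False
  define B where "B = enn2real (\<integral>\<^sup>+y. ennreal (k y * f y powr p) \<partial>M)"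
  have B: "(\<integral>\<^sup>+y. ennreal (k y * f y powr p) \<partial>M) = ennreal B" "0 \<le> B"
    using False by (auto simp: B_def less_top)
  \<comment> \<open>Where f exceeds c, write f = f^(1 - p) f^p; the factor with the negative
    exponent 1 - p is at most c^(1 - p). Both regimes are added, and c stays free.\<close>
  have split: "f y \<le> c + c powr (1 - p) * f y powr p" if "c > 0" for c y
  proof (cases "f y \<le> c")
    case True
    then show ?thesis using that f[of y] by (simp add: add_increasing2)
  next
    case False
    then have "f y = f y powr (1 - p) * f y powr p"
      using that f[of y] by (simp flip: powr_add)
    also have "\<dots> \<le> c powr (1 - p) * f y powr p"
      using False that p f[of y] by (intro mult_right_mono) (auto intro!: powr_mono2')
    finally show ?thesis using that by linarith
  qed
  have key: "a \<le> c * W + c powr (1 - p) * B" if "c > 0" for c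
  proof -
    have "ennreal a \<le> (\<integral>\<^sup>+y. ennreal (k y * f y) \<partial>M)" by fact
    also have "\<dots> \<le> (\<integral>\<^sup>+y. ennreal c * ennreal (k y) + ennreal (c powr (1 - p)) * ennreal (k y * f y powr p) \<partial>M)"
    proof (rule nn_integral_mono)
      fix y
      have "k y * f y \<le> k y * (c + c powr (1 - p) * f y powr p)"
        using split[OF that] k by (intro mult_left_mono) auto
      also have "\<dots> = c * k y + c powr (1 - p) * (k y * f y powr p)"
        by (simp add: algebra_simps)
      finally show "ennreal (k y * f y) \<le> ennreal c * ennreal (k y) + ennreal (c powr (1 - p)) * ennreal (k y * f y powr p)"
        using that k[of y] by (simp flip: ennreal_mult ennreal_plus add: ennreal_leI)
    qed
    also have "\<dots> = ennreal c * (\<integral>\<^sup>+y. ennreal (k y) \<partial>M) + ennreal (c powr (1 - p)) * ennreal B"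
      by (subst nn_integral_add) (auto simp: nn_integral_cmult B(1))
    also have "\<dots> \<le> ennreal c * ennreal W + ennreal (c powr (1 - p)) * ennreal B"
      using W(1) by (intro add_mono mult_left_mono) auto
    also have "\<dots> = ennreal (c * W + c powr (1 - p) * B)"
      using that W B by (simp flip: ennreal_mult ennreal_plus)
    finally show ?thesis using that W B by (subst (asm) ennreal_le_iff) auto
  qed
  show ?thesis
  proof (cases "B = 0")
    case True
    \<comment> \<open>For B = 0 there is no optimal c; letting c tend to 0 forces a = 0.\<close>
    have "a \<le> e" if "e > 0" for e
      using key[of "e / W"] that W True by simp
    then have "a = 0" using a(1) by (meson dual_order.antisym field_le_epsilon less_eq_real_def add_0 linorder_not_less dense)
    then show ?thesis by simp
  next
    case False
    then have Bp: "B > 0" using B by simp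
    \<comment> \<open>This c balances the two terms of \<open>key\<close>: c^p = B / W gives c^(1 -
      p) B = c W.\<close>
    define c where "c = (B / W) powr (1 / p)"
    have c: "c > 0" using Bp W by (simp add: c_def)
    have cp: "c powr p = B / W" using Bp W p by (simp add: c_def powr_powr)
    have "c powr (1 - p) * B = c * W"
      using c cp Bp W by (simp add: powr_diff)
    then have "a \<le> 2 * (c * W)" using key[OF c] by linarith
    then have "a powr p \<le> (2 * (c * W)) powr p"
      using a p by (intro powr_mono2) auto
    also have "\<dots> = 2 powr p * (B / W * W powr p)"
      using c W by (simp add: powr_mult cp)
    also have "\<dots> = 2 powr p * W powr (p - 1) * B"
      using W by (simp add: powr_diff)
    finally show ?thesis
      using B by (simp flip: ennreal_mult add: ennreal_leI)
  qed
qed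

lemma weighted_power_mean:
  fixes k :: "'a \<Rightarrow> real" and F :: "'a \<Rightarrow> complex"
  assumes [measurable]: "k \<in> borel_measurable M" "F \<in> borel_measurable M"
    and k: "\<And>y. 0 \<le> k y" 
    and W: "(\<integral>\<^sup>+y. ennreal (k y) \<partial>M) \<le> ennreal W" "0 < W" and p: "1 < p"
  shows "ennreal (norm (LINT y|M. of_real (k y) * F y) powr p)
    \<le> ennreal (2 powr p * W powr (p - 1)) * (\<integral>\<^sup>+y. ennreal (k y * norm (F y) powr p) \<partial>M)"
proof (rule weighted_power_mean_nn[OF _ _ k _ W p])
  show "ennreal (norm (LINT y|M. of_real (k y) * F y)) \<le> (\<integral>\<^sup>+y. ennreal (k y * norm (F y)) \<partial>M)"
  proof (cases "integrable M (\<lambda>y. of_real (k y) * F y)")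
    case True
    then have "ennreal (norm (LINT y|M. of_real (k y) * F y)) \<le> (\<integral>\<^sup>+y. ennreal (norm (of_real (k y) * F y)) \<partial>M)"
      by (rule integral_norm_bound_ennreal)
    also have "\<dots> = (\<integral>\<^sup>+y. ennreal (k y * norm (F y)) \<partial>M)"
      using k by (simp add: norm_mult)
    finally show ?thesis .
  next
    \<comment> \<open>The Bochner integral of a nonintegrable function is 0 by convention.\<close>
    case False
    then show ?thesis by (simp add: not_integrable_integral_eq)
  qed
qed auto

section \<open>Gaussian kernels\<close>

text \<open>Fubini's theorem with absolute integrability expressed by an iterated integral of a
  nonnegative function, the form in which it can be verified by Tonelli and kernel masses.\<close>

lemma LINT_swap:
  fixes f :: "'a \<Rightarrow> 'b \<Rightarrow> complex"
  assumes "sigma_finite_measure M" "sigma_finite_measure N"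
    and [measurable]: "case_prod f \<in> borel_measurable (M \<Otimes>\<^sub>M N)"
    and fin: "(\<integral>\<^sup>+x. (\<integral>\<^sup>+y. ennreal (norm (f x y)) \<partial>N) \<partial>M) < \<infinity>"
  shows "(LINT x|M. LINT y|N. f x y) = (LINT y|N. LINT x|M. f x y)"
proof -
  interpret M: sigma_finite_measure M by fact
  interpret N: sigma_finite_measure N by fact
  interpret pair_sigma_finite M N ..
  have "integrable (M \<Otimes>\<^sub>M N) (case_prod f)"
    unfolding integrable_iff_bounded
  proof
    have "(\<integral>\<^sup>+z. ennreal (norm (case_prod f z)) \<partial>(M \<Otimes>\<^sub>M N)) = (\<integral>\<^sup>+x. (\<integral>\<^sup>+y. ennreal (norm (f x y)) \<partial>N) \<partial>M)"
      by (subst N.nn_integral_fst[symmetric]) auto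
    then show "(\<integral>\<^sup>+z. ennreal (norm (case_prod f z)) \<partial>(M \<Otimes>\<^sub>M N)) < \<infinity>"
      using fin by simp
  qed fact
  then show ?thesis
    by (rule Fubini_integral[symmetric])
qed

text \<open>The characteristic function of the standard normal distribution after the substitution
  of c x for x, where c^2 = 2 \<tau>.\<close>

lemma gaussian_fourier_real:
  fixes \<tau> t :: real
  assumes "0 < \<tau>"
  shows "has_bochner_integral lborel (\<lambda>x. of_real (exp (- \<tau> * x\<^sup>2)) * cis (t * x))
           (of_real (sqrt (pi / \<tau>) * exp (- t\<^sup>2 / (4 * \<tau>))) :: complex)"
proof -
  define c where "c = sqrt (2 * \<tau>)"
  have c: "c > 0" "c\<^sup>2 = 2 * \<tau>" using assms by (auto simp: c_def)
  define s where "s = t / c"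
  have "integrable lborel (\<lambda>x. std_normal_density x *\<^sub>R iexp (s * x))"
  proof (rule Bochner_Integration.integrable_bound)
    show "integrable lborel std_normal_density" by simp
  qed auto
  moreover have "(LINT x|lborel. std_normal_density x *\<^sub>R iexp (s * x)) = of_real (exp (- (s\<^sup>2) / 2))"
    using char_std_normal_distribution unfolding char_def
    by (subst (asm) integral_density) (auto simp: fun_eq_iff)
  ultimately have "has_bochner_integral lborel (\<lambda>x. std_normal_density x *\<^sub>R iexp (s * x)) (of_real (exp (- (s\<^sup>2) / 2)))"
    by (simp add: has_bochner_integral_iff)
  then have "has_bochner_integral lborel (\<lambda>x. std_normal_density (0 + c * x) *\<^sub>R iexp (s * (0 + c * x))) (of_real (exp (- (s\<^sup>2) / 2)) /\<^sub>R \<bar>c\<bar>)"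
    using c by (subst lborel_has_bochner_integral_real_affine_iff[symmetric]) auto
  then have "has_bochner_integral lborel (\<lambda>x. of_real (sqrt (2 * pi)) * (std_normal_density (0 + c * x) *\<^sub>R iexp (s * (0 + c * x))))
      (of_real (sqrt (2 * pi)) * (of_real (exp (- (s\<^sup>2) / 2)) /\<^sub>R \<bar>c\<bar>))"
    by (intro has_bochner_integral_mult_right) 
  moreover have "of_real (sqrt (2 * pi)) * (std_normal_density (0 + c * x) *\<^sub>R iexp (s * (0 + c * x)))
      = of_real (exp (- \<tau> * x\<^sup>2)) * cis (t * x)" for x
    using c by (simp add: std_normal_density_def s_def cis_conv_exp power_mult_distrib scaleR_conv_of_real)
  moreover have "of_real (sqrt (2 * pi)) * (of_real (exp (- (s\<^sup>2) / 2)) /\<^sub>R \<bar>c\<bar>)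
      = (of_real (sqrt (pi / \<tau>) * exp (- t\<^sup>2 / (4 * \<tau>))) :: complex)"
  proof -
    have "sqrt (2 * pi) / c = sqrt (pi / \<tau>)"
      unfolding c_def by (simp flip: real_sqrt_divide)
    moreover have "- (s\<^sup>2) / 2 = - t\<^sup>2 / (4 * \<tau>)"
      using c by (simp add: s_def power_divide)
    ultimately show ?thesis using c
      by (simp add: scaleR_conv_of_real field_simps flip: of_real_mult of_real_divide of_real_inverse)
  qed
  ultimately show ?thesis by simp
qed

lemma lborel_integral_prod_Basis:
  fixes f :: "'a::euclidean_space \<Rightarrow> real \<Rightarrow> complex"
  assumes "\<And>b. b \<in> Basis \<Longrightarrow> integrable lborel (f b)"
  shows "has_bochner_integral lborel (\<lambda>x::'a. \<Prod>b\<in>Basis. f b (x \<bullet> b)) (\<Prod>b\<in>Basis. LINT t|lborel. f b t)"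
proof -
  interpret product_sigma_finite "\<lambda>_::'a. lborel :: real measure"
    by (simp add: product_sigma_finite_def sigma_finite_lborel)
  define g where "g b = (if b \<in> Basis then f b else (\<lambda>_. 0))" for b :: 'a
  have [measurable]: "g b \<in> borel_measurable borel" for b
    using assms[of b] borel_measurable_integrable[of lborel "f b"] by (auto simp: g_def)
  have "has_bochner_integral lborel (\<lambda>x::'a. \<Prod>b\<in>Basis. g b (x \<bullet> b)) (\<Prod>b\<in>Basis. LINT t|lborel. g b t)"
    unfolding has_bochner_integral_iff
    apply (subst (1) lborel_eq)
    apply (subst (2) lborel_eq)
    apply (subst integrable_distr_eq, simp, simp)
    apply (subst integral_distr, simp, simp)
    using product_integrable_prod[of Basis g] product_integral_prod[of Basis g] assms
    by (simp add: g_def cong: prod.cong)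
  then show ?thesis by (simp add: g_def cong: prod.cong)
qed

lemma gaussian_fourier:
  fixes a :: "'a::euclidean_space"
  assumes "0 < \<tau>"
  shows "has_bochner_integral lborel (\<lambda>\<xi>. of_real (exp (- \<tau> * (norm \<xi>)\<^sup>2)) * cis (a \<bullet> \<xi>))
           (of_real ((pi / \<tau>) powr (DIM('a) / 2) * exp (- (norm a)\<^sup>2 / (4 * \<tau>))) :: complex)"
proof -
  have norm2: "(norm x)\<^sup>2 = (\<Sum>b\<in>Basis. (x \<bullet> b)\<^sup>2)" for x :: 'a
    unfolding power2_norm_eq_inner by (subst euclidean_inner) (simp add: power2_eq_square)
  have "has_bochner_integral lborel (\<lambda>\<xi>. \<Prod>b\<in>Basis. of_real (exp (- \<tau> * (\<xi> \<bullet> b)\<^sup>2)) * cis ((a \<bullet> b) * (\<xi> \<bullet> b)))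
     (\<Prod>b\<in>(Basis::'a set). LINT t|lborel. of_real (exp (- \<tau> * t\<^sup>2)) * cis ((a \<bullet> b) * t))"
    using gaussian_fourier_real[OF assms]
    by (intro lborel_integral_prod_Basis) (auto simp: has_bochner_integral_iff)
  moreover have "(\<Prod>b\<in>Basis. of_real (exp (- \<tau> * (\<xi> \<bullet> b)\<^sup>2)) * cis ((a \<bullet> b) * (\<xi> \<bullet> b)))
      = of_real (exp (- \<tau> * (norm \<xi>)\<^sup>2)) * cis (a \<bullet> \<xi>)" for \<xi>
  proof -
    have "(\<Prod>b\<in>Basis. cis ((a \<bullet> b) * (\<xi> \<bullet> b))) = cis (a \<bullet> \<xi>)"
      by (subst euclidean_inner) (simp add: cis_conv_exp exp_sum sum_distrib_left)
    moreover have "(\<Prod>b\<in>Basis. exp (- \<tau> * (\<xi> \<bullet> b)\<^sup>2)) = exp (- \<tau> * (norm \<xi>)\<^sup>2)"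
      by (simp add: norm2 exp_sum[symmetric] sum_distrib_left sum_negf)
    ultimately show ?thesis by (simp add: prod.distrib flip: of_real_prod)
  qed
  moreover have "(\<Prod>b\<in>(Basis::'a set). LINT t|lborel. of_real (exp (- \<tau> * t\<^sup>2)) * cis ((a \<bullet> b) * t))
     = (of_real ((pi / \<tau>) powr (DIM('a) / 2) * exp (- (norm a)\<^sup>2 / (4 * \<tau>))) :: complex)"
  proof -
    have "(\<Prod>b\<in>(Basis::'a set). LINT t|lborel. of_real (exp (- \<tau> * t\<^sup>2)) * cis ((a \<bullet> b) * t))
       = (\<Prod>b\<in>(Basis::'a set). of_real (sqrt (pi / \<tau>) * exp (- (a \<bullet> b)\<^sup>2 / (4 * \<tau>))))"
      using gaussian_fourier_real[OF assms] by (intro prod.cong) (simp_all add: has_bochner_integral_iff)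
    also have "\<dots> = of_real (\<Prod>b\<in>(Basis::'a set). sqrt (pi / \<tau>) * exp (- (a \<bullet> b)\<^sup>2 / (4 * \<tau>)))"
      by simp
    also have "(\<Prod>b\<in>(Basis::'a set). sqrt (pi / \<tau>) * exp (- (a \<bullet> b)\<^sup>2 / (4 * \<tau>)))
       = sqrt (pi / \<tau>) ^ DIM('a) * exp (- (norm a)\<^sup>2 / (4 * \<tau>))"
      by (simp add: prod.distrib norm2 exp_sum[symmetric] sum_divide_distrib sum_negf)
    also have "sqrt (pi / \<tau>) ^ DIM('a) = (pi / \<tau>) powr (DIM('a) / 2)"
      using assms by (simp add: powr_half_sqrt[symmetric] powr_powr flip: powr_realpow)
    finally show ?thesis .
  qed
  ultimately show ?thesis by simp
qed

section \<open>The kernel of exp(-\<tau>(1 - \<Delta>))\<close>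

definition heat_kernel :: "real \<Rightarrow> real^'n \<Rightarrow> real" where
  "heat_kernel \<tau> x = exp (- \<tau>) * (4 * pi * \<tau>) powr (- (CARD('n) / 2)) * exp (- (norm x)\<^sup>2 / (4 * \<tau>))"

lemma heat_kernel_nonneg: "0 \<le> heat_kernel \<tau> x"
  by (simp add: heat_kernel_def)

lemma measurable_heat_kernel [measurable (raw)]:
  assumes [measurable]: "f \<in> borel_measurable M" "g \<in> borel_measurable M"
  shows "(\<lambda>w. heat_kernel (f w) (g w)) \<in> borel_measurable M"
  unfolding heat_kernel_def by measurable

lemma heat_kernel_le:
  assumes "0 < \<tau>"
  shows "heat_kernel \<tau> (x::real^'n) \<le> exp (- \<tau>) * (4 * pi * \<tau>) powr (- (CARD('n) / 2))"
  unfolding heat_kernel_def using assms by (intro mult_left_le) auto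

lemma nn_integral_gaussian:
  assumes "0 < \<tau>"
  shows "(\<integral>\<^sup>+\<xi>. ennreal (exp (- \<tau> * (norm (\<xi>::'a::euclidean_space))\<^sup>2)) \<partial>lborel) = ennreal ((pi / \<tau>) powr (DIM('a) / 2))"
proof -
  have "has_bochner_integral lborel (\<lambda>\<xi>::'a. Re (of_real (exp (- \<tau> * (norm \<xi>)\<^sup>2)) * cis (0 \<bullet> \<xi>)))
           (Re (of_real ((pi / \<tau>) powr (DIM('a) / 2) * exp (- (norm (0::'a))\<^sup>2 / (4 * \<tau>)))))"
    by (rule has_bochner_integral_Re[OF gaussian_fourier[OF assms, of "0::'a"]])
  then have "has_bochner_integral lborel (\<lambda>\<xi>::'a. exp (- \<tau> * (norm \<xi>)\<^sup>2)) ((pi / \<tau>) powr (DIM('a) / 2))"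
    by simp
  then show ?thesis
    by (subst nn_integral_eq_integral) (auto simp: has_bochner_integral_iff)
qed

lemma nn_integral_shift:
  fixes f :: "'a::euclidean_space \<Rightarrow> ennreal"
  assumes [measurable]: "f \<in> borel_measurable borel"
  shows "(\<integral>\<^sup>+x. f (a + x) \<partial>lborel) = (\<integral>\<^sup>+x. f x \<partial>lborel)"
    and "(\<integral>\<^sup>+x. f (x - a) \<partial>lborel) = (\<integral>\<^sup>+x. f x \<partial>lborel)"
    and "(\<integral>\<^sup>+x. f (a - x) \<partial>lborel) = (\<integral>\<^sup>+x. f x \<partial>lborel)"
proof -
  have A: "(\<integral>\<^sup>+x. f x \<partial>lborel) = (\<integral>\<^sup>+x. f (a + c *\<^sub>R x) \<partial>lborel)" if "\<bar>c\<bar> = 1" for a c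
    using that by (subst lborel_affine[of c a])
       (auto simp: nn_integral_density nn_integral_distr)
  show "(\<integral>\<^sup>+x. f (a + x) \<partial>lborel) = (\<integral>\<^sup>+x. f x \<partial>lborel)" using A[of 1 a] by simp
  show "(\<integral>\<^sup>+x. f (x - a) \<partial>lborel) = (\<integral>\<^sup>+x. f x \<partial>lborel)" using A[of 1 "-a"] by simp
  show "(\<integral>\<^sup>+x. f (a - x) \<partial>lborel) = (\<integral>\<^sup>+x. f x \<partial>lborel)" using A[of "-1" a] by simp
qed

text \<open>The decay of the mass comes from the 1 in 1 - \<Delta>. It is what makes integrals over
  the time r against \<open>gamma_measure\<close> converge at infinity.\<close>

lemma nn_integral_heat_kernel:
  assumes "0 < \<tau>"
  shows "(\<integral>\<^sup>+x. ennreal (heat_kernel \<tau> (x::real^'n)) \<partial>lborel) = ennreal (exp (- \<tau>))"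
proof -
  have "(\<integral>\<^sup>+x. ennreal (heat_kernel \<tau> (x::real^'n)) \<partial>lborel)
    = (\<integral>\<^sup>+x. ennreal (exp (- \<tau>) * (4 * pi * \<tau>) powr (- (CARD('n) / 2))) * ennreal (exp (- (1 / (4 * \<tau>)) * (norm (x::real^'n))\<^sup>2)) \<partial>lborel)"
    by (intro nn_integral_cong) (simp add: heat_kernel_def flip: ennreal_mult)
  also have "\<dots> = ennreal (exp (- \<tau>) * (4 * pi * \<tau>) powr (- (CARD('n) / 2))) * ennreal ((pi / (1 / (4 * \<tau>))) powr (CARD('n) / 2))"
    using assms nn_integral_gaussian[of "1 / (4 * \<tau>)", where 'a="real^'n"]
    by (subst nn_integral_cmult) simp_all
  also have "\<dots> = ennreal (exp (- \<tau>))"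
    using assms by (simp flip: ennreal_mult powr_add add: mult.assoc) (simp add: ac_simps flip: powr_add)
  finally show ?thesis .
qed

lemma nn_integral_heat_kernel_shift:
  assumes "0 < \<tau>"
  shows "(\<integral>\<^sup>+y. ennreal (heat_kernel \<tau> (x - y)) \<partial>lborel) = ennreal (exp (- \<tau>))"
    "(\<integral>\<^sup>+y. ennreal (heat_kernel \<tau> (y - x)) \<partial>lborel) = ennreal (exp (- \<tau>))"
  using nn_integral_shift[of "\<lambda>x. ennreal (heat_kernel \<tau> x)" x] nn_integral_heat_kernel[OF assms]
  by auto

section \<open>The heat operators\<close>

text \<open>Completing the square in y: the product is a Gaussian in x - z times a Gaussian in y
  centred at a weighted mean of x and z. With r = \<tau>\<sigma>/(\<tau> + \<sigma>), the factor
  exp(r) cancels the mass exp(-r) of the last kernel.\<close>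

lemma heat_kernel_mult:
  assumes "0 < \<tau>" "0 < \<sigma>"
  shows "heat_kernel \<tau> (x - y) * heat_kernel \<sigma> (y - z)
    = heat_kernel (\<tau> + \<sigma>) (x - z) * (exp (\<tau> * \<sigma> / (\<tau> + \<sigma>))
        * heat_kernel (\<tau> * \<sigma> / (\<tau> + \<sigma>)) (y - (1 / (\<tau> + \<sigma>)) *\<^sub>R (\<sigma> *\<^sub>R x + \<tau> *\<^sub>R (z::real^'n))))"
proof -
  let ?r = "\<tau> * \<sigma> / (\<tau> + \<sigma>)" and ?m = "(1 / (\<tau> + \<sigma>)) *\<^sub>R (\<sigma> *\<^sub>R x + \<tau> *\<^sub>R z)"
  let ?N = "- (real CARD('n) / 2)"
  have pos: "0 < \<tau> + \<sigma>" using assms by simp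
  have r: "0 < ?r" using assms by simp
  have quad: "(norm (x - y))\<^sup>2 / (4 * \<tau>) + (norm (y - z))\<^sup>2 / (4 * \<sigma>)
     = (norm (x - z))\<^sup>2 / (4 * (\<tau> + \<sigma>)) + (norm (y - ?m))\<^sup>2 / (4 * ?r)"
  proof -
    define a where "a = x - y"
    define b where "b = y - z"
    have xz: "x - z = a + b" by (simp add: a_def b_def)
    have "(\<tau> + \<sigma>) *\<^sub>R (y - ?m) = \<tau> *\<^sub>R b - \<sigma> *\<^sub>R a"
      using pos by (simp add: a_def b_def scaleR_diff_right) (simp add: algebra_simps)
    then have "y - ?m = (1 / (\<tau> + \<sigma>)) *\<^sub>R (\<tau> *\<^sub>R b - \<sigma> *\<^sub>R a)"
      using pos by (metis (no_types, lifting) divide_inverse less_irrefl mult_1 scaleR_left.zero scaleR_one scaleR_scaleR left_inverse)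
    then have n2: "(norm (y - ?m))\<^sup>2 = (norm (\<tau> *\<^sub>R b - \<sigma> *\<^sub>R a))\<^sup>2 / (\<tau> + \<sigma>)\<^sup>2"
      by (simp add: power_divide)
    have e1: "(norm (\<tau> *\<^sub>R b - \<sigma> *\<^sub>R a))\<^sup>2 = \<tau>\<^sup>2 * (b \<bullet> b) - 2 * \<tau> * \<sigma> * (a \<bullet> b) + \<sigma>\<^sup>2 * (a \<bullet> a)"
      unfolding power2_norm_eq_inner by (simp add: inner_simps inner_commute power2_eq_square algebra_simps)
    have e2: "(norm (a + b))\<^sup>2 = a \<bullet> a + 2 * (a \<bullet> b) + b \<bullet> b"
      unfolding power2_norm_eq_inner by (simp add: inner_simps inner_commute)
    have e3: "(norm a)\<^sup>2 = a \<bullet> a" "(norm b)\<^sup>2 = b \<bullet> b"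
      by (simp_all add: power2_norm_eq_inner)
    have alg: "A / (4 * \<tau>) + B / (4 * \<sigma>) = (A + 2 * C + B) / (4 * (\<tau> + \<sigma>))
        + ((\<tau>\<^sup>2 * B - 2 * \<tau> * \<sigma> * C + \<sigma>\<^sup>2 * A) / (\<tau> + \<sigma>)\<^sup>2) / (4 * ?r)" for A B C :: real
      using assms pos by (simp add: divide_simps power2_eq_square) (simp add: algebra_simps)
    show ?thesis
      unfolding n2 xz a_def[symmetric] b_def[symmetric] e1 e2 e3 by (rule alg)
  qed
  have "(4 * pi * \<tau>) powr ?N * (4 * pi * \<sigma>) powr ?N = (4 * pi * (\<tau> + \<sigma>)) powr ?N * (4 * pi * ?r) powr ?N"
    using assms pos r by (subst powr_mult[symmetric], simp, simp)+ (simp add: field_simps)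
  moreover have "exp (- (norm (x - y))\<^sup>2 / (4 * \<tau>)) * exp (- (norm (y - z))\<^sup>2 / (4 * \<sigma>))
    = exp (- (norm (x - z))\<^sup>2 / (4 * (\<tau> + \<sigma>))) * exp (- (norm (y - ?m))\<^sup>2 / (4 * ?r))"
    using quad by (simp flip: exp_add)
  ultimately have "((4 * pi * \<tau>) powr ?N * (4 * pi * \<sigma>) powr ?N) * (exp (- (norm (x - y))\<^sup>2 / (4 * \<tau>)) * exp (- (norm (y - z))\<^sup>2 / (4 * \<sigma>)))
     * exp (- (\<tau> + \<sigma>)) = ((4 * pi * (\<tau> + \<sigma>)) powr ?N * (4 * pi * ?r) powr ?N) * 
      (exp (- (norm (x - z))\<^sup>2 / (4 * (\<tau> + \<sigma>))) * exp (- (norm (y - ?m))\<^sup>2 / (4 * ?r))) * exp (- (\<tau> + \<sigma>)) * (exp ?r * exp (- ?r))"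
    by (simp flip: exp_add)
  then show ?thesis
    unfolding heat_kernel_def by (simp add: exp_add exp_minus field_simps exp_diff)
qed

lemma nn_integral_heat_kernel_mult:
  assumes "0 < \<tau>" "0 < \<sigma>"
  shows "(\<integral>\<^sup>+y. ennreal (heat_kernel \<tau> (x - y) * heat_kernel \<sigma> (y - (z::real^'n))) \<partial>lborel)
    = ennreal (heat_kernel (\<tau> + \<sigma>) (x - z))"
proof -
  have r: "0 < \<tau> * \<sigma> / (\<tau> + \<sigma>)" using assms by simp
  show ?thesis
    unfolding heat_kernel_mult[OF assms]
    by (simp only: ennreal_mult heat_kernel_nonneg mult_nonneg_nonneg exp_ge_zero)
       (simp add: nn_integral_cmult nn_integral_heat_kernel_shift(2)[OF r] flip: ennreal_mult exp_add)
qed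

lemma integral_heat_kernel_mult:
  assumes "0 < \<tau>" "0 < \<sigma>"
  shows "(LINT y|lborel. heat_kernel \<tau> (x - y) * heat_kernel \<sigma> (y - (z::real^'n)))
    = heat_kernel (\<tau> + \<sigma>) (x - z)"
  using nn_integral_heat_kernel_mult[OF assms, of x z]
  by (subst integral_eq_nn_integral) (auto simp: heat_kernel_nonneg)

text \<open>The operator \<open>exp (- \<tau> (1 - \<Delta>))\<close>; Fourier multiplier \<open>exp (- \<tau> (1 + |\<xi>|\<^sup>2))\<close>.\<close>

definition heat :: "real \<Rightarrow> (real^'n \<Rightarrow> complex) \<Rightarrow> real^'n \<Rightarrow> complex" where
  "heat \<tau> u x = (if \<tau> = 0 then u x else LINT y|lborel. of_real (heat_kernel \<tau> (x - y)) * u y)"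

lemma measurable_heat [measurable (raw)]:
  assumes [measurable]: "u \<in> borel_measurable borel" "f \<in> borel_measurable M" "g \<in> borel_measurable M"
  shows "(\<lambda>w. heat (f w) u (g w)) \<in> borel_measurable M"
  unfolding heat_def by measurable

lemma heat_zero [simp]: "heat 0 u = u"
  by (simp add: heat_def fun_eq_iff)

lemma le_one_plus_powr:
  fixes a p :: real
  assumes "0 \<le> a" "1 \<le> p"
  shows "a \<le> 1 + a powr p"
proof (cases "a \<le> 1")
  case True
  then show ?thesis by (simp add: add_increasing2)
next
  case False
  then have "a powr 1 \<le> a powr p" using assms by (intro powr_mono) auto
  then show ?thesis using False by simp
qed

text \<open>A kernel that is bounded and integrable can be paired with L^p through a \<le> 1 + a^p,
  which separates the mass of the kernel from the p-th powers and involves no dual exponent.\<close>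

lemma nn_integral_bounded_mult:
  assumes [measurable]: "k \<in> borel_measurable lborel" "u \<in> borel_measurable borel"
    and "\<And>y. 0 \<le> k y" "\<And>y. k y \<le> C" "1 \<le> p"
  shows "(\<integral>\<^sup>+y. ennreal (k y * norm (u y)) \<partial>lborel)
    \<le> (\<integral>\<^sup>+y. ennreal (k y) \<partial>lborel) + ennreal C * lpow p u"
proof -
  have C: "0 \<le> C" using assms(3,4) order.trans by blast
  have "(\<integral>\<^sup>+y. ennreal (k y * norm (u y)) \<partial>lborel)
     \<le> (\<integral>\<^sup>+y. ennreal (k y) + ennreal C * ennreal (norm (u y) powr p) \<partial>lborel)"
  proof (rule nn_integral_mono)
    fix y
    have "k y * norm (u y) \<le> k y * (1 + norm (u y) powr p)"
      using assms by (intro mult_left_mono le_one_plus_powr) auto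
    also have "\<dots> \<le> k y + C * norm (u y) powr p"
      using assms by (simp add: algebra_simps mult_right_mono)
    finally show "ennreal (k y * norm (u y)) \<le> ennreal (k y) + ennreal C * ennreal (norm (u y) powr p)"
      using C assms(3)[of y] by (simp flip: ennreal_mult ennreal_plus add: ennreal_leI)
  qed
  also have "\<dots> = (\<integral>\<^sup>+y. ennreal (k y) \<partial>lborel) + ennreal C * lpow p u"
    by (simp add: nn_integral_add nn_integral_cmult lpow_def)
  finally show ?thesis .
qed

lemma nn_integral_heat_le:
  assumes [measurable]: "u \<in> borel_measurable borel" and "0 < \<tau>" "1 \<le> p"
  shows "(\<integral>\<^sup>+y. ennreal (heat_kernel \<tau> (x - y) * norm (u y)) \<partial>lborel)
    \<le> ennreal (exp (- \<tau>)) + ennreal (exp (- \<tau>) * (4 * pi * \<tau>) powr (- (CARD('n) / 2))) * lpow p (u :: real^'n \<Rightarrow> complex)"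
  using nn_integral_bounded_mult[of "\<lambda>y. heat_kernel \<tau> (x - y)" u _ p, OF _ _ heat_kernel_nonneg heat_kernel_le]
    assms by (simp add: nn_integral_heat_kernel_shift)

lemma integrable_heat:
  assumes "u \<in> elems (Lp p)" "0 < \<tau>" "1 \<le> p"
  shows "integrable lborel (\<lambda>y. of_real (heat_kernel \<tau> (x - y)) * u y)"
  unfolding integrable_iff_bounded
proof
  have [measurable]: "u \<in> borel_measurable borel" using assms Lp_measurable by blast
  show "(\<lambda>y. of_real (heat_kernel \<tau> (x - y)) * u y) \<in> borel_measurable lborel"
    by measurable
  have "(\<integral>\<^sup>+y. ennreal (norm (of_real (heat_kernel \<tau> (x - y)) * u y)) \<partial>lborel)
      = (\<integral>\<^sup>+y. ennreal (heat_kernel \<tau> (x - y) * norm (u y)) \<partial>lborel)"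
    by (simp add: norm_mult heat_kernel_nonneg)
  also have "\<dots> < \<infinity>"
    using assms by (intro le_less_trans[OF nn_integral_heat_le[of u \<tau> p]])
      (auto simp: Lp_elems_iff ennreal_mult_less_top)
  finally show "(\<integral>\<^sup>+y. ennreal (norm (of_real (heat_kernel \<tau> (x - y)) * u y)) \<partial>lborel) < \<infinity>" .
qed

lemma heat_add:
  assumes "u \<in> elems (Lp p)" "v \<in> elems (Lp p)" "0 \<le> \<tau>" "1 \<le> p"
  shows "heat \<tau> (\<lambda>x. u x + v x) = (\<lambda>x. heat \<tau> u x + heat \<tau> v x)"
proof (cases "\<tau> = 0")
  case False
  then show ?thesis
    using assms integrable_heat[of _ p \<tau>]
    by (simp add: heat_def fun_eq_iff distrib_left integrable_heat)
qed simp

lemma heat_cmult: "heat \<tau> (\<lambda>x. c * u x) = (\<lambda>x. c * heat \<tau> u x)"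
  by (simp add: heat_def fun_eq_iff mult.left_commute)

text \<open>Young's inequality for L^1 and L^p: the power mean in y with weight |k(x - y)| costs
  W^(p - 1), and Tonelli costs one more W.\<close>

lemma convolution_lpow_le:
  fixes u :: "real^'n \<Rightarrow> complex"
  assumes [measurable]: "k \<in> borel_measurable borel" "u \<in> borel_measurable borel"
    and W: "(\<integral>\<^sup>+y. ennreal \<bar>k y\<bar> \<partial>lborel) \<le> ennreal W" "0 < W" and p: "1 < p"
  shows "lpow p (\<lambda>x. LINT y|lborel. of_real (k (x - y)) * u y) \<le> ennreal (2 powr p * W powr p) * lpow p u"
proof -
  have W': "(\<integral>\<^sup>+y. ennreal \<bar>k (x - y)\<bar> \<partial>lborel) \<le> ennreal W" "(\<integral>\<^sup>+x. ennreal \<bar>k (x - y)\<bar> \<partial>lborel) \<le> ennreal W" for x y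
    using W nn_integral_shift[of "\<lambda>y. ennreal \<bar>k y\<bar>"] by auto
  have pt: "ennreal (norm (LINT y|lborel. of_real (k (x - y)) * u y) powr p)
      \<le> ennreal (2 powr p * W powr (p - 1)) * (\<integral>\<^sup>+y. ennreal \<bar>k (x - y)\<bar> * ennreal (norm (u y) powr p) \<partial>lborel)" for x
  proof -
    \<comment> \<open>Weights have to be nonnegative, so the sign of the kernel is moved to u. This
      matters for differences of heat kernels.\<close>
    have eq: "of_real (k (x - y)) * u y = of_real \<bar>k (x - y)\<bar> * (of_real (sgn (k (x - y))) * u y)" for y
      by (simp add: mult.assoc[symmetric] abs_mult_sgn flip: of_real_mult)
    have "ennreal (norm (LINT y|lborel. of_real (k (x - y)) * u y) powr p)
      = ennreal (norm (LINT y|lborel. of_real \<bar>k (x - y)\<bar> * (of_real (sgn (k (x - y))) * u y)) powr p)"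
      by (subst eq) (rule refl)
    also have "\<dots> \<le> ennreal (2 powr p * W powr (p - 1)) * (\<integral>\<^sup>+y. ennreal (\<bar>k (x - y)\<bar> * norm (of_real (sgn (k (x - y))) * u y) powr p) \<partial>lborel)"
      by (rule weighted_power_mean[OF _ _ _ W'(1) W(2) p]) auto
    also have "\<dots> \<le> ennreal (2 powr p * W powr (p - 1)) * (\<integral>\<^sup>+y. ennreal \<bar>k (x - y)\<bar> * ennreal (norm (u y) powr p) \<partial>lborel)"
    proof (intro mult_left_mono nn_integral_mono)
      fix y
      have "\<bar>k (x - y)\<bar> * norm (of_real (sgn (k (x - y))) * u y) powr p \<le> \<bar>k (x - y)\<bar> * norm (u y) powr p"
        using p by (intro mult_left_mono powr_mono2) (auto simp: norm_mult sgn_if)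
      then show "ennreal (\<bar>k (x - y)\<bar> * norm (of_real (sgn (k (x - y))) * u y) powr p) \<le> ennreal \<bar>k (x - y)\<bar> * ennreal (norm (u y) powr p)"
        by (simp add: ennreal_leI flip: ennreal_mult)
    qed auto
    finally show ?thesis .
  qed
  have "lpow p (\<lambda>x. LINT y|lborel. of_real (k (x - y)) * u y)
     \<le> (\<integral>\<^sup>+x. ennreal (2 powr p * W powr (p - 1)) * (\<integral>\<^sup>+y. ennreal \<bar>k (x - y)\<bar> * ennreal (norm (u y) powr p) \<partial>lborel) \<partial>lborel)"
    unfolding lpow_def by (intro nn_integral_mono pt)
  also have "\<dots> = ennreal (2 powr p * W powr (p - 1)) * (\<integral>\<^sup>+x. (\<integral>\<^sup>+y. ennreal \<bar>k (x - y)\<bar> * ennreal (norm (u y) powr p) \<partial>lborel) \<partial>lborel)"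
    by (simp add: nn_integral_cmult)
  also have "(\<integral>\<^sup>+x. (\<integral>\<^sup>+y. ennreal \<bar>k (x - y)\<bar> * ennreal (norm (u y) powr p) \<partial>lborel) \<partial>lborel)
     = (\<integral>\<^sup>+y. (\<integral>\<^sup>+x. ennreal \<bar>k (x - y)\<bar> * ennreal (norm (u y) powr p) \<partial>lborel) \<partial>lborel)"
    by (rule lborel_pair.Fubini') simp
  also have "\<dots> = (\<integral>\<^sup>+y. (\<integral>\<^sup>+x. ennreal \<bar>k (x - y)\<bar> \<partial>lborel) * ennreal (norm (u y) powr p) \<partial>lborel)"
    by (simp add: nn_integral_multc)
  also have "\<dots> \<le> (\<integral>\<^sup>+y. ennreal W * ennreal (norm (u y) powr p) \<partial>lborel)"
    by (intro nn_integral_mono mult_right_mono W') auto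
  also have "\<dots> = ennreal W * lpow p u"
    by (simp add: nn_integral_cmult lpow_def)
  finally have "lpow p (\<lambda>x. LINT y|lborel. of_real (k (x - y)) * u y) \<le> ennreal (2 powr p * W powr (p - 1)) * (ennreal W * lpow p u)"
    by (simp add: mult_left_mono)
  also have "\<dots> = ennreal (2 powr p * W powr p) * lpow p u"
    using W by (simp add: powr_diff mult.assoc[symmetric] flip: ennreal_mult)
  finally show ?thesis .
qed

lemma lpow_heat_le:
  assumes [measurable]: "u \<in> borel_measurable borel" and "0 \<le> \<tau>" "1 < p"
  shows "lpow p (heat \<tau> u) \<le> ennreal (2 powr p * exp (- \<tau>) powr p) * lpow p u"
proof (cases "\<tau> = 0")
  case True
  have "1 * lpow p u \<le> ennreal (2 powr p) * lpow p u"
    using assms by (intro mult_right_mono) (auto simp: ge_one_powr_ge_zero)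
  with True show ?thesis by simp
next
  case False
  then have "heat \<tau> u = (\<lambda>x. LINT y|lborel. of_real (heat_kernel \<tau> (x - y)) * u y)"
    by (simp add: heat_def fun_eq_iff)
  then show ?thesis
    using convolution_lpow_le[of "heat_kernel \<tau>" u "exp (- \<tau>)" p] False assms
    by (simp add: heat_kernel_nonneg nn_integral_heat_kernel)
qed

lemma heat_Lp:
  assumes "u \<in> elems (Lp p)" "0 \<le> \<tau>" "1 < p"
  shows "heat \<tau> u \<in> elems (Lp p)"
proof -
  have [measurable]: "u \<in> borel_measurable borel" using assms Lp_measurable by blast
  have "heat \<tau> u \<in> borel_measurable lborel" by measurable
  moreover have "lpow p (heat \<tau> u) < \<infinity>"
    using assms by (intro le_less_trans[OF lpow_heat_le]) (auto simp: Lp_elems_iff ennreal_mult_less_top)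
  ultimately show ?thesis by (simp add: Lp_elems_iff)
qed

text \<open>The kernel is first a Jensen weight of mass at most 1 and is then replaced by its
  maximum. Thus \<tau>^(-N/2) bounds the p-th power, and the norm sees only
  \<tau>^(-N/(2p)).\<close>

lemma heat_sup_le:
  fixes u :: "real^'n \<Rightarrow> complex"
  assumes [measurable]: "u \<in> borel_measurable borel" and "0 < \<tau>" "1 < p"
  shows "ennreal (norm (heat \<tau> u x) powr p) \<le> ennreal (2 powr p * (4 * pi * \<tau>) powr (- (CARD('n) / 2))) * lpow p u"
proof -
  have K: "heat_kernel \<tau> y \<le> (4 * pi * \<tau>) powr (- (CARD('n) / 2))" for y :: "real^'n"
    using assms by (intro order.trans[OF heat_kernel_le] mult_left_le_one_le) auto
  have "ennreal (norm (heat \<tau> u x) powr p)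
     = ennreal (norm (LINT y|lborel. of_real (heat_kernel \<tau> (x - y)) * u y) powr p)"
    using assms by (simp add: heat_def)
  also have "\<dots> \<le> ennreal (2 powr p * 1 powr (p - 1)) * (\<integral>\<^sup>+y. ennreal (heat_kernel \<tau> (x - y) * norm (u y) powr p) \<partial>lborel)"
    using assms by (intro weighted_power_mean) (auto simp: nn_integral_heat_kernel_shift heat_kernel_nonneg)
  also have "\<dots> \<le> ennreal (2 powr p * 1 powr (p - 1)) * (\<integral>\<^sup>+y. ennreal ((4 * pi * \<tau>) powr (- (CARD('n) / 2))) * ennreal (norm (u y) powr p) \<partial>lborel)"
    using K by (intro mult_left_mono nn_integral_mono) (auto simp flip: ennreal_mult intro!: ennreal_leI mult_right_mono)
  also have "\<dots> = ennreal (2 powr p * (4 * pi * \<tau>) powr (- (CARD('n) / 2))) * lpow p u"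
    by (simp add: nn_integral_cmult lpow_def ennreal_mult mult.assoc)
  finally show ?thesis .
qed

lemma heat_heat:
  assumes u: "u \<in> elems (Lp p)" and "0 \<le> \<tau>" "0 \<le> \<sigma>" "1 \<le> p"
  shows "heat \<tau> (heat \<sigma> u) = heat (\<tau> + \<sigma>) u"
proof (cases "\<tau> = 0 \<or> \<sigma> = 0")
  case False
  then have pos: "0 < \<tau>" "0 < \<sigma>" using assms by auto
  have [measurable]: "u \<in> borel_measurable borel" using assms Lp_measurable by blast
  show ?thesis
  proof
    fix x
    have "heat \<tau> (heat \<sigma> u) x = (LINT y|lborel. LINT z|lborel. of_real (heat_kernel \<tau> (x - y) * heat_kernel \<sigma> (y - z)) * u z)"
      using pos by (simp add: heat_def mult.assoc)
    also have "\<dots> = (LINT z|lborel. LINT y|lborel. of_real (heat_kernel \<tau> (x - y) * heat_kernel \<sigma> (y - z)) * u z)"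
    proof (rule LINT_swap)
      have "(\<integral>\<^sup>+ y. \<integral>\<^sup>+ z. ennreal (norm (of_real (heat_kernel \<tau> (x - y) * heat_kernel \<sigma> (y - z)) * u z)) \<partial>lborel \<partial>lborel)
        = (\<integral>\<^sup>+ y. \<integral>\<^sup>+ z. ennreal (heat_kernel \<tau> (x - y) * heat_kernel \<sigma> (y - z)) * ennreal (norm (u z)) \<partial>lborel \<partial>lborel)"
        by (simp add: norm_mult heat_kernel_nonneg ennreal_mult)
      also have "\<dots> = (\<integral>\<^sup>+ z. \<integral>\<^sup>+ y. ennreal (heat_kernel \<tau> (x - y) * heat_kernel \<sigma> (y - z)) * ennreal (norm (u z)) \<partial>lborel \<partial>lborel)"
        by (rule lborel_pair.Fubini') measurable
      also have "\<dots> = (\<integral>\<^sup>+ z. ennreal (heat_kernel (\<tau> + \<sigma>) (x - z)) * ennreal (norm (u z)) \<partial>lborel)"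
        using pos by (simp add: nn_integral_multc nn_integral_heat_kernel_mult)
      also have "\<dots> = (\<integral>\<^sup>+ z. ennreal (heat_kernel (\<tau> + \<sigma>) (x - z) * norm (u z)) \<partial>lborel)"
        by (simp add: ennreal_mult heat_kernel_nonneg)
      also have "\<dots> < \<infinity>"
        using assms pos by (intro le_less_trans[OF nn_integral_heat_le[of u "\<tau> + \<sigma>" p]])
          (auto simp: Lp_elems_iff ennreal_mult_less_top)
      finally show "(\<integral>\<^sup>+ y. \<integral>\<^sup>+ z. ennreal (norm (of_real (heat_kernel \<tau> (x - y) * heat_kernel \<sigma> (y - z)) * u z)) \<partial>lborel \<partial>lborel) < \<infinity>" .
    qed (auto intro: sigma_finite_lborel)
    also have "\<dots> = (LINT z|lborel. of_real (heat_kernel (\<tau> + \<sigma>) (x - z)) * u z)"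
      using pos integral_heat_kernel_mult[OF pos, of x]
      by (simp flip: of_real_mult)
    also have "\<dots> = heat (\<tau> + \<sigma>) u x" using pos by (simp add: heat_def)
    finally show "heat \<tau> (heat \<sigma> u) x = heat (\<tau> + \<sigma>) u x" .
  qed
qed auto

lemma heat_translate:
  assumes [measurable]: "u \<in> borel_measurable borel"
  shows "heat \<tau> (\<lambda>x. u (x + y)) z = heat \<tau> u (z + (y::real^'n))"
proof -
  have "(LINT w|lborel. of_real (heat_kernel \<tau> (z + y - w)) * u w)
    = (LINT w|distr lborel borel ((+) y). of_real (heat_kernel \<tau> (z + y - w)) * u w)"
    by (simp add: lborel_distr_plus)
  also have "\<dots> = (LINT w|lborel. of_real (heat_kernel \<tau> (z + y - (y + w))) * u (y + w))"
    by (rule integral_distr) measurable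
  finally show ?thesis by (simp add: heat_def add.commute)
qed

text \<open>Write K_t for the kernel at time t. With c as defined below, c K_r \<le> K_(r+h)
  pointwise, because the Gaussian widens. Hence |K_r - K_(r+h)| is at most the sum of the
  nonnegative functions (1 - c) K_r and K_(r+h) - c K_r. Each has integral at most (1 - c) exp(-r)
  \<le> (1 + N/2) h/r, which doubles to the constant 2 + N.\<close>

lemma nn_integral_heat_kernel_diff:
  assumes "0 < r" "0 < h"
  shows "(\<integral>\<^sup>+x. ennreal \<bar>heat_kernel r (x::real^'n) - heat_kernel (r + h) x\<bar> \<partial>lborel)
    \<le> ennreal ((2 + CARD('n)) * (h / r))"
proof -
  let ?m = "real CARD('n) / 2"
  define c where "c = exp (- h) * (r / (r + h)) powr ?m"
  have c01: "0 \<le> c" "c \<le> 1"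
    using assms by (auto simp: c_def intro!: mult_le_one powr_le1)
  have lower: "c * heat_kernel r x \<le> heat_kernel (r + h) x" for x :: "real^'n"
  proof -
    have "(r / (r + h)) powr ?m * (4 * pi * r) powr (- ?m) = (4 * pi * (r + h)) powr (- ?m)"
    proof -
      have "4 * pi * r = (r / (r + h)) * (4 * pi * (r + h))" using assms by simp
      then have "(4 * pi * r) powr (- ?m) = (r / (r + h)) powr (- ?m) * (4 * pi * (r + h)) powr (- ?m)"
        using assms by (metis powr_mult)
      then show ?thesis using assms by (simp add: mult.assoc[symmetric] flip: powr_add)
    qed
    then have "c * heat_kernel r x = exp (- (r + h)) * (4 * pi * (r + h)) powr (- ?m) * exp (- (norm x)\<^sup>2 / (4 * r))"
      by (simp add: c_def heat_kernel_def exp_add exp_minus exp_diff field_simps)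
    also have "\<dots> \<le> heat_kernel (r + h) x"
      unfolding heat_kernel_def using assms
      by (intro mult_left_mono) (auto simp: divide_left_mono)
    finally show ?thesis .
  qed
  have abs: "\<bar>heat_kernel r x - heat_kernel (r + h) x\<bar>
      \<le> (1 - c) * heat_kernel r x + (heat_kernel (r + h) x - c * heat_kernel r x)" for x :: "real^'n"
    using lower[of x] heat_kernel_nonneg[of r x] c01 mult_nonneg_nonneg[of "1 - c" "heat_kernel r x"]
    by (simp add: abs_if algebra_simps)
  have int: "integrable lborel (\<lambda>x::real^'n. heat_kernel t x)" "(LINT x|lborel. heat_kernel t (x::real^'n)) = exp (- t)" if "0 < t" for t
  proof -
    show "integrable lborel (\<lambda>x::real^'n. heat_kernel t x)"
      unfolding integrable_iff_bounded using nn_integral_heat_kernel[OF that, where 'n='n] by (simp add: heat_kernel_nonneg)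
    show "(LINT x|lborel. heat_kernel t (x::real^'n)) = exp (- t)"
      using nn_integral_heat_kernel[OF that, where 'n='n] by (subst integral_eq_nn_integral) (auto simp: heat_kernel_nonneg)
  qed
  have rh: "0 < r + h" using assms by simp
  have bound: "(1 - c) * exp (- r) + (exp (- (r + h)) - c * exp (- r)) \<le> (2 + CARD('n)) * (h / r)"
  proof -
    \<comment> \<open>(1 + x)^(-N/2) \<ge> 1 - (N/2) x at x = h/r, through ln(1 + x) \<le> x and e^y
      \<ge> 1 + y.\<close>
    have "1 - ?m * (h / r) \<le> exp (- (?m * (h / r)))"
      using exp_ge_add_one_self[of "- (?m * (h / r))"] by simp
    also have "\<dots> \<le> exp (- (?m * ln (1 + h / r)))"
      using assms ln_add_one_self_le_self[of "h / r"]
      by (simp only: exp_le_cancel_iff neg_le_iff_le) (intro mult_left_mono, auto)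
    also have "\<dots> = (1 + h / r) powr (- ?m)"
      using assms add_pos_pos[of 1 "h / r"] by (simp add: powr_def)
    also have "1 + h / r = inverse (r / (r + h))" using assms by (simp add: field_simps)
    also have "\<dots> powr (- ?m) = (r / (r + h)) powr ?m"
      using assms by (simp add: powr_minus powr_divide)
    finally have A: "1 - ?m * (h / r) \<le> (r / (r + h)) powr ?m" .
    have B: "1 - h \<le> exp (- h)" using exp_ge_add_one_self[of "-h"] by simp
    have "0 \<le> (1 - exp (- h)) * (1 - (r / (r + h)) powr ?m)"
      using assms by (intro mult_nonneg_nonneg) (auto intro!: powr_le1)
    then have "1 - c \<le> (1 - exp (- h)) + (1 - (r / (r + h)) powr ?m)"
      by (simp add: c_def algebra_simps)
    also have "\<dots> \<le> h + ?m * (h / r)" using A B by linarith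
    finally have "(1 - c) * exp (- r) \<le> (h + ?m * (h / r)) * exp (- r)"
      by (intro mult_right_mono) auto
    also have "\<dots> = h * exp (- r) + ?m * (h / r) * exp (- r)" by (simp add: algebra_simps)
    \<comment> \<open>The term h, which stems from the factor exp(-h) of c, becomes h/r by r exp(-r)
      \<le> 1.\<close>
    also have "\<dots> \<le> h * (1 / r) + ?m * (h / r) * 1"
    proof (intro add_mono mult_left_mono)
      have "r \<le> exp r" using exp_ge_add_one_self[of r] by linarith
      then show "exp (- r) \<le> 1 / r" using assms by (simp add: exp_minus field_simps)
    qed (use assms in auto)
    finally have "(1 - c) * exp (- r) \<le> (1 + ?m) * (h / r)" by (simp add: algebra_simps)
    moreover have "exp (- (r + h)) - c * exp (- r) \<le> (1 - c) * exp (- r)"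
      using assms by (simp add: left_diff_distrib)
    moreover have "(2 + CARD('n)) * (h / r) = 2 * ((1 + ?m) * (h / r))"
      by (simp add: algebra_simps)
    ultimately show ?thesis by linarith
  qed
  have "(\<integral>\<^sup>+x. ennreal \<bar>heat_kernel r (x::real^'n) - heat_kernel (r + h) x\<bar> \<partial>lborel)
    \<le> (\<integral>\<^sup>+x. ennreal ((1 - c) * heat_kernel r (x::real^'n) + (heat_kernel (r + h) x - c * heat_kernel r x)) \<partial>lborel)"
    by (intro nn_integral_mono ennreal_leI abs)
  also have "\<dots> = ennreal (LINT x|lborel. (1 - c) * heat_kernel r (x::real^'n) + (heat_kernel (r + h) x - c * heat_kernel r x))"
    using int assms rh by (intro nn_integral_eq_integral) (auto intro!: AE_I2 order.trans[OF abs_ge_zero abs])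
  also have "(LINT x|lborel. (1 - c) * heat_kernel r (x::real^'n) + (heat_kernel (r + h) x - c * heat_kernel r x))
      = (1 - c) * exp (- r) + (exp (- (r + h)) - c * exp (- r))"
    using int assms rh by (subst Bochner_Integration.integral_add) (auto simp: Bochner_Integration.integral_diff)
  also have "ennreal \<dots> \<le> ennreal ((2 + CARD('n)) * (h / r))"
    using bound by (rule ennreal_leI)
  finally show ?thesis .
qed

lemma lpow_heat_diff_le:
  fixes u :: "real^'n \<Rightarrow> complex"
  assumes u: "u \<in> elems (Lp p)" and "0 < r" "0 < h" "1 < p"
  shows "lpow p (\<lambda>x. heat r u x - heat (r + h) u x)
    \<le> ennreal (2 powr p * ((2 + CARD('n)) * (h / r)) powr p) * lpow p u"
proof -
  have [measurable]: "u \<in> borel_measurable borel" using assms Lp_measurable by blast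
  have "(\<lambda>x. heat r u x - heat (r + h) u x)
      = (\<lambda>x. LINT y|lborel. of_real (heat_kernel r (x - y) - heat_kernel (r + h) (x - y)) * u y)"
    using assms integrable_heat[OF u]
    by (simp add: heat_def fun_eq_iff left_diff_distrib)
  moreover have "lpow p \<dots> \<le> ennreal (2 powr p * ((2 + CARD('n)) * (h / r)) powr p) * lpow p u"
    using assms nn_integral_heat_kernel_diff[of r h, where 'n='n]
    by (intro convolution_lpow_le[where k="\<lambda>z. heat_kernel r z - heat_kernel (r + h) z"]) auto
  ultimately show ?thesis by simp
qed

text \<open>As \<open>heat (i * h)\<close> is the \<open>i\<close>-th power of \<open>heat h\<close>, this is \<open>P\<close> evaluated at \<open>heat h\<close>.\<close>

definition heat_poly :: "real \<Rightarrow> complex poly \<Rightarrow> (real^'n \<Rightarrow> complex) \<Rightarrow> real^'n \<Rightarrow> complex" where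
  "heat_poly h P u x = (\<Sum>i\<le>degree P. coeff P i * heat (of_nat i * h) u x)"

lemma measurable_heat_poly [measurable (raw)]:
  assumes [measurable]: "u \<in> borel_measurable borel" "f \<in> borel_measurable M" "g \<in> borel_measurable M"
  shows "(\<lambda>w. heat_poly (f w) P u (g w)) \<in> borel_measurable M"
  unfolding heat_poly_def by measurable

lemma heat_poly_eq:
  assumes "degree P \<le> n"
  shows "heat_poly h P u x = (\<Sum>i\<le>n. coeff P i * heat (of_nat i * h) u x)"
  unfolding heat_poly_def using assms
  by (intro sum.mono_neutral_left) (auto simp: coeff_eq_0)

lemma heat_poly_0 [simp]: "heat_poly h 0 u = (\<lambda>x. 0)"
  by (simp add: heat_poly_def fun_eq_iff)

lemma heat_poly_1 [simp]: "heat_poly h 1 u = u"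
  by (simp add: heat_poly_def fun_eq_iff)

lemma heat_poly_plus: "heat_poly h (P + Q) u x = heat_poly h P u x + heat_poly h Q u x"
  by (simp add: heat_poly_eq[of _ "max (degree P) (degree Q)"] degree_add_le distrib_right sum.distrib)

lemma heat_poly_smult: "heat_poly h (smult c P) u x = c * heat_poly h P u x"
  by (simp add: heat_poly_eq[of "smult c P" "degree P"] heat_poly_def[of h P] sum_distrib_left mult.assoc)

lemma heat_poly_minus: "heat_poly h (P - Q) u x = heat_poly h P u x - heat_poly h Q u x"
  using heat_poly_plus[of h P "- Q" u x] heat_poly_smult[of h "-1" Q u x] by simp

text \<open>Horner's rule; it is the induction step in the inductions over polynomials
  below.\<close>

lemma heat_poly_pCons:
  assumes "u \<in> elems (Lp p)" "0 \<le> h" "1 \<le> p"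
  shows "heat_poly h (pCons a P) u x = a * u x + heat_poly h P (heat h u) x"
proof -
  have "heat_poly h (pCons a P) u x = (\<Sum>i\<le>Suc (degree P). coeff (pCons a P) i * heat (of_nat i * h) u x)"
    by (intro heat_poly_eq) (simp add: degree_pCons_le)
  also have "\<dots> = a * u x + (\<Sum>i\<le>degree P. coeff P i * heat (of_nat (Suc i) * h) u x)"
    by (subst sum.atMost_Suc_shift) simp
  also have "(\<Sum>i\<le>degree P. coeff P i * heat (of_nat (Suc i) * h) u x) = heat_poly h P (heat h u) x"
    unfolding heat_poly_def using assms
    by (intro sum.cong) (simp_all add: heat_heat algebra_simps)
  finally show ?thesis .
qed

lemma heat_poly_Lp:
  assumes "u \<in> elems (Lp p)" "0 \<le> h" "1 < p"
  shows "heat_poly h P u \<in> elems (Lp p)"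
  using assms(1)
proof (induction P arbitrary: u)
  case 0
  then show ?case by (simp add: Lp_zero)
next
  case (pCons a P)
  have "heat_poly h (pCons a P) u = (\<lambda>x. a * u x + heat_poly h P (heat h u) x)"
    using pCons assms by (simp add: fun_eq_iff heat_poly_pCons)
  then show ?case
    using pCons assms by (simp add: Lp_add Lp_cmult heat_Lp)
qed

lemma heat_poly_add:
  assumes "u \<in> elems (Lp p)" "v \<in> elems (Lp p)" "0 \<le> h" "1 \<le> p"
  shows "heat_poly h P (\<lambda>x. u x + v x) = (\<lambda>x. heat_poly h P u x + heat_poly h P v x)"
  using assms by (simp add: heat_poly_def fun_eq_iff heat_add distrib_left sum.distrib)

lemma heat_poly_cmult: "heat_poly h P (\<lambda>x. c * u x) = (\<lambda>x. c * heat_poly h P u x)"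
  by (simp add: heat_poly_def fun_eq_iff heat_cmult sum_distrib_left mult.left_commute)

lemma heat_poly_heat:
  assumes "u \<in> elems (Lp p)" "0 \<le> h" "0 \<le> \<tau>" "1 < p"
  shows "heat_poly h P (heat \<tau> u) = heat \<tau> (heat_poly h P u)"
  using assms(1)
proof (induction P arbitrary: u)
  case 0
  show ?case using heat_cmult[of \<tau> 0 u] by simp
next
  case (pCons a P)
  have "heat h (heat \<tau> u) = heat \<tau> (heat h u)"
    using pCons assms by (simp add: heat_heat add.commute)
  then have "heat_poly h (pCons a P) (heat \<tau> u) = (\<lambda>x. a * heat \<tau> u x + heat \<tau> (heat_poly h P (heat h u)) x)"
    using pCons assms by (intro ext) (simp add: heat_poly_pCons[where p=p] heat_Lp)
  also have "\<dots> = heat \<tau> (\<lambda>x. a * u x + heat_poly h P (heat h u) x)"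
    using pCons assms by (subst heat_add[of _ p]) (simp_all add: heat_cmult Lp_cmult heat_poly_Lp heat_Lp)
  also have "(\<lambda>x. a * u x + heat_poly h P (heat h u) x) = heat_poly h (pCons a P) u"
    using pCons assms by (intro ext) (simp add: heat_poly_pCons[where p=p])
  finally show ?case .
qed

text \<open>Evaluation at \<open>heat h\<close> respects products, so a factorization of polynomials
  is a factorization of operators.\<close>

lemma heat_poly_mult:
  assumes "u \<in> elems (Lp p)" "0 \<le> h" "1 < p"
  shows "heat_poly h (P * Q) u = heat_poly h P (heat_poly h Q u)"
  using assms(1)
proof (induction P arbitrary: u)
  case 0
  then show ?case by simp
next
  case (pCons a P)
  show ?case
  proof
    fix x
    have "heat_poly h (pCons a P * Q) u x = a * heat_poly h Q u x + heat_poly h (P * Q) (heat h u) x"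
      using pCons assms by (simp add: heat_poly_plus heat_poly_smult heat_poly_pCons)
    also have "\<dots> = a * heat_poly h Q u x + heat_poly h P (heat h (heat_poly h Q u)) x"
      using pCons assms by (simp add: heat_Lp[where p=p] heat_poly_heat[of u p, symmetric])
    also have "\<dots> = heat_poly h (pCons a P) (heat_poly h Q u) x"
      using pCons assms by (simp add: heat_poly_pCons[where p=p] heat_poly_Lp)
    finally show "heat_poly h (pCons a P * Q) u x = heat_poly h (pCons a P) (heat_poly h Q u) x" .
  qed
qed

text \<open>\<open>heat (2 * h)\<close> is the square of \<open>heat h\<close>, and
  \<open>[:0, 0, 1:]\<close> is the polynomial X^2. This brings two consecutive dyadic scales into
  one polynomial algebra.\<close>

lemma heat_poly_double:
  assumes "u \<in> elems (Lp p)" "0 \<le> h" "1 < p"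
  shows "heat_poly (2 * h) P u = heat_poly h (pcompose P [:0, 0, 1:]) u"
  using assms(1)
proof (induction P arbitrary: u)
  case 0
  then show ?case by simp
next
  case (pCons a P)
  have "heat h (heat h u) = heat (2 * h) u"
    using pCons assms by (simp add: heat_heat)
  then show ?case
    using pCons assms
    by (simp add: fun_eq_iff[of "heat_poly _ _ _"] heat_poly_plus heat_poly_pCons[where p=p] heat_Lp pcompose_pCons)
qed

text \<open>The constant depends on P and p but not on h, as a sum over dyadic scales
  requires.\<close>

lemma lpow_heat_poly_le:
  assumes "1 < p"
  obtains C where "0 < C" "\<And>u h. u \<in> elems (Lp p) \<Longrightarrow> 0 \<le> h \<Longrightarrow>
     lpow p (heat_poly h P (u::real^'n \<Rightarrow> complex)) \<le> ennreal C * lpow p u"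
proof -
  have "\<exists>C>0. \<forall>u h. u \<in> elems (Lp p) \<longrightarrow> 0 \<le> h \<longrightarrow>
     lpow p (heat_poly h P (u::real^'n \<Rightarrow> complex)) \<le> ennreal C * lpow p u"
  proof (induction P)
    case 0
    then show ?case using assms by (intro exI[of _ 1]) (auto simp: lpow_def)
  next
    case (pCons a P)
    then obtain C where C: "0 < C" "\<And>u h. u \<in> elems (Lp p) \<Longrightarrow> 0 \<le> h \<Longrightarrow>
     lpow p (heat_poly h P (u::real^'n \<Rightarrow> complex)) \<le> ennreal C * lpow p u" by blast
    define C' where "C' = 2 powr p * (norm a powr p + C * 2 powr p)"
    have "lpow p (heat_poly h (pCons a P) u) \<le> ennreal C' * lpow p u"
      if u: "u \<in> elems (Lp p)" and h: "0 \<le> h" for u :: "real^'n \<Rightarrow> complex" and h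
    proof -
      have [measurable]: "u \<in> borel_measurable borel" using u Lp_measurable by blast
      have "lpow p (heat h u) \<le> ennreal (2 powr p * exp (- h) powr p) * lpow p u"
        using assms h by (intro lpow_heat_le) auto
      also have "\<dots> \<le> ennreal (2 powr p) * lpow p u"
        using assms h by (intro mult_right_mono ennreal_leI mult_left_le powr_le1) auto
      finally have H: "lpow p (heat h u) \<le> ennreal (2 powr p) * lpow p u" .
      have "heat_poly h (pCons a P) u = (\<lambda>x. a * u x + heat_poly h P (heat h u) x)"
        using u h assms by (simp add: fun_eq_iff heat_poly_pCons)
      then have "lpow p (heat_poly h (pCons a P) u)
         \<le> ennreal (2 powr p) * (lpow p (\<lambda>x. a * u x) + lpow p (heat_poly h P (heat h u)))"
        using assms by (simp only:) (intro lpow_add, auto)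
      also have "\<dots> \<le> ennreal (2 powr p) * (ennreal (norm a powr p) * lpow p u + ennreal C * (ennreal (2 powr p) * lpow p u))"
        using u h assms C(1)
        by (intro mult_left_mono add_mono order.trans[OF C(2)] H) (auto simp: lpow_cmult heat_Lp)
      also have "\<dots> = ennreal C' * lpow p u"
        using C(1) by (simp add: C'_def ennreal_mult ennreal_plus distrib_right distrib_left mult.assoc)
      finally show ?thesis .
    qed
    moreover have "C' > 0" using C(1) unfolding C'_def by (intro mult_pos_pos add_nonneg_pos) auto
    ultimately show ?case by blast
  qed
  then show ?thesis using that by blast
qed

text \<open>Each factor \<open>1 - heat h\<close> gains a factor \<open>h / \<tau>\<close> when part of the smoothing is spent on it.\<close>

lemma lpow_heat_difference_power_le:
  fixes u :: "real^'n \<Rightarrow> complex"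
  assumes u: "u \<in> elems (Lp p)" and "0 < h" "0 < \<tau>" "1 < p"
  shows "lpow p (heat_poly h ([:1, -1:] ^ m) (heat (of_nat m * \<tau>) u))
    \<le> ennreal ((2 powr p * ((2 + CARD('n)) * (h / \<tau>)) powr p) ^ m) * lpow p u"
proof (induction m)
  case 0
  show ?case by simp
next
  case (Suc m)
  let ?c = "2 powr p * ((2 + CARD('n)) * (h / \<tau>)) powr p"
  let ?v = "heat_poly h ([:1, -1:] ^ m) (heat (of_nat m * \<tau>) u)"
  have v: "?v \<in> elems (Lp p)"
    using assms by (intro heat_poly_Lp heat_Lp) auto
  have "heat (of_nat (Suc m) * \<tau>) u = heat \<tau> (heat (of_nat m * \<tau>) u)"
    using assms by (simp add: heat_heat algebra_simps)
  then have "heat_poly h ([:1, -1:] ^ Suc m) (heat (of_nat (Suc m) * \<tau>) u)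
     = heat_poly h ([:1, -1:] * [:1, -1:] ^ m) (heat \<tau> (heat (of_nat m * \<tau>) u))"
    by simp
  also have "\<dots> = heat_poly h [:1, -1:] (heat_poly h ([:1, -1:] ^ m) (heat \<tau> (heat (of_nat m * \<tau>) u)))"
    using assms by (intro heat_poly_mult[where p=p] heat_Lp) auto
  also have "heat_poly h ([:1, -1:] ^ m) (heat \<tau> (heat (of_nat m * \<tau>) u)) = heat \<tau> ?v"
    using assms by (intro heat_poly_heat[where p=p] heat_Lp) auto
  also have "heat_poly h [:1, -1:] (heat \<tau> ?v) = (\<lambda>x. heat \<tau> ?v x - heat (\<tau> + h) ?v x)"
    using assms v by (simp add: fun_eq_iff heat_poly_def heat_heat add.commute)
  finally have "lpow p (heat_poly h ([:1, -1:] ^ Suc m) (heat (of_nat (Suc m) * \<tau>) u))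
      \<le> ennreal ?c * lpow p ?v"
    using lpow_heat_diff_le[OF v, of \<tau> h] assms by simp
  also have "\<dots> \<le> ennreal ?c * (ennreal (?c ^ m) * lpow p u)"
    by (intro mult_left_mono Suc) auto
  also have "\<dots> = ennreal (?c ^ Suc m) * lpow p u"
    by (subst mult.assoc[symmetric], subst ennreal_mult[symmetric]) auto
  finally show ?case .
qed

section \<open>Bessel potentials\<close>

text \<open>The measure on \<open>[0, \<infinity>)\<close> with Laplace transform \<open>c \<mapsto> c powr (- \<beta>)\<close>.\<close>

definition gamma_measure :: "real \<Rightarrow> real measure" where
  "gamma_measure \<beta> = (if \<beta> = 0 then return borel 0
     else density lborel (\<lambda>r. ennreal (indicator {0<..} r * r powr (\<beta> - 1) / Gamma \<beta>)))"

lemma sets_gamma_measure [simp, measurable_cong]: "sets (gamma_measure \<beta>) = sets borel"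
  by (simp add: gamma_measure_def)

lemma space_gamma_measure [simp]: "space (gamma_measure \<beta>) = UNIV"
  by (simp add: gamma_measure_def)

lemma sigma_finite_gamma_measure: "sigma_finite_measure (gamma_measure \<beta>)"
proof (cases "\<beta> = 0")
  case True
  interpret prob_space "return borel (0::real)" by (rule prob_space_return) simp
  show ?thesis using True by (simp add: gamma_measure_def sigma_finite_measure_axioms)
next
  case False
  then show ?thesis
    by (simp add: gamma_measure_def sigma_finite_lborel sigma_finite_measure.sigma_finite_iff_density_finite)
qed

lemma nn_integral_gamma_measure:
  assumes "0 < \<beta>" "f \<in> borel_measurable borel"
  shows "(\<integral>\<^sup>+r. f r \<partial>gamma_measure \<beta>)
    = (\<integral>\<^sup>+r. ennreal (indicator {0<..} r * r powr (\<beta> - 1) / Gamma \<beta>) * f r \<partial>lborel)"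
  using assms by (simp add: gamma_measure_def nn_integral_density)

lemma AE_gamma_measure: "0 < \<beta> \<Longrightarrow> AE r in gamma_measure \<beta>. 0 < r"
  unfolding gamma_measure_def by (auto simp: AE_density indicator_def)

lemma AE_gamma_measure_nonneg: "0 \<le> \<beta> \<Longrightarrow> AE r in gamma_measure \<beta>. 0 \<le> r"
proof (cases "\<beta> = 0")
  case True
  have "AE r in return borel (0::real). 0 \<le> r"
    by (subst AE_return) auto
  moreover have "gamma_measure \<beta> = return borel 0" using True by (simp add: gamma_measure_def)
  ultimately show ?thesis by (simp only:)
next
  case False
  assume "0 \<le> \<beta>"
  then have "AE r in gamma_measure \<beta>. 0 < r" using False AE_gamma_measure by simp
  then show ?thesis by eventually_elim simp
qed

lemma gamma_measure_laplace:
  assumes "0 \<le> \<beta>" "0 < c"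
  shows "(\<integral>\<^sup>+r. ennreal (exp (- c * r)) \<partial>gamma_measure \<beta>) = ennreal (c powr (- \<beta>))"
proof (cases "\<beta> = 0")
  case True
  then show ?thesis using assms by (simp add: gamma_measure_def nn_integral_return)
next
  case False
  then have b: "0 < \<beta>" using assms by simp
  have G: "0 < Gamma \<beta>" using b by (rule Gamma_real_pos)
  have "ennreal (Gamma \<beta>) = (\<integral>\<^sup>+t. ennreal (indicator {0..} t * t powr (\<beta> - 1) / exp t) \<partial>lborel)"
    using Gamma_conv_nn_integral_real[OF b] by simp
  also have "\<dots> = (\<integral>\<^sup>+t. ennreal (indicator {0<..} t * t powr (\<beta> - 1) / exp t) \<partial>lborel)"
    by (intro nn_integral_cong) (auto simp: indicator_def)
  \<comment> \<open>Substitution t = c r in the Euler integral for Gamma.\<close>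
  also have "\<dots> = ennreal \<bar>c\<bar> * (\<integral>\<^sup>+r. ennreal (indicator {0<..} (0 + c * r) * (0 + c * r) powr (\<beta> - 1) / exp (0 + c * r)) \<partial>lborel)"
    using assms by (intro nn_integral_real_affine) auto
  also have "\<dots> = (\<integral>\<^sup>+r. ennreal (c powr \<beta> * Gamma \<beta>) * (ennreal (indicator {0<..} r * r powr (\<beta> - 1) / Gamma \<beta>) * ennreal (exp (- c * r))) \<partial>lborel)"
    using assms G
    by (subst nn_integral_cmult[symmetric]) 
      (auto intro!: nn_integral_cong simp: indicator_def powr_mult exp_minus zero_less_mult_iff powr_diff field_simps simp flip: ennreal_mult)
  also have "\<dots> = ennreal (c powr \<beta> * Gamma \<beta>) * (\<integral>\<^sup>+r. ennreal (exp (- c * r)) \<partial>gamma_measure \<beta>)"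
    using b by (simp add: nn_integral_cmult nn_integral_gamma_measure)
  finally have eq: "ennreal (Gamma \<beta>) = ennreal (c powr \<beta> * Gamma \<beta>) * (\<integral>\<^sup>+r. ennreal (exp (- c * r)) \<partial>gamma_measure \<beta>)" .
  have "ennreal (c powr (- \<beta>)) = ennreal (c powr (- \<beta>) / Gamma \<beta>) * ennreal (Gamma \<beta>)"
    using G by (simp flip: ennreal_mult)
  also have "\<dots> = ennreal (c powr (- \<beta>) / Gamma \<beta> * (c powr \<beta> * Gamma \<beta>)) * (\<integral>\<^sup>+r. ennreal (exp (- c * r)) \<partial>gamma_measure \<beta>)"
    unfolding eq using G by (subst mult.assoc[symmetric], subst ennreal_mult[symmetric]) auto
  also have "c powr (- \<beta>) / Gamma \<beta> * (c powr \<beta> * Gamma \<beta>) = 1"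
    using G assms by (simp add: powr_minus)
  finally show ?thesis by simp
qed

text \<open>A Beta integral: (c + r)^(-m) is the Laplace transform of \<open>gamma_measure m\<close>
  at c + r. After the exchange of integrals the inner one contributes s^(-\<beta>), which leaves a
  Gamma integral of order m - \<beta>; the condition \<beta> < m is its convergence.\<close>

lemma nn_integral_gamma_measure_powr:
  assumes "0 \<le> \<beta>" "\<beta> < m" "0 < c"
  shows "(\<integral>\<^sup>+r. ennreal ((c + r) powr (- m)) \<partial>gamma_measure \<beta>) = ennreal (Gamma (m - \<beta>) / Gamma m * c powr (\<beta> - m))"
proof -
  interpret B: sigma_finite_measure "gamma_measure \<beta>" by (rule sigma_finite_gamma_measure)
  interpret M: sigma_finite_measure "gamma_measure m" by (rule sigma_finite_gamma_measure)
  interpret pair_sigma_finite "gamma_measure \<beta>" "gamma_measure m" ..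
  have m: "0 < m" using assms by simp
  have pos: "0 < Gamma m" "0 < Gamma (m - \<beta>)"
    using m assms Gamma_real_pos[of m] Gamma_real_pos[of "m - \<beta>"] by auto
  then have G: "0 < Gamma m" "0 < Gamma (m - \<beta>)" "Gamma m \<noteq> 0" "Gamma (m - \<beta>) \<noteq> 0"
    by linarith+
  have "(\<integral>\<^sup>+r. ennreal ((c + r) powr (- m)) \<partial>gamma_measure \<beta>)
     = (\<integral>\<^sup>+r. \<integral>\<^sup>+s. ennreal (exp (- (c + r) * s)) \<partial>gamma_measure m \<partial>gamma_measure \<beta>)"
  proof (rule nn_integral_cong_AE)
    show "AE r in gamma_measure \<beta>. ennreal ((c + r) powr (- m)) = (\<integral>\<^sup>+s. ennreal (exp (- (c + r) * s)) \<partial>gamma_measure m)"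
      using AE_gamma_measure_nonneg[OF assms(1)]
    proof eventually_elim
      case (elim r)
      then show ?case using assms m by (intro gamma_measure_laplace[symmetric]) auto
    qed
  qed
  also have "\<dots> = (\<integral>\<^sup>+s. \<integral>\<^sup>+r. ennreal (exp (- (c + r) * s)) \<partial>gamma_measure \<beta> \<partial>gamma_measure m)"
    by (rule Fubini'[symmetric]) measurable
  also have "\<dots> = (\<integral>\<^sup>+s. ennreal (exp (- c * s) * s powr (- \<beta>)) \<partial>gamma_measure m)"
  proof (rule nn_integral_cong_AE)
    show "AE s in gamma_measure m. (\<integral>\<^sup>+r. ennreal (exp (- (c + r) * s)) \<partial>gamma_measure \<beta>) = ennreal (exp (- c * s) * s powr (- \<beta>))"
      using AE_gamma_measure[OF m]
    proof eventually_elim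
      case (elim s)
      have "(\<integral>\<^sup>+r. ennreal (exp (- (c + r) * s)) \<partial>gamma_measure \<beta>) = (\<integral>\<^sup>+r. ennreal (exp (- c * s)) * ennreal (exp (- s * r)) \<partial>gamma_measure \<beta>)"
        by (intro nn_integral_cong) (simp add: algebra_simps exp_add flip: ennreal_mult exp_add)
      then show ?case
        using elim assms by (simp add: nn_integral_cmult gamma_measure_laplace[of \<beta> s, simplified] ennreal_mult)
    qed
  qed
  also have "\<dots> = (\<integral>\<^sup>+s. ennreal (Gamma (m - \<beta>) / Gamma m) * (ennreal (indicator {0<..} s * s powr (m - \<beta> - 1) / Gamma (m - \<beta>)) * ennreal (exp (- c * s))) \<partial>lborel)"
    using m assms G
    by (subst nn_integral_gamma_measure)
       (auto intro!: nn_integral_cong simp: indicator_def powr_diff powr_minus field_simps powr_mult_base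
          simp flip: ennreal_mult)
  also have "\<dots> = ennreal (Gamma (m - \<beta>) / Gamma m) * ennreal (c powr (- (m - \<beta>)))"
    using assms gamma_measure_laplace[of "m - \<beta>" c]
    by (simp add: nn_integral_cmult nn_integral_gamma_measure)
  also have "\<dots> = ennreal (Gamma (m - \<beta>) / Gamma m * c powr (\<beta> - m))"
    using assms G by (simp flip: ennreal_mult)
  finally show ?thesis .
qed

section \<open>Test functions for the distributional equation\<close>

definition bessel_gaussian :: "real \<Rightarrow> real \<Rightarrow> real^'n \<Rightarrow> real^'n \<Rightarrow> complex" where
  "bessel_gaussian \<gamma> \<tau> a \<xi> = of_real ((1 + (norm \<xi>)\<^sup>2) powr \<gamma> * exp (- \<tau> * (1 + (norm \<xi>)\<^sup>2))) * cis (a \<bullet> \<xi>)"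

text \<open>A derivative of \<open>bessel_gaussian\<close> brings in coordinate factors and lowers
  \<gamma>. The three rules generate a set that is closed under partial derivatives, so that decay
  of its members gives decay of all their derivatives.\<close>

inductive_set gaussian_class :: "real \<Rightarrow> real^'n \<Rightarrow> (real^'n \<Rightarrow> complex) set" for \<tau> a where
  base: "(\<lambda>\<xi>. c * bessel_gaussian \<gamma> \<tau> a \<xi>) \<in> gaussian_class \<tau> a"
| coord: "f \<in> gaussian_class \<tau> a \<Longrightarrow> (\<lambda>\<xi>. of_real (\<xi> $ i) * f \<xi>) \<in> gaussian_class \<tau> a"
| add: "f \<in> gaussian_class \<tau> a \<Longrightarrow> g \<in> gaussian_class \<tau> a \<Longrightarrow> (\<lambda>\<xi>. f \<xi> + g \<xi>) \<in> gaussian_class \<tau> a"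

lemma bessel_gaussian_has_derivative:
  "(bessel_gaussian \<gamma> \<tau> a has_derivative
     (\<lambda>v. (of_real (2 * \<gamma> * (\<xi> \<bullet> v)) * bessel_gaussian (\<gamma> - 1) \<tau> a \<xi>
       + of_real (- 2 * \<tau> * (\<xi> \<bullet> v)) * bessel_gaussian \<gamma> \<tau> a \<xi>)
       + \<i> * of_real (a \<bullet> v) * bessel_gaussian \<gamma> \<tau> a \<xi>)) (at \<xi>)"
proof -
  have pos: "0 < 1 + (norm \<xi>)\<^sup>2" for \<xi> :: "real^'n" by (simp add: add_pos_nonneg)
  have l: "((\<lambda>\<xi>. 1 + (norm \<xi>)\<^sup>2) has_derivative (\<lambda>v. 2 * (\<xi> \<bullet> v))) (at \<xi>)"
    unfolding power2_norm_eq_inner by (auto intro!: derivative_eq_intros simp: inner_commute)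
  have A: "((\<lambda>t. t powr \<gamma> * exp (- \<tau> * t)) has_real_derivative
       (\<gamma> * t powr (\<gamma> - 1) - \<tau> * t powr \<gamma>) * exp (- \<tau> * t)) (at t)" if "t > 0" for t
    using that by (auto intro!: derivative_eq_intros simp: algebra_simps)
  have "((\<lambda>\<xi>. (1 + (norm \<xi>)\<^sup>2) powr \<gamma> * exp (- \<tau> * (1 + (norm \<xi>)\<^sup>2))) has_derivative
      (\<lambda>v. ((\<gamma> * (1 + (norm \<xi>)\<^sup>2) powr (\<gamma> - 1) - \<tau> * (1 + (norm \<xi>)\<^sup>2) powr \<gamma>) * exp (- \<tau> * (1 + (norm \<xi>)\<^sup>2))) * (2 * (\<xi> \<bullet> v)))) (at \<xi>)"
    using has_derivative_compose[OF l has_field_derivative_imp_has_derivative[OF A[OF pos]]] by simp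
  then have R: "((\<lambda>\<xi>. complex_of_real ((1 + (norm \<xi>)\<^sup>2) powr \<gamma> * exp (- \<tau> * (1 + (norm \<xi>)\<^sup>2)))) has_derivative
      (\<lambda>v. of_real (((\<gamma> * (1 + (norm \<xi>)\<^sup>2) powr (\<gamma> - 1) - \<tau> * (1 + (norm \<xi>)\<^sup>2) powr \<gamma>) * exp (- \<tau> * (1 + (norm \<xi>)\<^sup>2))) * (2 * (\<xi> \<bullet> v))))) (at \<xi>)"
    by (rule has_derivative_of_real)
  have C: "((\<lambda>\<xi>. cis (a \<bullet> \<xi>)) has_derivative (\<lambda>v. (a \<bullet> v) *\<^sub>R (\<i> * cis (a \<bullet> \<xi>)))) (at \<xi>)"
  proof -
    have "((\<lambda>t. cis t) has_vector_derivative \<i> * cis t) (at t)" for t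
      unfolding cis_conv_exp by (auto intro!: derivative_eq_intros)
    then have "((\<lambda>t. cis t) has_derivative (\<lambda>s. s *\<^sub>R (\<i> * cis t))) (at t)" for t
      by (simp add: has_vector_derivative_def)
    moreover have "((\<lambda>\<xi>. a \<bullet> \<xi>) has_derivative (\<lambda>v. a \<bullet> v)) (at \<xi>)"
      by (auto intro!: derivative_eq_intros)
    ultimately show ?thesis by (rule has_derivative_compose[rotated])
  qed
  show ?thesis
    unfolding bessel_gaussian_def[abs_def]
    by (rule has_derivative_eq_rhs[OF has_derivative_mult[OF R C]])
       (simp add: fun_eq_iff scaleR_conv_of_real algebra_simps)
qed

lemma gaussian_class_cmult: "f \<in> gaussian_class \<tau> a \<Longrightarrow> (\<lambda>\<xi>. c * f \<xi>) \<in> gaussian_class \<tau> a"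
proof (induction rule: gaussian_class.induct)
  case (base d \<gamma>)
  then show ?case using gaussian_class.base[of "c * d" \<gamma> \<tau> a] by (simp add: mult.assoc)
next
  case (coord f i)
  then show ?case using gaussian_class.coord[of "\<lambda>\<xi>. c * f \<xi>" \<tau> a i] by (simp add: mult.left_commute)
next
  case (add f g)
  then show ?case using gaussian_class.add[of "\<lambda>\<xi>. c * f \<xi>" \<tau> a "\<lambda>\<xi>. c * g \<xi>"] by (simp add: distrib_left)
qed

lemma gaussian_class_derivative:
  fixes f :: "real^'n \<Rightarrow> complex"
  assumes "f \<in> gaussian_class \<tau> a"
  shows "\<exists>f'. (\<forall>x. (f has_derivative f' x) (at x)) \<and> (\<forall>i. (\<lambda>x. f' x (axis i 1)) \<in> gaussian_class \<tau> a)"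
  using assms
proof (induction rule: gaussian_class.induct)
  case (base c \<gamma>)
  let ?f' = "\<lambda>\<xi> v. c * ((of_real (2 * \<gamma> * (\<xi> \<bullet> v)) * bessel_gaussian (\<gamma> - 1) \<tau> a \<xi>
       + of_real (- 2 * \<tau> * (\<xi> \<bullet> v)) * bessel_gaussian \<gamma> \<tau> a \<xi>)
       + \<i> * of_real (a \<bullet> v) * bessel_gaussian \<gamma> \<tau> a \<xi>)"
  have "((\<lambda>\<xi>. c * bessel_gaussian \<gamma> \<tau> a \<xi>) has_derivative ?f' x) (at x)" for x
    by (intro has_derivative_mult_right bessel_gaussian_has_derivative)
  moreover have "(\<lambda>\<xi>. ?f' \<xi> (axis i 1)) \<in> gaussian_class \<tau> a" for i
  proof -
    have "(\<lambda>\<xi>. (of_real (\<xi> $ i) * ((c * of_real (2 * \<gamma>)) * bessel_gaussian (\<gamma> - 1) \<tau> a \<xi>)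
       + of_real (\<xi> $ i) * ((c * of_real (- 2 * \<tau>)) * bessel_gaussian \<gamma> \<tau> a \<xi>))
       + (c * \<i> * of_real (a $ i)) * bessel_gaussian \<gamma> \<tau> a \<xi>) \<in> gaussian_class \<tau> a"
      by (intro gaussian_class.intros)
    then show ?thesis by (simp add: inner_axis algebra_simps)
  qed
  ultimately show ?case by (intro exI[of _ ?f']) blast
next
  case (coord f i)
  then obtain f' where f': "\<And>x. (f has_derivative f' x) (at x)" "\<And>i. (\<lambda>x. f' x (axis i 1)) \<in> gaussian_class \<tau> a"
    by blast
  let ?f' = "\<lambda>\<xi> v. of_real (\<xi> $ i) * f' \<xi> v + of_real (v $ i) * f \<xi>"
  have "((\<lambda>\<xi>. of_real (\<xi> $ i) * f \<xi>) has_derivative ?f' x) (at x)" for x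
    by (intro has_derivative_mult f' has_derivative_of_real bounded_linear_imp_has_derivative bounded_linear_vec_nth)
  moreover have "(\<lambda>\<xi>. ?f' \<xi> (axis j 1)) \<in> gaussian_class \<tau> a" for j
    using f'(2) coord by (intro gaussian_class.intros gaussian_class_cmult)
  ultimately show ?case by (intro exI[of _ ?f']) blast
next
  case (add f g)
  then obtain f' g' where f': "\<And>x. (f has_derivative f' x) (at x)" "\<And>i. (\<lambda>x. f' x (axis i 1)) \<in> gaussian_class \<tau> a"
   "\<And>x. (g has_derivative g' x) (at x)" "\<And>i. (\<lambda>x. g' x (axis i 1)) \<in> gaussian_class \<tau> a"
    by blast
  then show ?case
    by (intro exI[of _ "\<lambda>\<xi> v. f' \<xi> v + g' \<xi> v"] conjI allI has_derivative_add gaussian_class.intros)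
qed

lemma bessel_gaussian_decay:
  assumes "0 < \<tau>"
  shows "\<exists>C. \<forall>x. norm x ^ m * norm (bessel_gaussian \<gamma> \<tau> a x) \<le> C"
proof -
  \<comment> \<open>An integer that is at least m + \<gamma>, and positive so that it can be divided
    by.\<close>
  define k where "k = m + nat \<lceil>\<gamma>\<rceil> + 1"
  have k: "0 < real k" "real m + \<gamma> \<le> real k" unfolding k_def by linarith+
  have "norm x ^ m * norm (bessel_gaussian \<gamma> \<tau> a x) \<le> (real k / \<tau>) ^ k" for x
  proof -
    define t where "t = 1 + (norm x)\<^sup>2"
    have t: "1 \<le> t" by (simp add: t_def)
    have "0 \<le> (norm x - 1)\<^sup>2" by simp
    then have "norm x \<le> t"
      unfolding t_def using norm_ge_zero[of x] by (simp add: power2_eq_square algebra_simps) (smt (verit) norm_ge_zero)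
    then have "norm x ^ m \<le> t ^ m" by (intro power_mono) auto
    then have "norm x ^ m * norm (bessel_gaussian \<gamma> \<tau> a x) \<le> t ^ m * (t powr \<gamma> * exp (- \<tau> * t))"
      by (simp add: bessel_gaussian_def norm_mult t_def[symmetric] abs_mult) (intro mult_right_mono, auto)
    also have "\<dots> = t powr (real m + \<gamma>) * exp (- \<tau> * t)"
      using t by (simp add: powr_add powr_realpow)
    also have "\<dots> \<le> t powr (real k) * exp (- \<tau> * t)"
      using t k by (intro mult_right_mono powr_mono) auto
    also have "\<dots> = t ^ k * exp (- \<tau> * t)"
      using t by (simp add: powr_realpow)
    also have "\<dots> \<le> (real k / \<tau>) ^ k * exp (\<tau> * t) * exp (- \<tau> * t)"
    proof (intro mult_right_mono)
      \<comment> \<open>y \<le> e^y at y = \<tau> t / k, raised to the power k, gives t^k \<le>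
        (k/\<tau>)^k e^(\<tau> t).\<close>
      have "\<tau> * t / k \<le> exp (\<tau> * t / k)"
        using exp_ge_add_one_self[of "\<tau> * t / k"] by linarith
      then have "t \<le> (real k / \<tau>) * exp (\<tau> * t / k)"
        using assms k by (simp add: field_simps)
      then have "t ^ k \<le> ((real k / \<tau>) * exp (\<tau> * t / k)) ^ k"
        using t by (intro power_mono) auto
      also have "\<dots> = (real k / \<tau>) ^ k * exp (\<tau> * t)"
      proof -
        have "exp (\<tau> * t / k) ^ k = exp (\<tau> * t)"
          using k by (simp flip: exp_of_nat_mult)
        then show ?thesis by (simp only: power_mult_distrib)
      qed
      finally show "t ^ k \<le> (real k / \<tau>) ^ k * exp (\<tau> * t)" .
    qed auto
    also have "\<dots> = (real k / \<tau>) ^ k" by (simp add: mult.assoc flip: exp_add)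
    finally show ?thesis .
  qed
  then show ?thesis by blast
qed

lemma gaussian_class_decay:
  assumes "f \<in> gaussian_class \<tau> a" "0 < \<tau>"
  shows "\<exists>C. \<forall>x. norm x ^ m * norm (f x) \<le> C"
  using assms(1)
proof (induction arbitrary: m rule: gaussian_class.induct)
  case (base c \<gamma>)
  obtain C where C: "\<And>x. norm x ^ m * norm (bessel_gaussian \<gamma> \<tau> a x) \<le> C"
    using bessel_gaussian_decay[OF assms(2)] by metis
  have "norm x ^ m * norm (c * bessel_gaussian \<gamma> \<tau> a x) \<le> norm c * C" for x
    using mult_left_mono[OF C[of x], of "norm c"] by (simp add: norm_mult mult.left_commute)
  then show ?case by blast
next
  case (coord f i)
  obtain C where C: "\<And>x. norm x ^ Suc m * norm (f x) \<le> C"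
    using coord.IH[of "Suc m"] by metis
  have "norm x ^ m * norm (of_real (x $ i) * f x) \<le> C" for x
  proof -
    have "norm x ^ m * norm (of_real (x $ i) * f x) \<le> norm x ^ m * (norm x * norm (f x))"
      by (simp add: norm_mult mult_left_mono mult_right_mono component_le_norm_cart)
    then show ?thesis using C[of x] by (simp add: mult_ac)
  qed
  then show ?case by blast
next
  case (add f g)
  obtain C D where C: "\<And>x. norm x ^ m * norm (f x) \<le> C" and D: "\<And>x. norm x ^ m * norm (g x) \<le> D"
    using add.IH by metis
  have "norm x ^ m * norm (f x + g x) \<le> C + D" for x
  proof -
    have "norm x ^ m * norm (f x + g x) \<le> norm x ^ m * (norm (f x) + norm (g x))"
      by (intro mult_left_mono norm_triangle_ineq) auto
    then show ?thesis using C[of x] D[of x] by (simp add: distrib_left)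
  qed
  then show ?case by blast
qed

lemma gaussian_class_schwartz:
  fixes f :: "real^'n \<Rightarrow> complex"
  assumes "f \<in> gaussian_class \<tau> a" "0 < \<tau>"
  shows "f \<in> schwartz"
proof -
  have "iterated_partial is f \<in> gaussian_class \<tau> a" for "is"
  proof (induction "is")
    case Nil
    then show ?case using assms by simp
  next
    case (Cons i "is")
    obtain f' where f': "\<And>x. (iterated_partial is f has_derivative f' x) (at x)"
        "\<And>i. (\<lambda>x. f' x (axis i 1)) \<in> gaussian_class \<tau> a"
      using gaussian_class_derivative[OF Cons] by blast
    have "frechet_derivative (iterated_partial is f) (at x) = f' x" for x
      using frechet_derivative_at[OF f'(1)] by simp
    then show ?case using f'(2) by simp
  qed
  then show ?thesis
    unfolding schwartz_def
    using gaussian_class_derivative gaussian_class_decay[OF _ assms(2)] differentiableI by blast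
qed

lemma bessel_gaussian_schwartz: "0 < \<tau> \<Longrightarrow> bessel_gaussian \<gamma> \<tau> a \<in> schwartz"
  using gaussian_class_schwartz[OF gaussian_class.base[of 1]] by simp


lemma bessel_symbol_mult_gaussian:
  "bessel_symbol s \<xi> * bessel_gaussian (- s / 2) \<tau> a \<xi> = bessel_gaussian 0 \<tau> a \<xi>"
proof -
  have "0 < 1 + (norm \<xi>)\<^sup>2" by (simp add: add_pos_nonneg)
  then have "(1 + (norm \<xi>)\<^sup>2) powr (s / 2) * (1 + (norm \<xi>)\<^sup>2) powr (- s / 2) = 1"
    by (simp flip: powr_add)
  then show ?thesis
    using \<open>0 < 1 + (norm \<xi>)\<^sup>2\<close>
    by (simp add: bessel_symbol_def bessel_gaussian_def mult.assoc[symmetric] flip: of_real_mult)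
qed

text \<open>The multiplier of \<open>heat \<tau>\<close> with a phase transforms into the kernel at
  a - y. As \<open>fourier\<close> carries no normalization, (2 pi)^N appears; it occurs on both
  sides of the tested equation and cancels there.\<close>

lemma fourier_bessel_gaussian_0:
  assumes "0 < \<tau>"
  shows "fourier (bessel_gaussian 0 \<tau> a) y = of_real ((2 * pi) powr CARD('n) * heat_kernel \<tau> (a - (y::real^'n)))"
proof -
  have nz: "1 + (norm \<xi>)\<^sup>2 \<noteq> 0" for \<xi> :: "real^'n" by (smt (verit) zero_le_power2)
  have "cis (- (\<xi> \<bullet> y)) * bessel_gaussian 0 \<tau> a \<xi>
     = of_real (exp (- \<tau>)) * (of_real (exp (- \<tau> * (norm \<xi>)\<^sup>2)) * cis ((a - y) \<bullet> \<xi>))" for \<xi>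
  proof -
    have "cis (- (\<xi> \<bullet> y)) * cis (a \<bullet> \<xi>) = cis ((a - y) \<bullet> \<xi>)"
      by (simp add: cis_mult inner_diff_left inner_commute[of \<xi> y])
    moreover have "exp (- \<tau> * (1 + (norm \<xi>)\<^sup>2)) = exp (- \<tau>) * exp (- \<tau> * (norm \<xi>)\<^sup>2)"
      by (simp add: algebra_simps flip: exp_add)
    ultimately show ?thesis
      using nz[of \<xi>] by (simp add: bessel_gaussian_def mult_ac)
  qed
  then have "fourier (bessel_gaussian 0 \<tau> a) y
    = of_real (exp (- \<tau>)) * of_real ((pi / \<tau>) powr (CARD('n) / 2) * exp (- (norm (a - y))\<^sup>2 / (4 * \<tau>)))"
    using gaussian_fourier[OF assms, of "a - y"] unfolding fourier_def
    by (simp add: has_bochner_integral_iff)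
  moreover have "(pi / \<tau>) powr (CARD('n) / 2) = (2 * pi) powr CARD('n) * (4 * pi * \<tau>) powr (- (CARD('n) / 2))"
  proof -
    have "(2 * pi) powr CARD('n) = ((2 * pi) powr 2) powr (CARD('n) / 2)"
      by (simp only: powr_powr) simp
    also have "(2 * pi) powr 2 = (2 * pi)\<^sup>2" by (rule powr_numeral) simp
    also have "(2 * pi)\<^sup>2 = (pi / \<tau>) * (4 * pi * \<tau>)"
      using assms by (simp add: power2_eq_square)
    also have "\<dots> powr (CARD('n) / 2) = (pi / \<tau>) powr (CARD('n) / 2) * (4 * pi * \<tau>) powr (CARD('n) / 2)"
      using assms by (intro powr_mult) 
    finally show ?thesis
      using assms by (simp add: mult.assoc flip: powr_add)
  qed
  ultimately show ?thesis
    by (simp add: heat_kernel_def mult_ac)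
qed

text \<open>The factor (1 + |\<xi>|^2)^(-\<beta>) is a Laplace transform in r, which adds r to the
  time of the Gaussian. The Fourier transform is then taken under the integral over r.\<close>

lemma fourier_bessel_gaussian:
  assumes "0 < \<tau>" "0 < \<beta>"
  shows "fourier (bessel_gaussian (- \<beta>) \<tau> a) y
    = of_real ((2 * pi) powr CARD('n)) * (LINT r|gamma_measure \<beta>. of_real (heat_kernel (\<tau> + r) (a - (y::real^'n))))"
proof -
  interpret B: sigma_finite_measure "gamma_measure \<beta>" by (rule sigma_finite_gamma_measure)
  have pos: "0 < 1 + (norm \<xi>)\<^sup>2" for \<xi> :: "real^'n" by (simp add: add_pos_nonneg)
  have exp_r: "bessel_gaussian 0 (\<tau> + r) a \<xi> = bessel_gaussian 0 \<tau> a \<xi> * of_real (exp (- (1 + (norm \<xi>)\<^sup>2) * r))" for r \<xi>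
    using pos[of \<xi>] by (simp add: bessel_gaussian_def algebra_simps exp_add exp_diff exp_minus divide_simps)
  have lap: "(LINT r|gamma_measure \<beta>. complex_of_real (exp (- (1 + (norm \<xi>)\<^sup>2) * r))) = of_real ((1 + (norm \<xi>)\<^sup>2) powr (- \<beta>))" for \<xi> :: "real^'n"
  proof -
    have "(LINT r|gamma_measure \<beta>. exp (- (1 + (norm \<xi>)\<^sup>2) * r)) = (1 + (norm \<xi>)\<^sup>2) powr (- \<beta>)"
      using gamma_measure_laplace[of \<beta>, OF _ pos[of \<xi>]] assms
      by (subst integral_eq_nn_integral) auto
    then show ?thesis by (simp only: integral_complex_of_real)
  qed
  have split: "bessel_gaussian (- \<beta>) \<tau> a \<xi> = (LINT r|gamma_measure \<beta>. bessel_gaussian 0 (\<tau> + r) a \<xi>)" for \<xi>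
    unfolding exp_r using lap[of \<xi>] pos[of \<xi>] by (simp add: bessel_gaussian_def mult_ac)
  have [measurable]: "(\<lambda>(\<xi>, r). bessel_gaussian 0 (\<tau> + r) a \<xi>) \<in> borel_measurable (borel \<Otimes>\<^sub>M borel)"
    unfolding bessel_gaussian_def cis_conv_exp by measurable
  have "fourier (bessel_gaussian (- \<beta>) \<tau> a) y
      = (LINT \<xi>|lborel. LINT r|gamma_measure \<beta>. cis (- (\<xi> \<bullet> y)) * bessel_gaussian 0 (\<tau> + r) a \<xi>)"
    by (simp add: fourier_def split)
  also have "\<dots> = (LINT r|gamma_measure \<beta>. LINT \<xi>|lborel. cis (- (\<xi> \<bullet> y)) * bessel_gaussian 0 (\<tau> + r) a \<xi>)"
  proof (rule LINT_swap)
    show "case_prod (\<lambda>\<xi> r. cis (- (\<xi> \<bullet> y)) * bessel_gaussian 0 (\<tau> + r) a \<xi>) \<in> borel_measurable (lborel \<Otimes>\<^sub>M gamma_measure \<beta>)"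
      unfolding bessel_gaussian_def cis_conv_exp by measurable
    have "(\<integral>\<^sup>+ \<xi>. \<integral>\<^sup>+ r. ennreal (norm (cis (- (\<xi> \<bullet> y)) * bessel_gaussian 0 (\<tau> + r) a \<xi>)) \<partial>gamma_measure \<beta> \<partial>lborel)
      \<le> (\<integral>\<^sup>+ \<xi>. ennreal (exp (- \<tau> * (norm (\<xi>::real^'n))\<^sup>2)) \<partial>lborel)"
    proof (rule nn_integral_mono)
      fix \<xi> :: "real^'n"
      have "(\<integral>\<^sup>+ r. ennreal (norm (cis (- (\<xi> \<bullet> y)) * bessel_gaussian 0 (\<tau> + r) a \<xi>)) \<partial>gamma_measure \<beta>)
         = (\<integral>\<^sup>+ r. ennreal (exp (- \<tau> * (1 + (norm \<xi>)\<^sup>2))) * ennreal (exp (- (1 + (norm \<xi>)\<^sup>2) * r)) \<partial>gamma_measure \<beta>)"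
        using pos[of \<xi>] unfolding exp_r
        by (intro nn_integral_cong) (simp add: norm_mult bessel_gaussian_def flip: ennreal_mult)
      also have "\<dots> = ennreal (exp (- \<tau> * (1 + (norm \<xi>)\<^sup>2))) * ennreal ((1 + (norm \<xi>)\<^sup>2) powr (- \<beta>))"
        using assms pos[of \<xi>] gamma_measure_laplace[of \<beta>, OF _ pos[of \<xi>]] by (simp add: nn_integral_cmult)
      also have "\<dots> \<le> ennreal (exp (- \<tau> * (norm \<xi>)\<^sup>2)) * ennreal 1"
        using assms by (intro mult_mono ennreal_leI) (auto simp: algebra_simps powr_minus intro!: inverse_le_1_iff[THEN iffD2] ge_one_powr_ge_zero)
      finally show "(\<integral>\<^sup>+ r. ennreal (norm (cis (- (\<xi> \<bullet> y)) * bessel_gaussian 0 (\<tau> + r) a \<xi>)) \<partial>gamma_measure \<beta>)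
         \<le> ennreal (exp (- \<tau> * (norm \<xi>)\<^sup>2))" by simp
    qed
    also have "\<dots> < \<infinity>" unfolding nn_integral_gaussian[OF assms(1)] by simp
    finally show "(\<integral>\<^sup>+ \<xi>. \<integral>\<^sup>+ r. ennreal (norm (cis (- (\<xi> \<bullet> y)) * bessel_gaussian 0 (\<tau> + r) a \<xi>)) \<partial>gamma_measure \<beta> \<partial>lborel) < \<infinity>" .
  qed (auto intro: sigma_finite_lborel sigma_finite_gamma_measure)
  also have "\<dots> = (LINT r|gamma_measure \<beta>. of_real ((2 * pi) powr CARD('n)) * of_real (heat_kernel (\<tau> + r) (a - y)))"
  proof (rule integral_cong_AE)
    show "AE r in gamma_measure \<beta>. (LINT \<xi>|lborel. cis (- (\<xi> \<bullet> y)) * bessel_gaussian 0 (\<tau> + r) a \<xi>)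
       = of_real ((2 * pi) powr CARD('n)) * of_real (heat_kernel (\<tau> + r) (a - y))"
      using AE_gamma_measure[OF assms(2)]
    proof eventually_elim
      case (elim r)
      then show ?case
        using fourier_bessel_gaussian_0[of "\<tau> + r" a y] assms by (simp add: fourier_def)
    qed
    show "(\<lambda>r. LINT \<xi>|lborel. cis (- (\<xi> \<bullet> y)) * bessel_gaussian 0 (\<tau> + r) a \<xi>) \<in> borel_measurable (gamma_measure \<beta>)"
      unfolding bessel_gaussian_def cis_conv_exp by measurable
  qed measurable
  finally show ?thesis by simp
qed

text \<open>The dependence on r is separated as exp(-r), which \<open>gamma_measure\<close>
  integrates. For g in L^p this justifies exchanging the integrals over y and r.\<close>

lemma nn_integral_heat_add_le:
  fixes g :: "real^'n \<Rightarrow> complex"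
  assumes [measurable]: "g \<in> borel_measurable borel" and "0 < \<tau>" "0 \<le> r" "1 \<le> p"
  shows "(\<integral>\<^sup>+ y. ennreal (norm (of_real (heat_kernel (\<tau> + r) (x - y)) * g y)) \<partial>lborel)
    \<le> (1 + ennreal ((4 * pi * \<tau>) powr (- (CARD('n) / 2))) * lpow p g) * ennreal (exp (- 1 * r))"
proof -
  have "(\<integral>\<^sup>+ y. ennreal (norm (of_real (heat_kernel (\<tau> + r) (x - y)) * g y)) \<partial>lborel)
      = (\<integral>\<^sup>+ y. ennreal (heat_kernel (\<tau> + r) (x - y) * norm (g y)) \<partial>lborel)"
      by (simp add: norm_mult heat_kernel_nonneg)
  also have "\<dots> \<le> ennreal (exp (- (\<tau> + r))) + ennreal (exp (- (\<tau> + r)) * (4 * pi * (\<tau> + r)) powr (- (CARD('n) / 2))) * lpow p g"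
      using assms by (intro nn_integral_heat_le) auto
  also have "\<dots> \<le> ennreal (exp (- 1 * r)) + ennreal (exp (- 1 * r) * (4 * pi * \<tau>) powr (- (CARD('n) / 2))) * lpow p g"
      using assms by (intro add_mono mult_right_mono ennreal_leI mult_mono powr_mono2') auto
  also have "\<dots> = (1 + ennreal ((4 * pi * \<tau>) powr (- (CARD('n) / 2))) * lpow p g) * ennreal (exp (- 1 * r))"
      by (simp add: ennreal_mult distrib_right distrib_left mult_ac)
  finally show ?thesis .
qed

text \<open>The distributional equation \<open>(1 - \<Delta>)\<^bsup>s/2\<^esup> f = g\<close> is tested with
  \<open>bessel_gaussian (- s / 2) \<tau> x\<close>, for which both sides are integrals against heat kernels.\<close>

lemma bessel_derivative_heat:
  fixes f g :: "real^'n \<Rightarrow> complex"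
  assumes f: "f \<in> elems (Lp p)" and g: "g \<in> elems (Lp p)" and "1 < p" "0 < s" "0 < \<tau>"
    and D: "is_bessel_derivative s f g"
  shows "heat \<tau> f x = (LINT r|gamma_measure (s / 2). heat (\<tau> + r) g x)"
proof -
  let ?M = "gamma_measure (s / 2)"
  let ?c = "(2 * pi) powr CARD('n)"
  have b: "0 < s / 2" using assms by simp
  interpret B: sigma_finite_measure ?M by (rule sigma_finite_gamma_measure)
  have [measurable]: "f \<in> borel_measurable borel" "g \<in> borel_measurable borel"
    using f g Lp_measurable by auto
  have "(LINT y|lborel. f y * fourier (\<lambda>\<xi>. bessel_symbol s \<xi> * bessel_gaussian (- s / 2) \<tau> x \<xi>) y)
      = (LINT y|lborel. g y * fourier (bessel_gaussian (- s / 2) \<tau> x) y)"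
    using D bessel_gaussian_schwartz[OF assms(5), of "- s / 2" x]
    unfolding is_bessel_derivative_def mult_dist_def fourier_dist_def regular_dist_def by blast
  moreover have "(LINT y|lborel. f y * fourier (\<lambda>\<xi>. bessel_symbol s \<xi> * bessel_gaussian (- s / 2) \<tau> x \<xi>) y)
     = of_real ?c * heat \<tau> f x"
    using assms unfolding bessel_symbol_mult_gaussian
    by (simp add: fourier_bessel_gaussian_0 heat_def mult_ac flip: integral_mult_right_zero)
  moreover have "(LINT y|lborel. g y * fourier (bessel_gaussian (- s / 2) \<tau> x) y)
     = of_real ?c * (LINT y|lborel. LINT r|?M. of_real (heat_kernel (\<tau> + r) (x - y)) * g y)"
  proof -
    have "g y * fourier (bessel_gaussian (- s / 2) \<tau> x) y
       = of_real ?c * (LINT r|?M. of_real (heat_kernel (\<tau> + r) (x - y)) * g y)" for y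
      unfolding integral_mult_left_zero
      using fourier_bessel_gaussian[OF assms(5) b, of x y] by (simp only: minus_divide_left mult_ac)
    then show ?thesis by (simp only: integral_mult_right_zero)
  qed
  moreover have "(LINT y|lborel. LINT r|?M. of_real (heat_kernel (\<tau> + r) (x - y)) * g y)
     = (LINT r|?M. LINT y|lborel. of_real (heat_kernel (\<tau> + r) (x - y)) * g y)"
  proof (rule LINT_swap)
    interpret P: pair_sigma_finite ?M "lborel :: (real^'n) measure" ..
    have "(\<integral>\<^sup>+ y. \<integral>\<^sup>+ r. ennreal (norm (of_real (heat_kernel (\<tau> + r) (x - y)) * g y)) \<partial>?M \<partial>lborel)
      = (\<integral>\<^sup>+ r. \<integral>\<^sup>+ y. ennreal (norm (of_real (heat_kernel (\<tau> + r) (x - y)) * g y)) \<partial>lborel \<partial>?M)"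
      by (rule P.Fubini') measurable
    also have "\<dots> \<le> (\<integral>\<^sup>+ r. (1 + ennreal ((4 * pi * \<tau>) powr (- (CARD('n) / 2))) * lpow p g) * ennreal (exp (- 1 * r)) \<partial>?M)"
    proof (rule nn_integral_mono_AE)
      show "AE r in ?M. (\<integral>\<^sup>+ y. ennreal (norm (of_real (heat_kernel (\<tau> + r) (x - y)) * g y)) \<partial>lborel)
        \<le> (1 + ennreal ((4 * pi * \<tau>) powr (- (CARD('n) / 2))) * lpow p g) * ennreal (exp (- 1 * r))"
        using AE_gamma_measure[OF b]
      proof eventually_elim
        case (elim r)
        then show ?case using assms by (intro nn_integral_heat_add_le) auto
      qed
    qed
    also have "\<dots> = (1 + ennreal ((4 * pi * \<tau>) powr (- (CARD('n) / 2))) * lpow p g) * ennreal (1 powr (- (s / 2)))"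
      using b gamma_measure_laplace[of "s / 2" 1] by (subst nn_integral_cmult) auto
    also have "\<dots> < \<infinity>"
      using g by (simp add: Lp_elems_iff ennreal_mult_less_top)
    finally show "(\<integral>\<^sup>+ y. \<integral>\<^sup>+ r. ennreal (norm (of_real (heat_kernel (\<tau> + r) (x - y)) * g y)) \<partial>?M \<partial>lborel) < \<infinity>" .
  qed (auto intro: sigma_finite_lborel sigma_finite_gamma_measure)
  moreover have "(LINT r|?M. LINT y|lborel. of_real (heat_kernel (\<tau> + r) (x - y)) * g y) = (LINT r|?M. heat (\<tau> + r) g x)"
  proof (rule integral_cong_AE)
    show "AE r in ?M. (LINT y|lborel. of_real (heat_kernel (\<tau> + r) (x - y)) * g y) = heat (\<tau> + r) g x"
      using AE_gamma_measure[OF b] by eventually_elim (use assms in \<open>simp add: heat_def\<close>)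
  qed measurable
  ultimately have "of_real ?c * heat \<tau> f x = of_real ?c * (LINT r|?M. heat (\<tau> + r) g x)"
    by simp
  then show ?thesis by simp
qed

section \<open>Norm inequalities up to constants\<close>

lemma Lp_fnorm_le_mult:
  assumes "f \<in> elems (Lp p)" "g \<in> elems (Lp p)" "0 < p" "0 \<le> B"
    and "lpow p f \<le> ennreal (B powr p) * lpow p g"
  shows "fnorm (Lp p) f \<le> B * fnorm (Lp p) g"
proof (rule fnorm_le_of_lpow_le[OF assms(1,3)])
  have "ennreal (B powr p) * lpow p g = ennreal ((B * fnorm (Lp p) g) powr p)"
    using assms by (simp add: lpow_eq_fnorm powr_mult Lp_fnorm_nonneg ennreal_mult)
  then show "lpow p f \<le> ennreal ((B * fnorm (Lp p) g) powr p)" using assms by simp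
  show "0 \<le> B * fnorm (Lp p) g" using assms(4) by (simp add: Lp_fnorm_nonneg)
qed

text \<open>4^p = 2^p 2^p absorbs the constant of \<open>lpow_add\<close> and the factor 2 in a^p +
  b^p \<le> 2 (a + b)^p.\<close>

lemma Lp_fnorm_add_le:
  assumes "f \<in> elems (Lp p)" "g \<in> elems (Lp p)" "1 < p"
  shows "fnorm (Lp p) (\<lambda>x. f x + g x) \<le> 4 * (fnorm (Lp p) f + fnorm (Lp p) g)"
proof (rule fnorm_le_of_lpow_le)
  let ?a = "fnorm (Lp p) f" and ?b = "fnorm (Lp p) g"
  have nn: "0 \<le> ?a" "0 \<le> ?b" by (simp_all add: Lp_fnorm_nonneg)
  have [measurable]: "f \<in> borel_measurable borel" "g \<in> borel_measurable borel"
    using assms Lp_measurable by auto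
  have "lpow p (\<lambda>x. f x + g x) \<le> ennreal (2 powr p) * (lpow p f + lpow p g)"
    using assms by (intro lpow_add) auto
  also have "\<dots> = ennreal (2 powr p * (?a powr p + ?b powr p))"
    using assms by (simp add: lpow_eq_fnorm flip: ennreal_plus ennreal_mult)
  also have "\<dots> \<le> ennreal ((4 * (?a + ?b)) powr p)"
  proof (rule ennreal_leI)
    have "?a powr p + ?b powr p \<le> 2 * (?a + ?b) powr p"
      using assms nn powr_mono2[of p ?a "?a + ?b"] powr_mono2[of p ?b "?a + ?b"] by simp
    also have "\<dots> \<le> 2 powr p * (?a + ?b) powr p"
      using assms powr_mono[of 1 p 2] by (intro mult_right_mono) auto
    finally have "2 powr p * (?a powr p + ?b powr p) \<le> 2 powr p * (2 powr p * (?a + ?b) powr p)"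
      by (intro mult_left_mono) auto
    also have "\<dots> = (4 * (?a + ?b)) powr p"
      using powr_mult[of 4 "?a + ?b" p] powr_mult[of 2 2 p] by simp
    finally show "2 powr p * (?a powr p + ?b powr p) \<le> (4 * (?a + ?b)) powr p" .
  qed
  finally show "lpow p (\<lambda>x. f x + g x) \<le> ennreal ((4 * (?a + ?b)) powr p)" .
qed (use assms Lp_fnorm_nonneg in \<open>auto intro!: Lp_add add_nonneg_nonneg\<close>)

text \<open>\<open>a = (1 - \<Delta>)\<^bsup>-\<sigma>/2\<^esup> g\<close>, stated for the smoothings of \<open>a\<close> and \<open>g\<close>.\<close>

definition bessel_potential_of :: "real \<Rightarrow> real \<Rightarrow> (real^'n \<Rightarrow> complex) \<Rightarrow> (real^'n \<Rightarrow> complex) \<Rightarrow> bool" where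
  "bessel_potential_of \<sigma> p g a \<longleftrightarrow> a \<in> elems (Lp p) \<and> g \<in> elems (Lp p) \<and>
     (\<forall>\<tau>>0. \<forall>x. heat \<tau> a x = (LINT r|gamma_measure (\<sigma> / 2). heat (\<tau> + r) g x))"

lemma sobolev_bessel_potential:
  assumes "a \<in> elems (sobolev \<sigma> p)" "0 \<le> \<sigma>" "1 < p"
  obtains g where "bessel_potential_of \<sigma> p g a" "fnorm (sobolev \<sigma> p) a = fnorm (Lp p) g"
proof (cases "\<sigma> = 0")
  \<comment> \<open>\<open>gamma_measure 0\<close> is the point mass at 0, so g = a works and the
    exponent 0 is treated like the others.\<close>
  case True
  have [measurable]: "a \<in> borel_measurable borel"
    using assms True Lp_measurable by (auto simp: sobolev_def)
  have "(LINT r|return borel 0. heat (\<tau> + r) a x) = heat (\<tau> + 0) a x" for \<tau> x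
    by (intro integral_return) auto
  then have "bessel_potential_of \<sigma> p a a"
    using True assms by (simp add: bessel_potential_of_def sobolev_def gamma_measure_def)
  then show ?thesis using that True by (simp add: sobolev_def)
next
  case False
  then have s: "0 < \<sigma>" using assms by simp
  \<comment> \<open>The function chosen in the definition of the norm, which makes the equality of
    norms immediate.\<close>
  define g where "g = (SOME g. g \<in> elems (Lp p) \<and> is_bessel_derivative \<sigma> a g)"
  have a: "a \<in> elems (Lp p)" using assms False by (simp add: sobolev_def)
  have "\<exists>g. g \<in> elems (Lp p) \<and> is_bessel_derivative \<sigma> a g"
    using assms False by (auto simp: sobolev_def)
  then have g: "g \<in> elems (Lp p)" "is_bessel_derivative \<sigma> a g"
    unfolding g_def by (metis (mono_tags, lifting) someI_ex)+
  have "bessel_potential_of \<sigma> p g a"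
    unfolding bessel_potential_of_def using bessel_derivative_heat[OF a g(1) assms(3) s _ g(2)] a g by blast
  moreover have "fnorm (sobolev \<sigma> p) a = fnorm (Lp p) g"
    using False by (simp add: sobolev_def g_def)
  ultimately show ?thesis using that by blast
qed

section \<open>Bounds for Bessel potentials\<close>

lemma sobolev_Lp:
  assumes "a \<in> elems (sobolev \<sigma> p)"
  shows "a \<in> elems (Lp p)"
  using assms by (auto simp: sobolev_def split: if_splits)

lemma sobolev_fnorm_nonneg: "0 \<le> fnorm (sobolev \<sigma> p) a"
  by (simp add: sobolev_def Lp_fnorm_nonneg)

lemma integrable_gamma_heat:
  fixes g :: "real^'n \<Rightarrow> complex"
  assumes g: "g \<in> elems (Lp p)" and "0 < \<tau>" "0 \<le> \<beta>" "1 < p"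
  shows "integrable (gamma_measure \<beta>) (\<lambda>r. heat (\<tau> + r) g x)"
  unfolding integrable_iff_bounded
proof
  have [measurable]: "g \<in> borel_measurable borel" using g Lp_measurable by auto
  show "(\<lambda>r. heat (\<tau> + r) g x) \<in> borel_measurable (gamma_measure \<beta>)" by measurable
  let ?C = "1 + ennreal ((4 * pi * \<tau>) powr (- (CARD('n) / 2))) * lpow p g"
  have "(\<integral>\<^sup>+ r. ennreal (norm (heat (\<tau> + r) g x)) \<partial>gamma_measure \<beta>)
      \<le> (\<integral>\<^sup>+ r. ?C * ennreal (exp (- 1 * r)) \<partial>gamma_measure \<beta>)"
  proof (rule nn_integral_mono_AE)
    show "AE r in gamma_measure \<beta>. ennreal (norm (heat (\<tau> + r) g x)) \<le> ?C * ennreal (exp (- 1 * r))"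
      using AE_gamma_measure_nonneg[OF assms(3)]
    proof eventually_elim
      case (elim r)
      have "ennreal (norm (heat (\<tau> + r) g x)) \<le> (\<integral>\<^sup>+ y. ennreal (norm (of_real (heat_kernel (\<tau> + r) (x - y)) * g y)) \<partial>lborel)"
        using elim assms by (simp add: heat_def integral_norm_bound_ennreal integrable_heat)
      also have "\<dots> \<le> ?C * ennreal (exp (- 1 * r))"
        using elim assms by (intro nn_integral_heat_add_le) auto
      finally show ?case .
    qed
  qed
  also have "\<dots> = ?C * ennreal (1 powr (- \<beta>))"
    using assms gamma_measure_laplace[of \<beta> 1] by (subst nn_integral_cmult) auto
  also have "\<dots> < \<infinity>"
    using g by (simp add: Lp_elems_iff ennreal_mult_less_top)
  finally show "(\<integral>\<^sup>+ r. ennreal (norm (heat (\<tau> + r) g x)) \<partial>gamma_measure \<beta>) < \<infinity>" .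
qed

text \<open>Plays the role of Minkowski's integral inequality. The potential is an integral over r
  of heat operators applied to g. If the operator at time \<tau> + r has norm of order w(r), then w
  is the right Jensen weight, and the total norm is of the order of the integral of w.\<close>

lemma bessel_potential_lpow_le:
  fixes a g :: "real^'n \<Rightarrow> complex"
  assumes B: "bessel_potential_of \<sigma> p g a" and "0 \<le> \<sigma>" "1 < p" "0 \<le> h" "0 < \<tau>"
    and [measurable]: "w \<in> borel_measurable borel" and w: "\<And>r. 0 < w r"
    and W: "(\<integral>\<^sup>+r. ennreal (w r) \<partial>gamma_measure (\<sigma> / 2)) \<le> ennreal W" "0 < W"
    and A: "0 \<le> A" "\<And>r. 0 \<le> r \<Longrightarrow> lpow p (heat_poly h P (heat (\<tau> + r) g)) \<le> ennreal (A * w r powr p) * lpow p g"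
  shows "lpow p (heat_poly h P (heat \<tau> a)) \<le> ennreal (2 powr p * W powr p * A) * lpow p g"
proof -
  let ?M = "gamma_measure (\<sigma> / 2)"
  interpret G: sigma_finite_measure ?M by (rule sigma_finite_gamma_measure)
  interpret pair_sigma_finite ?M "lborel :: (real^'n) measure" ..
  have a: "a \<in> elems (Lp p)" and g: "g \<in> elems (Lp p)"
    and rep: "\<And>t x. 0 < t \<Longrightarrow> heat t a x = (LINT r|?M. heat (t + r) g x)"
    using B by (auto simp: bessel_potential_of_def)
  have [measurable]: "a \<in> borel_measurable borel" "g \<in> borel_measurable borel"
    using a g Lp_measurable by auto
  have nonneg: "AE r in ?M. 0 \<le> r" using assms by (intro AE_gamma_measure_nonneg) simp
  \<comment> \<open>A formula that is jointly measurable in r and x for all real r. It is identified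
    with the operator applied to g for r \<ge> 0, where the measure is concentrated.\<close>
  define H where "H r x = (\<Sum>i\<le>degree P. coeff P i * heat (of_nat i * h + \<tau> + r) g x)" for r x
  have [measurable]: "(\<lambda>(r, x). H r x) \<in> borel_measurable (borel \<Otimes>\<^sub>M borel)"
    unfolding H_def by measurable
  have H: "H r = heat_poly h P (heat (\<tau> + r) g)" if "0 \<le> r" for r
    using that assms g by (simp add: fun_eq_iff H_def heat_poly_def heat_heat[where p=p] add.assoc)
  have repH: "heat_poly h P (heat \<tau> a) x = (LINT r|?M. of_real (w r) * (of_real (1 / w r) * H r x))" for x
  proof -
    have "heat_poly h P (heat \<tau> a) x = (\<Sum>i\<le>degree P. coeff P i * heat (of_nat i * h + \<tau>) a x)"
      using assms a by (simp add: heat_poly_def heat_heat[where p=p])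
    also have "\<dots> = (\<Sum>i\<le>degree P. LINT r|?M. coeff P i * heat (of_nat i * h + \<tau> + r) g x)"
      using assms by (simp add: rep add_nonneg_pos)
    also have "\<dots> = (LINT r|?M. H r x)"
      unfolding H_def using assms g
      by (intro Bochner_Integration.integral_sum[symmetric] integrable_mult_right integrable_gamma_heat[where p=p])
        (auto simp: add_nonneg_pos)
    also have "\<dots> = (LINT r|?M. of_real (w r) * (of_real (1 / w r) * H r x))"
      using w by (intro Bochner_Integration.integral_cong) (auto simp: less_imp_neq[symmetric])
    finally show ?thesis .
  qed
  have "lpow p (heat_poly h P (heat \<tau> a))
     \<le> (\<integral>\<^sup>+x. ennreal (2 powr p * W powr (p - 1)) * (\<integral>\<^sup>+r. ennreal (w r * norm (of_real (1 / w r) * H r x) powr p) \<partial>?M) \<partial>lborel)"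
    unfolding lpow_def repH using assms w
    by (intro nn_integral_mono weighted_power_mean) (auto intro: less_imp_le)
  also have "\<dots> = ennreal (2 powr p * W powr (p - 1)) * (\<integral>\<^sup>+x. \<integral>\<^sup>+r. ennreal (w r * norm (of_real (1 / w r) * H r x) powr p) \<partial>?M \<partial>lborel)"
    by (intro nn_integral_cmult) measurable
  also have "(\<integral>\<^sup>+x. \<integral>\<^sup>+r. ennreal (w r * norm (of_real (1 / w r) * H r x) powr p) \<partial>?M \<partial>lborel)
     = (\<integral>\<^sup>+r. \<integral>\<^sup>+x. ennreal (w r * norm (of_real (1 / w r) * H r x) powr p) \<partial>lborel \<partial>?M)"
    by (rule Fubini') measurable
  also have "\<dots> \<le> (\<integral>\<^sup>+r. ennreal A * lpow p g * ennreal (w r) \<partial>?M)"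
  proof (rule nn_integral_mono_AE)
    show "AE r in ?M. (\<integral>\<^sup>+x. ennreal (w r * norm (of_real (1 / w r) * H r x) powr p) \<partial>lborel) \<le> ennreal A * lpow p g * ennreal (w r)"
      using nonneg
    proof eventually_elim
      case (elim r)
      have "(\<integral>\<^sup>+x. ennreal (w r * norm (of_real (1 / w r) * H r x) powr p) \<partial>lborel)
         = (\<integral>\<^sup>+x. ennreal (w r powr (1 - p)) * ennreal (norm (H r x) powr p) \<partial>lborel)"
      proof (intro nn_integral_cong)
        fix x
        have "w r * norm (of_real (1 / w r) * H r x) powr p = w r powr (1 - p) * norm (H r x) powr p"
          using w[of r] by (simp add: norm_mult powr_mult powr_divide powr_diff norm_divide)
        then show "ennreal (w r * norm (of_real (1 / w r) * H r x) powr p) = ennreal (w r powr (1 - p)) * ennreal (norm (H r x) powr p)"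
          by (simp flip: ennreal_mult)
      qed
      also have "\<dots> = ennreal (w r powr (1 - p)) * lpow p (heat_poly h P (heat (\<tau> + r) g))"
        using elim by (simp add: nn_integral_cmult lpow_def H)
      also have "\<dots> \<le> ennreal (w r powr (1 - p)) * (ennreal (A * w r powr p) * lpow p g)"
        using elim by (intro mult_left_mono A) auto
      also have "\<dots> = ennreal (w r powr (1 - p) * (A * w r powr p)) * lpow p g"
        using A(1) by (simp add: ennreal_mult mult.assoc)
      also have "w r powr (1 - p) * (A * w r powr p) = A * w r"
        using w[of r] by (simp add: powr_diff)
      finally show ?case using A(1) w[of r] by (simp add: ennreal_mult mult_ac)
    qed
  qed
  also have "\<dots> = ennreal A * lpow p g * (\<integral>\<^sup>+r. ennreal (w r) \<partial>?M)"
    by (intro nn_integral_cmult) measurable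
  also have "\<dots> \<le> ennreal A * lpow p g * ennreal W"
    by (intro mult_left_mono W) auto
  finally have "lpow p (heat_poly h P (heat \<tau> a))
     \<le> ennreal (2 powr p * W powr (p - 1)) * (ennreal A * lpow p g * ennreal W)"
    by (simp add: mult_left_mono)
  also have "\<dots> = ennreal (2 powr p * W powr (p - 1) * A * W) * lpow p g"
    using A(1) W(2) by (simp add: ennreal_mult mult_ac)
  also have "2 powr p * W powr (p - 1) * A * W = 2 powr p * W powr p * A"
    using W(2) by (simp add: powr_diff)
  finally show ?thesis .
qed

lemma bessel_potential_heat_le:
  assumes B: "bessel_potential_of \<sigma> p g a" and "0 \<le> \<sigma>" "1 < p" "0 < \<tau>"
  shows "fnorm (Lp p) (heat \<tau> a) \<le> 4 * fnorm (Lp p) g"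
proof -
  have a: "a \<in> elems (Lp p)" and g: "g \<in> elems (Lp p)"
    using B by (auto simp: bessel_potential_of_def)
  have [measurable]: "g \<in> borel_measurable borel" using g Lp_measurable by auto
  \<comment> \<open>The polynomial 1 makes \<open>heat_poly\<close> the identity, and the weight
    exp(-r) has integral 1.\<close>
  have "lpow p (heat_poly 0 1 (heat \<tau> a)) \<le> ennreal (2 powr p * 1 powr p * 2 powr p) * lpow p g"
  proof (rule bessel_potential_lpow_le[OF B assms(2,3) _ assms(4), where w = "\<lambda>r. exp (- 1 * r)"])
    show "(\<integral>\<^sup>+r. ennreal (exp (- 1 * r)) \<partial>gamma_measure (\<sigma> / 2)) \<le> ennreal 1"
      using assms gamma_measure_laplace[of "\<sigma> / 2" 1] by simp
    show "lpow p (heat_poly 0 1 (heat (\<tau> + r) g)) \<le> ennreal (2 powr p * exp (- 1 * r) powr p) * lpow p g"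
      if "0 \<le> r" for r
    proof -
      have "lpow p (heat (\<tau> + r) g) \<le> ennreal (2 powr p * exp (- (\<tau> + r)) powr p) * lpow p g"
        using that assms by (intro lpow_heat_le) auto
      also have "\<dots> \<le> ennreal (2 powr p * exp (- 1 * r) powr p) * lpow p g"
        using that assms by (intro mult_right_mono ennreal_leI mult_left_mono powr_mono2) auto
      finally show ?thesis by simp
    qed
  qed auto
  also have "2 powr p * 1 powr p * 2 powr p = (4::real) powr p"
    using powr_mult[of 2 2 p] by simp
  finally show ?thesis
    using assms a g by (intro Lp_fnorm_le_mult heat_Lp) auto
qed

text \<open>At time h/2 + r the m-th difference has norm of order (h/(h/2 + r))^m. The integral of
  this weight against \<open>gamma_measure\<close> is c0 h^(\<sigma>/2), finite because \<sigma>/2 <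
  m.\<close>

lemma bessel_potential_difference_le:
  assumes "0 \<le> \<sigma>" "1 < p" "\<sigma> / 2 < of_nat m" "0 < m"
  obtains C where "0 < C"
    "\<And>g a h. bessel_potential_of \<sigma> p g (a::real^'n \<Rightarrow> complex) \<Longrightarrow> 0 < h \<Longrightarrow>
       fnorm (Lp p) (heat_poly h ([:1, -1:] ^ m) (heat (h / 2) a)) \<le> C * h powr (\<sigma> / 2) * fnorm (Lp p) g"
proof -
  define c0 where "c0 = Gamma (of_nat m - \<sigma> / 2) / Gamma (of_nat m) * (2::real) powr (of_nat m - \<sigma> / 2)"
  define A where "A = (2 powr p * (real (2 + CARD('n)) * of_nat m) powr p) ^ m"
  define C where "C = 2 * c0 * A powr (1 / p)"
  have c0: "0 < c0" unfolding c0_def using assms by (intro mult_pos_pos divide_pos_pos Gamma_real_pos) auto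
  have A: "0 < A" unfolding A_def using assms by (intro zero_less_power mult_pos_pos) auto
  have C: "0 < C" using c0 A by (simp add: C_def)
  have "fnorm (Lp p) (heat_poly h ([:1, -1:] ^ m) (heat (h / 2) a)) \<le> C * h powr (\<sigma> / 2) * fnorm (Lp p) g"
    if B: "bessel_potential_of \<sigma> p g a" and h: "0 < h" for g and a :: "real^'n \<Rightarrow> complex" and h
  proof -
    have a: "a \<in> elems (Lp p)" and g: "g \<in> elems (Lp p)"
      using B by (auto simp: bessel_potential_of_def)
    define w where "w r = (h / (h / 2 + \<bar>r\<bar>)) powr of_nat m" for r
    have w: "0 < w r" for r
    proof -
      have "0 < h / 2 + \<bar>r\<bar>" using h by simp
      then show ?thesis using h by (simp add: w_def)
    qed
    have W: "(\<integral>\<^sup>+r. ennreal (w r) \<partial>gamma_measure (\<sigma> / 2)) \<le> ennreal (c0 * h powr (\<sigma> / 2))"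
    proof -
      have "(\<integral>\<^sup>+r. ennreal (w r) \<partial>gamma_measure (\<sigma> / 2))
         = (\<integral>\<^sup>+r. ennreal (h powr of_nat m) * ennreal ((h / 2 + r) powr (- of_nat m)) \<partial>gamma_measure (\<sigma> / 2))"
      proof (rule nn_integral_cong_AE)
        have "AE r in gamma_measure (\<sigma> / 2). 0 \<le> r" using assms by (intro AE_gamma_measure_nonneg) simp
        then show "AE r in gamma_measure (\<sigma> / 2). ennreal (w r) = ennreal (h powr of_nat m) * ennreal ((h / 2 + r) powr (- of_nat m))"
        proof eventually_elim
          case (elim r)
          then have "w r = h powr of_nat m * (h / 2 + r) powr (- of_nat m)"
            using h by (simp add: w_def powr_divide powr_minus_divide)
          then show ?case by (simp flip: ennreal_mult)
        qed
      qed
      also have "\<dots> = ennreal (h powr of_nat m) * (\<integral>\<^sup>+r. ennreal ((h / 2 + r) powr (- of_nat m)) \<partial>gamma_measure (\<sigma> / 2))"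
        by (intro nn_integral_cmult) measurable
      also have "(\<integral>\<^sup>+r. ennreal ((h / 2 + r) powr (- of_nat m)) \<partial>gamma_measure (\<sigma> / 2))
          = ennreal (Gamma (of_nat m - \<sigma> / 2) / Gamma (of_nat m) * (h / 2) powr (\<sigma> / 2 - of_nat m))"
        using assms h by (intro nn_integral_gamma_measure_powr) auto
      also have "ennreal (h powr of_nat m) * \<dots> = ennreal (h powr of_nat m * (Gamma (of_nat m - \<sigma> / 2) / Gamma (of_nat m) * (h / 2) powr (\<sigma> / 2 - of_nat m)))"
        by (rule ennreal_mult'[symmetric]) simp
      also have "h powr of_nat m * (Gamma (of_nat m - \<sigma> / 2) / Gamma (of_nat m) * (h / 2) powr (\<sigma> / 2 - of_nat m)) = c0 * h powr (\<sigma> / 2)"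
      proof -
        have 1: "(h / 2) powr (\<sigma> / 2 - of_nat m) = h powr (\<sigma> / 2 - of_nat m) * 2 powr (of_nat m - \<sigma> / 2)"
          using powr_minus_divide[of 2 "of_nat m - \<sigma> / 2"] powr_divide[of h 2 "\<sigma> / 2 - of_nat m"]
          by (simp add: powr_minus_divide)
        have 2: "h powr of_nat m * h powr (\<sigma> / 2 - of_nat m) = h powr (\<sigma> / 2)"
          by (subst powr_add[symmetric]) simp
        show ?thesis
          unfolding 1 c0_def 2[symmetric] by (simp only: mult_ac)
      qed
      finally show ?thesis by simp
    qed
    have "lpow p (heat_poly h ([:1, -1:] ^ m) (heat (h / 2) a))
        \<le> ennreal (2 powr p * (c0 * h powr (\<sigma> / 2)) powr p * A) * lpow p g"
    proof (rule bessel_potential_lpow_le[OF B assms(1,2) _ _ _ w W])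
      show "w \<in> borel_measurable borel" unfolding w_def by measurable
      show "lpow p (heat_poly h ([:1, -1:] ^ m) (heat (h / 2 + r) g)) \<le> ennreal (A * w r powr p) * lpow p g"
        if r: "0 \<le> r" for r
      proof -
        \<comment> \<open>The smoothing time is divided equally among the m difference
          factors.\<close>
        define t where "t = (h / 2 + r) / of_nat m"
        have t: "0 < t" "h / 2 + r = of_nat m * t" using r h assms by (auto simp: t_def add_pos_nonneg)
        have "(2 powr p * (real (2 + CARD('n)) * (h / t)) powr p) ^ m = A * w r powr p"
        proof -
          have q: "0 < h / (h / 2 + r)" using h r by (simp add: add_pos_nonneg)
          have "real (2 + CARD('n)) * (h / t) = (real (2 + CARD('n)) * of_nat m) * (h / (h / 2 + r))"
            by (simp add: t_def)
          then have "2 powr p * (real (2 + CARD('n)) * (h / t)) powr p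
              = (2 powr p * (real (2 + CARD('n)) * of_nat m) powr p) * (h / (h / 2 + r)) powr p"
            using q by (simp only: powr_mult mult.assoc)
          moreover have "((h / (h / 2 + r)) powr p) ^ m = w r powr p"
          proof -
            have "((h / (h / 2 + r)) powr p) ^ m = ((h / (h / 2 + r)) powr p) powr of_nat m"
              using q by (intro powr_realpow[symmetric]) (metis less_irrefl powr_gt_zero)
            also have "\<dots> = ((h / (h / 2 + r)) powr of_nat m) powr p"
              by (simp only: powr_powr mult.commute)
            finally show ?thesis using r by (simp add: w_def)
          qed
          ultimately show ?thesis by (simp only: power_mult_distrib A_def)
        qed
        then show ?thesis
          using lpow_heat_difference_power_le[OF g h t(1) assms(2), of m] t(2) by simp
      qed
    qed (use c0 h A in auto)
    also have "2 powr p * (c0 * h powr (\<sigma> / 2)) powr p * A = (C * h powr (\<sigma> / 2)) powr p"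
      using c0 A h assms by (simp add: C_def powr_mult powr_powr)
    finally show ?thesis
      using assms a g h C by (intro Lp_fnorm_le_mult heat_poly_Lp heat_Lp) auto
  qed
  then show ?thesis using that C by blast
qed

section \<open>The K-functional\<close>

lemma K_functional_nonneg:
  assumes "a \<in> sum_elems A0 A1" "0 \<le> t" "\<And>u. 0 \<le> fnorm A0 u" "\<And>u. 0 \<le> fnorm A1 u"
  shows "0 \<le> K_functional t a A0 A1"
  unfolding K_functional_def using assms
  by (intro cInf_greatest) (auto simp: sum_elems_def)

lemma K_functional_mono:
  assumes "a \<in> sum_elems A0 A1" "0 \<le> t" "t \<le> t'" "\<And>u. 0 \<le> fnorm A0 u" "\<And>u. 0 \<le> fnorm A1 u"
  shows "K_functional t a A0 A1 \<le> K_functional t' a A0 A1"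
  unfolding K_functional_def
proof (rule cInf_mono)
  show "{fnorm A0 a0 + t' * fnorm A1 a1 |a0 a1. a0 \<in> elems A0 \<and> a1 \<in> elems A1 \<and> a = (\<lambda>x. a0 x + a1 x)} \<noteq> {}"
    using assms(1) by (auto simp: sum_elems_def)
  show "bdd_below {fnorm A0 a0 + t * fnorm A1 a1 |a0 a1. a0 \<in> elems A0 \<and> a1 \<in> elems A1 \<and> a = (\<lambda>x. a0 x + a1 x)}"
    using assms by (intro bdd_belowI[of _ 0]) auto
  fix y assume "y \<in> {fnorm A0 a0 + t' * fnorm A1 a1 |a0 a1. a0 \<in> elems A0 \<and> a1 \<in> elems A1 \<and> a = (\<lambda>x. a0 x + a1 x)}"
  then obtain a0 a1 where "y = fnorm A0 a0 + t' * fnorm A1 a1" "a0 \<in> elems A0" "a1 \<in> elems A1" "a = (\<lambda>x. a0 x + a1 x)"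
    by blast
  then show "\<exists>z\<in>{fnorm A0 a0 + t * fnorm A1 a1 |a0 a1. a0 \<in> elems A0 \<and> a1 \<in> elems A1 \<and> a = (\<lambda>x. a0 x + a1 x)}. z \<le> y"
    using assms by (intro bexI[of _ "fnorm A0 a0 + t * fnorm A1 a1"]) (auto intro: mult_right_mono)
qed

lemma K_functional_decomposition:
  assumes "a \<in> sum_elems A0 A1" "K_functional t a A0 A1 < y"
  obtains a0 a1 where "a0 \<in> elems A0" "a1 \<in> elems A1" "a = (\<lambda>x. a0 x + a1 x)"
    "fnorm A0 a0 + t * fnorm A1 a1 < y"
proof -
  have "\<exists>z\<in>{fnorm A0 a0 + t * fnorm A1 a1 |a0 a1. a0 \<in> elems A0 \<and> a1 \<in> elems A1 \<and> a = (\<lambda>x. a0 x + a1 x)}. z < y"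
    using assms unfolding K_functional_def
    by (intro cInf_lessD) (auto simp: sum_elems_def)
  then show ?thesis using that by blast
qed

text \<open>K is nondecreasing in t, so its value at t is controlled by the part of the integral
  over [t, 2t]. There the integrand is at least ((2t)^(-\<theta>) K(t))^q / (2t), which yields the
  constant.\<close>

lemma K_functional_le:
  assumes a: "a \<in> elems (real_interpolation A0 A1 \<theta> q)" and "0 < t" "0 \<le> \<theta>" "0 < q"
    and nn: "\<And>u. 0 \<le> fnorm A0 u" "\<And>u. 0 \<le> fnorm A1 u"
  shows "K_functional t a A0 A1 \<le> 2 powr (\<theta> + 1 / q) * t powr \<theta> * fnorm (real_interpolation A0 A1 \<theta> q) a"
proof -
  have sum: "a \<in> sum_elems A0 A1" and fin: "interp_integral \<theta> q A0 A1 a < \<infinity>"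
    using a by (auto simp: real_interpolation_def)
  let ?K = "\<lambda>t. K_functional t a A0 A1"
  have K: "0 \<le> ?K t" using sum assms by (intro K_functional_nonneg) auto
  define I where "I = enn2real (interp_integral \<theta> q A0 A1 a)"
  have I: "interp_integral \<theta> q A0 A1 a = ennreal I" "0 \<le> I"
    using fin by (auto simp: I_def less_top)
  have "ennreal (((2 * t) powr (- \<theta>) * ?K t) powr q / 2)
     = (\<integral>\<^sup>+\<tau>. ennreal (((2 * t) powr (- \<theta>) * ?K t) powr q / (2 * t)) * indicator {t..2 * t} \<tau> \<partial>lborel)"
    using assms by (subst nn_integral_cmult_indicator) (auto simp flip: ennreal_mult)
  also have "\<dots> \<le> interp_integral \<theta> q A0 A1 a"
    unfolding interp_integral_def
  proof (rule nn_integral_mono)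
    fix \<tau>
    have "((2 * t) powr (- \<theta>) * ?K t) powr q / (2 * t) \<le> (\<tau> powr (- \<theta>) * ?K \<tau>) powr q / \<tau>"
      if "t \<le> \<tau>" "\<tau> \<le> 2 * t"
    proof (rule frac_le)
      show "((2 * t) powr (- \<theta>) * ?K t) powr q \<le> (\<tau> powr (- \<theta>) * ?K \<tau>) powr q"
        using that assms sum K
        by (intro powr_mono2 mult_mono powr_mono2' K_functional_mono) auto
    qed (use that assms in auto)
    then show "ennreal (((2 * t) powr (- \<theta>) * ?K t) powr q / (2 * t)) * indicator {t..2 * t} \<tau>
       \<le> ennreal ((\<tau> powr (- \<theta>) * ?K \<tau>) powr q / \<tau>) * indicator {0<..} \<tau>"
      using assms by (auto simp: indicator_def intro: ennreal_leI)
  qed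
  finally have "((2 * t) powr (- \<theta>) * ?K t) powr q / 2 \<le> I"
    using I by simp
  then have "(((2 * t) powr (- \<theta>) * ?K t) powr q) powr (1 / q) \<le> (2 * I) powr (1 / q)"
    using assms by (intro powr_mono2) auto
  then have "(2 * t) powr (- \<theta>) * ?K t \<le> 2 powr (1 / q) * I powr (1 / q)"
    using assms K I by (simp add: powr_powr powr_mult)
  then have "?K t \<le> (2 * t) powr \<theta> * (2 powr (1 / q) * I powr (1 / q))"
    using assms by (simp add: powr_minus field_simps)
  also have "\<dots> = 2 powr (\<theta> + 1 / q) * t powr \<theta> * fnorm (real_interpolation A0 A1 \<theta> q) a"
    using assms by (simp add: powr_mult powr_add real_interpolation_def I_def)
  finally show ?thesis .
qed

section \<open>Estimates on the Besov space\<close>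

locale besov_setting =
  fixes s p q0 s0 s1 :: real and m :: nat
  assumes sp: "1 < p" "0 < q0" "0 \<le> s0" "s0 < s" "s < s1" and m: "0 < m" "s1 / 2 < of_nat m"
begin

lemma besov_Lp:
  assumes "u \<in> elems (besov s0 s1 s p q0)"
  shows "u \<in> elems (Lp p)"
proof -
  have "u \<in> sum_elems (sobolev s0 p) (sobolev s1 p)"
    using assms by (simp add: besov_def real_interpolation_def)
  then show ?thesis using sp sobolev_Lp by (auto simp: sum_elems_def intro!: Lp_add)
qed

lemma besov_fnorm_nonneg: "0 \<le> fnorm (besov s0 s1 s p q0) u"
  by (simp add: besov_def real_interpolation_def)

text \<open>The infimum in the K-functional need not be attained, hence the strict inequality for y;
  the estimates below let y decrease to the bound.\<close>

lemma besov_decomposition: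
  fixes u :: "real^'n \<Rightarrow> complex"
  assumes u: "u \<in> elems (besov s0 s1 s p q0)" and t: "0 < t"
    and y: "2 powr ((s - s0) / (s1 - s0) + 1 / q0) * t powr ((s - s0) / (s1 - s0)) * fnorm (besov s0 s1 s p q0) u < y"
  obtains a0 a1 g0 g1 where "u = (\<lambda>x. a0 x + a1 x)"
    "bessel_potential_of s0 p g0 a0" "bessel_potential_of s1 p g1 a1"
    "fnorm (Lp p) g0 \<le> y" "t * fnorm (Lp p) g1 \<le> y"
proof -
  let ?A0 = "sobolev s0 p :: (real^'n) fspace" and ?A1 = "sobolev s1 p :: (real^'n) fspace"
  let ?\<theta> = "(s - s0) / (s1 - s0)"
  have th: "0 \<le> ?\<theta>" using sp by simp
  have u': "u \<in> elems (real_interpolation ?A0 ?A1 ?\<theta> q0)" using u by (simp add: besov_def)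
  then have "K_functional t u ?A0 ?A1 < y"
    using K_functional_le[OF u' t th sp(2) sobolev_fnorm_nonneg sobolev_fnorm_nonneg] y
    by (simp add: besov_def)
  moreover have "u \<in> sum_elems ?A0 ?A1" using u' by (simp add: real_interpolation_def)
  ultimately obtain a0 a1 where a: "a0 \<in> elems ?A0" "a1 \<in> elems ?A1" "u = (\<lambda>x. a0 x + a1 x)"
    "fnorm ?A0 a0 + t * fnorm ?A1 a1 < y"
    using K_functional_decomposition by blast
  obtain g0 where g0: "bessel_potential_of s0 p g0 a0" "fnorm ?A0 a0 = fnorm (Lp p) g0"
    using sobolev_bessel_potential[OF a(1)] sp by auto
  obtain g1 where g1: "bessel_potential_of s1 p g1 a1" "fnorm ?A1 a1 = fnorm (Lp p) g1"
    using sobolev_bessel_potential[OF a(2)] sp by auto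
  have "0 \<le> t * fnorm (Lp p) g1" "0 \<le> fnorm (Lp p) g0" using t by (simp_all add: Lp_fnorm_nonneg)
  then show ?thesis using that[OF a(3) g0(1) g1(1)] a(4) g0(2) g1(2) by simp
qed

lemma besov_heat_le:
  obtains C where "0 < C"
    "\<And>u \<tau>. u \<in> elems (besov s0 s1 s p q0) \<Longrightarrow> 0 < \<tau> \<Longrightarrow>
       fnorm (Lp p) (heat \<tau> (u::real^'n \<Rightarrow> complex)) \<le> C * fnorm (besov s0 s1 s p q0) u"
proof -
  define c where "c = 2 powr ((s - s0) / (s1 - s0) + 1 / q0)"
  \<comment> \<open>32 = 4 * (4 + 4): the triangle inequality with factor 4 and the bound for each
    of the two potentials, with the decomposition taken at t = 1.\<close>
  have "fnorm (Lp p) (heat \<tau> u) \<le> 32 * c * fnorm (besov s0 s1 s p q0) u"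
    if u: "u \<in> elems (besov s0 s1 s p q0)" and \<tau>: "0 < \<tau>" for u :: "real^'n \<Rightarrow> complex" and \<tau>
  proof -
    have "fnorm (Lp p) (heat \<tau> u) \<le> 32 * y" if y: "c * fnorm (besov s0 s1 s p q0) u < y" for y
    proof -
      obtain a0 a1 g0 g1 where *: "u = (\<lambda>x. a0 x + a1 x)"
        "bessel_potential_of s0 p g0 a0" "bessel_potential_of s1 p g1 a1"
        "fnorm (Lp p) g0 \<le> y" "fnorm (Lp p) g1 \<le> y"
        by (rule besov_decomposition[OF u, of 1 y]) (use y in \<open>auto simp: c_def\<close>)
      have a: "a0 \<in> elems (Lp p)" "a1 \<in> elems (Lp p)"
        using * by (auto simp: bessel_potential_of_def)
      have "heat \<tau> u = (\<lambda>x. heat \<tau> a0 x + heat \<tau> a1 x)"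
        unfolding *(1) using a \<tau> sp by (intro heat_add) auto
      then have "fnorm (Lp p) (heat \<tau> u) \<le> 4 * (fnorm (Lp p) (heat \<tau> a0) + fnorm (Lp p) (heat \<tau> a1))"
        using a \<tau> sp Lp_fnorm_add_le[of "heat \<tau> a0" p "heat \<tau> a1"] by (simp only: heat_Lp less_imp_le)
      also have "\<dots> \<le> 4 * (4 * fnorm (Lp p) g0 + 4 * fnorm (Lp p) g1)"
        using bessel_potential_heat_le[OF *(2) _ _ \<tau>] bessel_potential_heat_le[OF *(3) _ _ \<tau>] sp by simp
      also have "\<dots> \<le> 32 * y" using * by simp
      finally show ?thesis .
    qed
    then have "fnorm (Lp p) (heat \<tau> u) / 32 \<le> y" if "c * fnorm (besov s0 s1 s p q0) u < y" for y
      using that by (simp add: mult.commute divide_le_eq)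
    then have "fnorm (Lp p) (heat \<tau> u) / 32 \<le> c * fnorm (besov s0 s1 s p q0) u"
      by (rule dense_ge)
    then show ?thesis by simp
  qed
  moreover have "0 < 32 * c" by (simp add: c_def)
  ultimately show ?thesis using that by blast
qed

lemma besov_difference_le:
  obtains C where "0 < C"
    "\<And>u h. u \<in> elems (besov s0 s1 s p q0) \<Longrightarrow> 0 < h \<Longrightarrow>
       fnorm (Lp p) (heat_poly h ([:1, -1:] ^ m) (heat (h / 2) (u::real^'n \<Rightarrow> complex)))
         \<le> C * h powr (s / 2) * fnorm (besov s0 s1 s p q0) u"
proof -
  let ?D = "[:1, -1:] ^ m :: complex poly"
  let ?\<theta> = "(s - s0) / (s1 - s0)"
  define c where "c = 2 powr (?\<theta> + 1 / q0)"
  obtain C0 where C0: "0 < C0" "\<And>g a h. bessel_potential_of s0 p g (a::real^'n \<Rightarrow> complex) \<Longrightarrow> 0 < h \<Longrightarrow>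
       fnorm (Lp p) (heat_poly h ?D (heat (h / 2) a)) \<le> C0 * h powr (s0 / 2) * fnorm (Lp p) g"
    by (rule bessel_potential_difference_le[of s0 p m]) (use sp m in auto)
  obtain C1 where C1: "0 < C1" "\<And>g a h. bessel_potential_of s1 p g (a::real^'n \<Rightarrow> complex) \<Longrightarrow> 0 < h \<Longrightarrow>
       fnorm (Lp p) (heat_poly h ?D (heat (h / 2) a)) \<le> C1 * h powr (s1 / 2) * fnorm (Lp p) g"
    by (rule bessel_potential_difference_le[of s1 p m]) (use sp m in auto)
  define C where "C = 4 * (C0 + C1) * c"
  have "fnorm (Lp p) (heat_poly h ?D (heat (h / 2) u)) \<le> C * h powr (s / 2) * fnorm (besov s0 s1 s p q0) u"
    if u: "u \<in> elems (besov s0 s1 s p q0)" and h: "0 < h" for u :: "real^'n \<Rightarrow> complex" and h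
  proof -
    \<comment> \<open>With this t the bounds for the two pieces, of order h^(s0/2) y and h^(s1/2) y
      / t, coincide, and t^\<theta> = h^((s - s0)/2) completes the exponent to s/2.\<close>
    define t where "t = h powr ((s1 - s0) / 2)"
    have t: "0 < t" using h by (simp add: t_def)
    let ?F = "\<lambda>v. heat_poly h ?D (heat (h / 2) v)"
    let ?e = "4 * (C0 + C1) * h powr (s0 / 2)"
    have e: "0 < ?e" using C0 C1 h by simp
    have "fnorm (Lp p) (?F u) / ?e \<le> y" if y: "c * t powr ?\<theta> * fnorm (besov s0 s1 s p q0) u < y" for y
    proof -
      obtain a0 a1 g0 g1 where *: "u = (\<lambda>x. a0 x + a1 x)"
        "bessel_potential_of s0 p g0 a0" "bessel_potential_of s1 p g1 a1"
        "fnorm (Lp p) g0 \<le> y" "t * fnorm (Lp p) g1 \<le> y"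
        by (rule besov_decomposition[OF u t, of y]) (use y in \<open>auto simp: c_def\<close>)
      have a: "a0 \<in> elems (Lp p)" "a1 \<in> elems (Lp p)"
        using * by (auto simp: bessel_potential_of_def)
      have F: "?F a0 \<in> elems (Lp p)" "?F a1 \<in> elems (Lp p)"
        using a h sp by (auto intro!: heat_poly_Lp heat_Lp)
      have "heat (h / 2) u = (\<lambda>x. heat (h / 2) a0 x + heat (h / 2) a1 x)"
        unfolding *(1) using a h sp by (intro heat_add) auto
      then have "?F u = (\<lambda>x. ?F a0 x + ?F a1 x)"
        using a h sp by (simp add: heat_poly_add[where p=p] heat_Lp)
      then have "fnorm (Lp p) (?F u) \<le> 4 * (fnorm (Lp p) (?F a0) + fnorm (Lp p) (?F a1))"
        using Lp_fnorm_add_le[OF F] sp by (simp only:)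
      also have "\<dots> \<le> 4 * (C0 * h powr (s0 / 2) * fnorm (Lp p) g0 + C1 * h powr (s1 / 2) * fnorm (Lp p) g1)"
        using C0(2)[OF *(2) h] C1(2)[OF *(3) h] by simp
      also have "h powr (s1 / 2) = h powr (s0 / 2) * t"
        unfolding t_def by (subst powr_add[symmetric]) (simp add: field_simps)
      also have "4 * (C0 * h powr (s0 / 2) * fnorm (Lp p) g0 + C1 * (h powr (s0 / 2) * t) * fnorm (Lp p) g1)
         = 4 * (C0 * h powr (s0 / 2)) * fnorm (Lp p) g0 + 4 * (C1 * h powr (s0 / 2)) * (t * fnorm (Lp p) g1)"
        by (simp add: algebra_simps)
      also have "\<dots> \<le> 4 * (C0 * h powr (s0 / 2)) * y + 4 * (C1 * h powr (s0 / 2)) * y"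
        using * C0 C1 by (intro add_mono mult_left_mono) auto
      also have "\<dots> = ?e * y" by (simp add: algebra_simps)
      finally show ?thesis using e by (simp add: divide_le_eq mult.commute)
    qed
    then have "fnorm (Lp p) (?F u) / ?e \<le> c * t powr ?\<theta> * fnorm (besov s0 s1 s p q0) u"
      by (rule dense_ge)
    then have "fnorm (Lp p) (?F u) \<le> ?e * (c * t powr ?\<theta> * fnorm (besov s0 s1 s p q0) u)"
      using e by (simp add: divide_le_eq mult.commute)
    also have "t powr ?\<theta> = h powr ((s - s0) / 2)"
    proof -
      have "d / 2 * (e / d) = e / 2" if "d \<noteq> 0" for d e :: real
        using that by simp
      then have "(s1 - s0) / 2 * ?\<theta> = (s - s0) / 2" using sp by (metis diff_eq_eq add_0 less_irrefl less_trans)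
      then show ?thesis by (simp only: t_def powr_powr)
    qed
    also have "?e * (c * h powr ((s - s0) / 2) * fnorm (besov s0 s1 s p q0) u)
       = C * (h powr (s0 / 2) * h powr ((s - s0) / 2)) * fnorm (besov s0 s1 s p q0) u"
      by (simp add: C_def mult_ac)
    also have "h powr (s0 / 2) * h powr ((s - s0) / 2) = h powr (s / 2)"
      by (subst powr_add[symmetric]) (simp add: field_simps)
    finally show ?thesis .
  qed
  moreover have "0 < C" using C0 C1 by (simp add: C_def c_def)
  ultimately show ?thesis using that by blast
qed

end

section \<open>Approximation of the identity\<close>

text \<open>Positive and negative part are densities of two measures that agree and are finite on
  boxes, a generator closed under intersections; densities are unique almost everywhere.\<close>

lemma AE_zero_of_box_integrals:
  fixes w :: "'a::euclidean_space \<Rightarrow> real"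
  assumes [measurable]: "w \<in> borel_measurable borel"
    and int: "\<And>a b. integrable lborel (\<lambda>x. indicator (box a b) x * w x)"
    and zero: "\<And>a b. (LINT x|lborel. indicator (box a b) x * w x) = 0"
  shows "AE x in lborel. w x = 0"
proof -
  define P where "P x = ennreal (max 0 (w x))" for x
  define M where "M x = ennreal (max 0 (- w x))" for x
  have [measurable]: "P \<in> borel_measurable borel" "M \<in> borel_measurable borel"
    unfolding P_def M_def by measurable
  have eq: "emeasure (density lborel P) (box a b) = emeasure (density lborel M) (box a b)"
    and fin: "emeasure (density lborel P) (box a b) \<noteq> \<infinity>" for a b
  proof -
    let ?p = "\<lambda>x. indicator (box a b) x * max 0 (w x)"
    let ?m = "\<lambda>x. indicator (box a b) x * max 0 (- w x)"
    have p: "integrable lborel ?p"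
      by (rule Bochner_Integration.integrable_bound[OF int[of a b]]) (auto simp: indicator_def)
    have m: "integrable lborel ?m"
      by (rule Bochner_Integration.integrable_bound[OF int[of a b]]) (auto simp: indicator_def)
    have "(LINT x|lborel. ?p x) - (LINT x|lborel. ?m x) = (LINT x|lborel. ?p x - ?m x)"
      using p m by simp
    also have "\<dots> = (LINT x|lborel. indicator (box a b) x * w x)"
      by (intro Bochner_Integration.integral_cong) (auto simp: indicator_def max_def)
    finally have pm: "(LINT x|lborel. ?p x) = (LINT x|lborel. ?m x)" using zero by simp
    have "emeasure (density lborel P) (box a b) = (\<integral>\<^sup>+x. ennreal (?p x) \<partial>lborel)"
      by (subst emeasure_density) (auto intro!: nn_integral_cong simp: P_def indicator_def)
    also have "\<dots> = ennreal (LINT x|lborel. ?p x)"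
      using p by (intro nn_integral_eq_integral) auto
    finally have A: "emeasure (density lborel P) (box a b) = ennreal (LINT x|lborel. ?p x)" .
    have "emeasure (density lborel M) (box a b) = (\<integral>\<^sup>+x. ennreal (?m x) \<partial>lborel)"
      by (subst emeasure_density) (auto intro!: nn_integral_cong simp: M_def indicator_def)
    also have "\<dots> = ennreal (LINT x|lborel. ?m x)"
      using m by (intro nn_integral_eq_integral) auto
    finally show "emeasure (density lborel P) (box a b) = emeasure (density lborel M) (box a b)"
      using A pm by simp
    show "emeasure (density lborel P) (box a b) \<noteq> \<infinity>" using A by simp
  qed
  have "density lborel P = density lborel M"
  proof (rule measure_eqI_generator_eq)
    let ?E = "range (\<lambda>(a, b). box a b::'a set)"
    show "Int_stable ?E"
      by (auto simp: Int_stable_def box_Int_box)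
    show "?E \<subseteq> Pow UNIV" "sets (density lborel P) = sigma_sets UNIV ?E" "sets (density lborel M) = sigma_sets UNIV ?E"
      by (simp_all add: borel_eq_box)
    let ?A = "\<lambda>n::nat. box (- (real n *\<^sub>R One)) (real n *\<^sub>R One) :: 'a set"
    show "range ?A \<subseteq> ?E" "(\<Union>i. ?A i) = UNIV"
      unfolding UN_box_eq_UNIV by auto
    show "emeasure (density lborel P) (?A i) \<noteq> \<infinity>" for i by (rule fin)
    show "emeasure (density lborel P) X = emeasure (density lborel M) X" if "X \<in> ?E" for X
      using that eq by auto
  qed
  then have "AE x in lborel. P x = M x"
    by (intro sigma_finite_measure.density_unique[OF sigma_finite_lborel]) auto
  then show ?thesis
  proof eventually_elim
    case (elim x)
    then have "max 0 (w x) = max 0 (- w x)"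
      unfolding P_def M_def by (subst (asm) ennreal_inj) auto
    then show ?case by (auto simp: max_def split: if_splits)
  qed
qed

text \<open>Half of the Gaussian exponent is kept as a decay factor; the other half forms the kernel
  of doubled time, whose mass is at most 1. Tails thus carry an explicit exponential factor.\<close>

lemma heat_kernel_eq_double:
  assumes "0 < \<tau>"
  shows "heat_kernel \<tau> (z::real^'n) = exp \<tau> * 2 powr (CARD('n) / 2) * exp (- (norm z)\<^sup>2 / (8 * \<tau>)) * heat_kernel (2 * \<tau>) z"
proof -
  let ?N = "real CARD('n) / 2"
  have "(4 * pi * (2 * \<tau>)) powr (- ?N) = 2 powr (- ?N) * (4 * pi * \<tau>) powr (- ?N)"
    using powr_mult[of 2 "4 * pi * \<tau>" "- ?N"] by (simp add: mult_ac)
  then have "2 powr ?N * (4 * pi * (2 * \<tau>)) powr (- ?N) = (2 powr ?N * 2 powr (- ?N)) * (4 * pi * \<tau>) powr (- ?N)"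
    by (simp only: mult.assoc)
  also have "2 powr ?N * 2 powr (- ?N) = (1::real)"
    by (subst powr_add[symmetric]) simp
  finally have 1: "2 powr ?N * (4 * pi * (2 * \<tau>)) powr (- ?N) = (4 * pi * \<tau>) powr (- ?N)" by simp
  have 2: "exp (- (norm z)\<^sup>2 / (8 * \<tau>)) * exp (- (norm z)\<^sup>2 / (4 * (2 * \<tau>))) = exp (- (norm z)\<^sup>2 / (4 * \<tau>))"
    by (subst exp_add[symmetric]) (simp add: field_simps)
  have 3: "exp \<tau> * exp (- (2 * \<tau>)) = exp (- \<tau>)"
    by (subst exp_add[symmetric]) simp
  have "exp \<tau> * 2 powr ?N * exp (- (norm z)\<^sup>2 / (8 * \<tau>)) * heat_kernel (2 * \<tau>) z
     = (exp \<tau> * exp (- (2 * \<tau>))) * (2 powr ?N * (4 * pi * (2 * \<tau>)) powr (- ?N)) * (exp (- (norm z)\<^sup>2 / (8 * \<tau>)) * exp (- (norm z)\<^sup>2 / (4 * (2 * \<tau>))))"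
    unfolding heat_kernel_def by (simp only: mult_ac)
  then show ?thesis unfolding 1 2 3 by (simp add: heat_kernel_def)
qed

lemma nn_integral_heat_kernel_far:
  assumes "0 < \<tau>" "\<And>x. x \<in> S \<Longrightarrow> r \<le> (norm (x - y))\<^sup>2"
  shows "(\<integral>\<^sup>+x. ennreal (indicator S x * heat_kernel \<tau> (x - (y::real^'n))) \<partial>lborel)
    \<le> ennreal (exp \<tau> * 2 powr (CARD('n) / 2) * exp (- r / (8 * \<tau>)))"
proof -
  let ?c = "exp \<tau> * 2 powr (CARD('n) / 2) * exp (- r / (8 * \<tau>))"
  have "(\<integral>\<^sup>+x. ennreal (indicator S x * heat_kernel \<tau> (x - y)) \<partial>lborel)
     \<le> (\<integral>\<^sup>+x. ennreal ?c * ennreal (heat_kernel (2 * \<tau>) (x - y)) \<partial>lborel)"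
  proof (rule nn_integral_mono)
    fix x
    have "indicator S x * heat_kernel \<tau> (x - y) \<le> ?c * heat_kernel (2 * \<tau>) (x - y)"
    proof (cases "x \<in> S")
      case True
      then show ?thesis
        unfolding heat_kernel_eq_double[OF assms(1), of "x - y"] using assms True
        by (auto intro!: mult_right_mono mult_left_mono heat_kernel_nonneg divide_right_mono)
    next
      case False
      then show ?thesis by (simp add: heat_kernel_nonneg)
    qed
    then show "ennreal (indicator S x * heat_kernel \<tau> (x - y)) \<le> ennreal ?c * ennreal (heat_kernel (2 * \<tau>) (x - y))"
      by (simp add: ennreal_leI heat_kernel_nonneg flip: ennreal_mult)
  qed
  also have "\<dots> = ennreal ?c * ennreal (exp (- (2 * \<tau>)))"
    using assms by (simp add: nn_integral_cmult nn_integral_heat_kernel_shift)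
  also have "\<dots> \<le> ennreal ?c * 1"
    using assms by (intro mult_left_mono) auto
  finally show ?thesis by simp
qed

text \<open>Fubini moves the heat operator onto the indicator function. The smoothed indicators
  \<open>\<phi> n\<close> converge off the boundary of the box and share a Gaussian majorant that is
  integrable against u. Box integrals determine an L^p function almost everywhere, so this
  convergence can identify limits.\<close>

lemma heat_box_tendsto:
  fixes u :: "real^'n \<Rightarrow> complex"
  assumes u: "u \<in> elems (Lp p)" and p: "1 < p" and t: "\<And>n. 0 < t n" "t \<longlonglongrightarrow> 0"
  shows "(\<lambda>n. LINT x|lborel. of_real (indicator (box a b) x) * heat (t n) u x)
    \<longlonglongrightarrow> (LINT x|lborel. of_real (indicator (box a b) x) * u x)"
proof -
  have [measurable]: "u \<in> borel_measurable borel" using u Lp_measurable by auto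
  let ?B = "box a b"
  obtain n0 where n0: "\<And>n. n0 \<le> n \<Longrightarrow> t n \<le> 1"
    using order_tendstoD(2)[OF t(2), of 1] by (auto simp: eventually_sequentially intro: less_imp_le)
  \<comment> \<open>Dropping finitely many terms makes all times at most 1, which the common
    majorant needs.\<close>
  define s where "s n = t (n + n0)" for n
  have s: "0 < s n" "s n \<le> 1" for n using t n0 by (auto simp: s_def)
  have s0: "s \<longlonglongrightarrow> 0" unfolding s_def using t(2) by (rule LIMSEQ_ignore_initial_segment)
  define \<phi> where "\<phi> n y = (LINT x|lborel. indicator ?B x * heat_kernel (s n) (x - y))" for n y
  have int\<phi>: "integrable lborel (\<lambda>x. indicator S x * heat_kernel (s n) (x - y))" if [measurable]: "S \<in> sets borel" for S n and y :: "real^'n"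
  proof -
    have "integrable lborel (\<lambda>x. heat_kernel (s n) (x - y))"
      unfolding integrable_iff_bounded using nn_integral_heat_kernel_shift(2)[OF s(1)[of n], of y]
      by (simp add: heat_kernel_nonneg)
    then show ?thesis
      by (rule Bochner_Integration.integrable_bound) (auto simp: heat_kernel_nonneg indicator_def)
  qed
  have \<phi>_nonneg: "0 \<le> \<phi> n y" for n y
    unfolding \<phi>_def by (intro Bochner_Integration.integral_nonneg) (simp add: heat_kernel_nonneg)
  have far: "(LINT x|lborel. indicator S x * heat_kernel (s n) (x - y)) \<le> exp (s n) * 2 powr (CARD('n) / 2) * exp (- r / (8 * s n))"
    if [measurable]: "S \<in> sets borel" and "\<And>x. x \<in> S \<Longrightarrow> r \<le> (norm (x - y))\<^sup>2" for S n r and y :: "real^'n"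
  proof -
    have "ennreal (LINT x|lborel. indicator S x * heat_kernel (s n) (x - y))
       = (\<integral>\<^sup>+x. ennreal (indicator S x * heat_kernel (s n) (x - y)) \<partial>lborel)"
      using int\<phi>[of S n y] by (intro nn_integral_eq_integral[symmetric]) (auto simp: heat_kernel_nonneg)
    also have "\<dots> \<le> ennreal (exp (s n) * 2 powr (CARD('n) / 2) * exp (- r / (8 * s n)))"
      by (rule nn_integral_heat_kernel_far[OF s(1)]) (rule that(2))
    finally show ?thesis by (subst (asm) ennreal_le_iff) auto
  qed
  have total: "(LINT x|lborel. indicator S x * heat_kernel (s n) (x - y)) + (LINT x|lborel. indicator (- S) x * heat_kernel (s n) (x - y)) = exp (- s n)"
    if [measurable]: "S \<in> sets borel" for S n and y :: "real^'n"
  proof -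
    have "(LINT x|lborel. indicator S x * heat_kernel (s n) (x - y)) + (LINT x|lborel. indicator (- S) x * heat_kernel (s n) (x - y))
      = (LINT x|lborel. indicator S x * heat_kernel (s n) (x - y) + indicator (- S) x * heat_kernel (s n) (x - y))"
      by (intro Bochner_Integration.integral_add[symmetric] int\<phi>) auto
    also have "\<dots> = (LINT x|lborel. heat_kernel (s n) (x - y))"
      by (intro Bochner_Integration.integral_cong) (auto simp: indicator_def)
    also have "\<dots> = exp (- s n)"
      using nn_integral_heat_kernel_shift(2)[OF s(1)[of n], of y]
      by (subst integral_eq_nn_integral) (auto simp: heat_kernel_nonneg)
    finally show ?thesis .
  qed
  have \<phi>_up: "\<phi> n y \<le> exp (- s n)" for n y
  proof -
    have "0 \<le> (LINT x|lborel. indicator (- ?B) x * heat_kernel (s n) (x - y))"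
      by (intro Bochner_Integration.integral_nonneg) (simp add: heat_kernel_nonneg)
    then show ?thesis using total[of ?B n y] unfolding \<phi>_def by simp
  qed
  have swap: "(LINT x|lborel. of_real (indicator ?B x) * heat (s n) u x) = (LINT y|lborel. of_real (\<phi> n y) * u y)" for n
  proof -
    have "(LINT x|lborel. of_real (indicator ?B x) * heat (s n) u x)
       = (LINT x|lborel. LINT y|lborel. of_real (indicator ?B x * heat_kernel (s n) (x - y)) * u y)"
      using s(1)[of n] by (simp add: heat_def mult.assoc)
    also have "\<dots> = (LINT y|lborel. LINT x|lborel. of_real (indicator ?B x * heat_kernel (s n) (x - y)) * u y)"
    proof (rule LINT_swap)
      let ?K = "ennreal (exp (- s n)) + ennreal (exp (- s n) * (4 * pi * s n) powr (- (CARD('n) / 2))) * lpow p u"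
      have "(\<integral>\<^sup>+x. \<integral>\<^sup>+y. ennreal (norm (of_real (indicator ?B x * heat_kernel (s n) (x - y)) * u y)) \<partial>lborel \<partial>lborel)
        = (\<integral>\<^sup>+x. indicator ?B x * (\<integral>\<^sup>+y. ennreal (heat_kernel (s n) (x - y) * norm (u y)) \<partial>lborel) \<partial>lborel)"
        by (intro nn_integral_cong) (auto simp: indicator_def norm_mult heat_kernel_nonneg)
      also have "\<dots> \<le> (\<integral>\<^sup>+x. indicator ?B x * ?K \<partial>lborel)"
        using s p by (intro nn_integral_mono mult_left_mono nn_integral_heat_le) auto
      also have "\<dots> = emeasure lborel ?B * ?K"
        by (subst nn_integral_multc) auto
      also have "\<dots> < \<infinity>"
        using u emeasure_lborel_box_finite[of a b] by (simp add: Lp_elems_iff ennreal_mult_less_top)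
      finally show "(\<integral>\<^sup>+x. \<integral>\<^sup>+y. ennreal (norm (of_real (indicator ?B x * heat_kernel (s n) (x - y)) * u y)) \<partial>lborel \<partial>lborel) < \<infinity>" .
    qed (auto intro: sigma_finite_lborel)
    also have "\<dots> = (LINT y|lborel. of_real (\<phi> n y) * u y)"
      by (simp only: integral_mult_left_zero integral_complex_of_real \<phi>_def)
    finally show ?thesis .
  qed
  obtain R where R: "\<And>x. x \<in> ?B \<Longrightarrow> norm x \<le> R"
    using bounded_box[of a b] by (auto simp: bounded_iff)
  define c where "c = exp 1 * 2 powr (CARD('n) / 2) * exp (R\<^sup>2 / 8)"
  define H where "H y = c * exp (- (1 / 16) * (norm y)\<^sup>2)" for y :: "real^'n"
  have c1: "1 \<le> exp 1 * 2 powr (CARD('n) / 2 :: real)"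
  proof -
    have "1 * 1 \<le> exp 1 * (2 powr (CARD('n) / 2) :: real)"
      by (intro mult_mono ge_one_powr_ge_zero) auto
    then show ?thesis by simp
  qed
  \<comment> \<open>For |y|^2 \<ge> 2 R^2, every x in the box has |x - y|^2 \<ge> |y|^2/2 - R^2, and
    the tail bound applies. For smaller y the majorant is at least 1, and the mass of the kernel
    suffices.\<close>
  have \<phi>_le: "\<phi> n y \<le> H y" for n y
  proof (cases "R\<^sup>2 \<le> (norm y)\<^sup>2 / 2")
    case True
    have "\<phi> n y \<le> exp (s n) * 2 powr (CARD('n) / 2) * exp (- ((norm y)\<^sup>2 / 2 - R\<^sup>2) / (8 * s n))"
      unfolding \<phi>_def
    proof (rule far)
      fix x assume "x \<in> ?B"
      then have x: "(norm x)\<^sup>2 \<le> R\<^sup>2" using R by (intro power_mono) auto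
      have "(norm y)\<^sup>2 \<le> (norm x + norm (x - y))\<^sup>2"
        using norm_triangle_sub[of y x] by (intro power_mono) (auto simp: norm_minus_commute)
      also have "\<dots> \<le> 2 * (norm x)\<^sup>2 + 2 * (norm (x - y))\<^sup>2"
        using sum_squares_bound[of "norm x" "norm (x - y)"] by (simp add: power2_sum)
      finally show "(norm y)\<^sup>2 / 2 - R\<^sup>2 \<le> (norm (x - y))\<^sup>2" using x by simp
    qed simp
    also have "\<dots> \<le> exp 1 * 2 powr (CARD('n) / 2) * exp (- ((norm y)\<^sup>2 / 2 - R\<^sup>2) / 8)"
    proof (intro mult_mono)
      show "exp (- ((norm y)\<^sup>2 / 2 - R\<^sup>2) / (8 * s n)) \<le> exp (- ((norm y)\<^sup>2 / 2 - R\<^sup>2) / 8)"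
      proof -
        have "X / 8 \<le> X / (8 * s n)" if "0 \<le> X" for X
          using that s[of n] by (intro divide_left_mono) auto
        from this[of "(norm y)\<^sup>2 / 2 - R\<^sup>2"] True show ?thesis
          by (simp only: exp_le_cancel_iff minus_divide_left[symmetric] neg_le_iff_le)
      qed
    qed (use s[of n] in auto)
    also have "\<dots> = H y"
      by (simp add: H_def c_def mult.assoc flip: exp_add)
    finally show ?thesis .
  next
    case False
    have "\<phi> n y \<le> exp (- s n)" by (rule \<phi>_up)
    also have "\<dots> \<le> 1" using s[of n] by simp
    also have "1 \<le> (exp 1 * 2 powr (CARD('n) / 2)) * exp (R\<^sup>2 / 8 - (norm y)\<^sup>2 / 16)"
      using mult_mono[OF c1, of 1 "exp (R\<^sup>2 / 8 - (norm y)\<^sup>2 / 16)"] False by simp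
    also have "\<dots> = H y"
      by (simp add: H_def c_def mult.assoc flip: exp_add)
    finally show ?thesis .
  qed
  have bound0: "(\<lambda>n. exp (s n) * 2 powr (CARD('n) / 2) * exp (- r / (8 * s n))) \<longlonglongrightarrow> 0" if r: "0 < r" for r
  proof -
    have fs: "filterlim s (at_right 0) sequentially"
      using s0 s(1) by (auto simp: filterlim_at less_imp_neq[OF s(1), symmetric] intro!: always_eventually)
    have "filterlim (\<lambda>n. inverse (s n)) at_top sequentially"
      by (rule filterlim_compose[OF filterlim_inverse_at_top_right fs])
    then have "filterlim (\<lambda>n. r / 8 * inverse (s n)) at_top sequentially"
      using r by (intro filterlim_tendsto_pos_mult_at_top[OF tendsto_const]) auto
    then have "filterlim (\<lambda>n. - (r / 8 * inverse (s n))) at_bot sequentially"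
      by (simp only: filterlim_uminus_at_bot minus_minus)
    then have "(\<lambda>n. exp (- (r / 8 * inverse (s n)))) \<longlonglongrightarrow> 0"
      by (rule filterlim_compose[OF exp_at_bot])
    then have "(\<lambda>n. exp (s n) * 2 powr (CARD('n) / 2) * exp (- (r / 8 * inverse (s n)))) \<longlonglongrightarrow> exp 0 * 2 powr (CARD('n) / 2) * 0"
      by (rule tendsto_mult[OF tendsto_mult[OF tendsto_exp[OF s0] tendsto_const]])
    moreover have "- r / (8 * s n) = - (r / 8 * inverse (s n))" for n
      using s(1)[of n] by (simp add: field_simps)
    ultimately show ?thesis by (simp only: mult_zero_right)
  qed
  have lim: "AE y in lborel. (\<lambda>n. \<phi> n y) \<longlonglongrightarrow> indicator ?B y"
  proof -
    \<comment> \<open>The boundary of the box is a null set and can be left out.\<close>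
    have "AE y in lborel. y \<notin> cbox a b - box a b"
      using negligible_frontier_interval[of a b]
      by (intro AE_not_in) (auto simp: negligible_iff_null_sets null_sets_completion_iff)
    then show ?thesis
    proof eventually_elim
      case (elim y)
      show ?case
      proof (cases "y \<in> ?B")
        case True
        obtain e where e: "0 < e" "ball y e \<subseteq> ?B"
          using open_box[of a b] True by (meson openE)
        \<comment> \<open>Inside the box, the mass lost to the complement is a tail beyond distance
          e; subtracting it from the total mass gives the lower bound \<open>lo\<close>.\<close>
        have cfar: "(LINT x|lborel. indicator (- ?B) x * heat_kernel (s n) (x - y))
            \<le> exp (s n) * 2 powr (CARD('n) / 2) * exp (- e\<^sup>2 / (8 * s n))" for n
        proof (rule far)
          fix x assume "x \<in> - ?B"
          then have "e \<le> norm (x - y)" using e(2) by (auto simp: dist_norm norm_minus_commute not_less subset_eq)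
          then show "e\<^sup>2 \<le> (norm (x - y))\<^sup>2" using e by (intro power_mono) auto
        qed simp
        have lo: "exp (- s n) - exp (s n) * 2 powr (CARD('n) / 2) * exp (- e\<^sup>2 / (8 * s n)) \<le> \<phi> n y" for n
          using total[of ?B n y] cfar[of n] unfolding \<phi>_def by simp
        have "(\<lambda>n. \<phi> n y) \<longlonglongrightarrow> 1"
        proof (rule tendsto_sandwich)
          show "(\<lambda>n. exp (- s n) - exp (s n) * 2 powr (CARD('n) / 2) * exp (- e\<^sup>2 / (8 * s n))) \<longlonglongrightarrow> 1"
            using tendsto_diff[OF tendsto_exp[OF tendsto_minus[OF s0]] bound0[of "e\<^sup>2"]] e by simp
          show "(\<lambda>n. exp (- s n)) \<longlonglongrightarrow> 1" using tendsto_exp[OF tendsto_minus[OF s0]] by simp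
        qed (use \<phi>_up lo in auto)
        then show ?thesis using True by simp
      next
        case False
        then have "y \<in> - cbox a b" using elim by auto
        moreover have "open (- cbox a b)" by (intro open_Compl closed_cbox)
        ultimately obtain e where e: "0 < e" "ball y e \<subseteq> - cbox a b"
          by (meson openE)
        have "\<phi> n y \<le> exp (s n) * 2 powr (CARD('n) / 2) * exp (- e\<^sup>2 / (8 * s n))" for n
          unfolding \<phi>_def
        proof (rule far)
          fix x assume "x \<in> ?B"
          then have "x \<in> cbox a b" using box_subset_cbox by blast
          then have "e \<le> norm (x - y)" using e(2) by (auto simp: dist_norm norm_minus_commute not_less subset_eq)
          then show "e\<^sup>2 \<le> (norm (x - y))\<^sup>2" using e by (intro power_mono) auto
        qed simp
        then have "(\<lambda>n. \<phi> n y) \<longlonglongrightarrow> 0"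
          using e \<phi>_nonneg by (intro tendsto_sandwich[OF _ _ tendsto_const bound0[of "e\<^sup>2"]]) auto
        then show ?thesis using False by simp
      qed
    qed
  qed
  have "(\<lambda>n. LINT y|lborel. of_real (\<phi> n y) * u y) \<longlonglongrightarrow> (LINT y|lborel. of_real (indicator ?B y) * u y)"
  proof (rule integral_dominated_convergence)
    show "integrable lborel (\<lambda>y. H y * norm (u y))"
      unfolding integrable_iff_bounded
    proof
      have c: "0 < c" by (simp add: c_def)
      have H: "0 \<le> H y" "H y \<le> c" for y using c by (auto simp: H_def)
      have "(\<integral>\<^sup>+y. ennreal (norm (H y * norm (u y))) \<partial>lborel) = (\<integral>\<^sup>+y. ennreal (H y * norm (u y)) \<partial>lborel)"
        using H by simp
      also have "\<dots> \<le> (\<integral>\<^sup>+y. ennreal (H y) \<partial>lborel) + ennreal c * lpow p u"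
        using H p by (intro nn_integral_bounded_mult) (auto simp: H_def)
      also have "(\<integral>\<^sup>+y. ennreal (H y) \<partial>lborel) = ennreal c * ennreal ((pi / (1 / 16)) powr (CARD('n) / 2))"
        unfolding H_def using c nn_integral_gaussian[of "1 / 16", where 'a="real^'n"]
        by (simp add: ennreal_mult nn_integral_cmult)
      also have "\<dots> + ennreal c * lpow p u < \<infinity>"
        using u by (simp add: Lp_elems_iff ennreal_mult_less_top)
      finally show "(\<integral>\<^sup>+y. ennreal (norm (H y * norm (u y))) \<partial>lborel) < \<infinity>" .
    qed (simp add: H_def)
    show "AE y in lborel. (\<lambda>n. of_real (\<phi> n y) * u y) \<longlonglongrightarrow> of_real (indicator ?B y) * u y"
      using lim by eventually_elim (intro tendsto_intros)
    show "AE y in lborel. norm (of_real (\<phi> n y) * u y) \<le> H y * norm (u y)" for n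
      using \<phi>_le \<phi>_nonneg by (intro AE_I2) (simp add: norm_mult mult_right_mono)
    show "(\<lambda>y. of_real (\<phi> n y) * u y) \<in> borel_measurable lborel" for n
      unfolding \<phi>_def by measurable
  qed measurable
  then have "(\<lambda>n. LINT x|lborel. of_real (indicator ?B x) * heat (t (n + n0)) u x) \<longlonglongrightarrow> (LINT y|lborel. of_real (indicator ?B y) * u y)"
    unfolding swap[symmetric] s_def .
  then show ?thesis by (rule LIMSEQ_offset)
qed

section \<open>Smoothing from L^p to L^q\<close>

lemma lpow_le_of_bounded:
  assumes [measurable]: "F \<in> borel_measurable borel" and "\<And>x. norm (F x) \<le> S" "p \<le> q"
  shows "lpow q F \<le> ennreal (S powr (q - p)) * lpow p F"
proof -
  have "lpow q F \<le> (\<integral>\<^sup>+x. ennreal (S powr (q - p)) * ennreal (norm (F x) powr p) \<partial>lborel)"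
    unfolding lpow_def
  proof (rule nn_integral_mono)
    fix x
    have "norm (F x) powr q = norm (F x) powr (q - p) * norm (F x) powr p"
      by (simp flip: powr_add)
    also have "\<dots> \<le> S powr (q - p) * norm (F x) powr p"
      using assms by (intro mult_right_mono powr_mono2) auto
    finally show "ennreal (norm (F x) powr q) \<le> ennreal (S powr (q - p)) * ennreal (norm (F x) powr p)"
      by (simp add: ennreal_leI flip: ennreal_mult)
  qed
  also have "\<dots> = ennreal (S powr (q - p)) * lpow p F"
    by (simp add: nn_integral_cmult lpow_def)
  finally show ?thesis .
qed

lemma heat_norm_le:
  fixes v :: "real^'n \<Rightarrow> complex"
  assumes v: "v \<in> elems (Lp p)" and "1 < p" "0 < \<tau>"
  shows "norm (heat \<tau> v x) \<le> 2 * (4 * pi * \<tau>) powr (- (CARD('n) / (2 * p))) * fnorm (Lp p) v"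
proof -
  have [measurable]: "v \<in> borel_measurable borel" using v Lp_measurable by auto
  let ?S = "2 * (4 * pi * \<tau>) powr (- (CARD('n) / (2 * p))) * fnorm (Lp p) v"
  have S: "0 \<le> ?S" by (simp add: Lp_fnorm_nonneg)
  have "ennreal (norm (heat \<tau> v x) powr p) \<le> ennreal (2 powr p * (4 * pi * \<tau>) powr (- (CARD('n) / 2))) * lpow p v"
    using assms by (intro heat_sup_le) auto
  also have "\<dots> = ennreal (?S powr p)"
  proof -
    have "((4 * pi * \<tau>) powr (- (CARD('n) / (2 * p)))) powr p = (4 * pi * \<tau>) powr (- (CARD('n) / 2))"
      using assms by (simp add: powr_powr)
    then have "?S powr p = 2 powr p * (4 * pi * \<tau>) powr (- (CARD('n) / 2)) * fnorm (Lp p) v powr p"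
      by (simp only: powr_mult)
    then show ?thesis
      using assms by (simp only: lpow_eq_fnorm[OF v]) (simp flip: ennreal_mult)
  qed
  finally have "norm (heat \<tau> v x) powr p \<le> ?S powr p" by simp
  then show ?thesis using S assms by (metis norm_ge_zero not_le powr_less_mono2 less_trans zero_less_one)
qed

text \<open>Interpolates between the uniform bound of order \<tau>^(-N/(2p)) and the L^p bound: the
  power (q - p)/q of the former is \<tau>^(-(N/2)(1/p - 1/q)).\<close>

lemma heat_Lq:
  fixes v :: "real^'n \<Rightarrow> complex"
  assumes v: "v \<in> elems (Lp p)" and pq: "1 < p" "p < q" and \<tau>: "0 < \<tau>"
  shows "heat \<tau> v \<in> elems (Lp q)"
    and "fnorm (Lp q) (heat \<tau> v) \<le> 2 * (4 * pi * \<tau>) powr (- (CARD('n) / 2 * (1 / p - 1 / q))) * fnorm (Lp p) v"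
proof -
  have [measurable]: "v \<in> borel_measurable borel" using v Lp_measurable by auto
  let ?n = "fnorm (Lp p) v" and ?x = "4 * pi * \<tau>"
  let ?S = "2 * ?x powr (- (CARD('n) / (2 * p))) * ?n"
  let ?T = "2 * ?x powr (- (CARD('n) / 2 * (1 / p - 1 / q))) * ?n"
  have n: "0 \<le> ?n" by (simp add: Lp_fnorm_nonneg)
  have "lpow q (heat \<tau> v) \<le> ennreal (?S powr (q - p)) * lpow p (heat \<tau> v)"
    using heat_norm_le[OF v pq(1) \<tau>] pq by (intro lpow_le_of_bounded) auto
  also have "\<dots> \<le> ennreal (?S powr (q - p)) * (ennreal (2 powr p * exp (- \<tau>) powr p) * lpow p v)"
    using pq \<tau> by (intro mult_left_mono lpow_heat_le) auto
  also have "\<dots> \<le> ennreal (?S powr (q - p)) * (ennreal (2 powr p) * ennreal (?n powr p))"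
    using pq \<tau> v by (intro mult_left_mono mult_mono ennreal_leI mult_left_le powr_le1) (auto simp: lpow_eq_fnorm)
  also have "\<dots> = ennreal (?S powr (q - p) * (2 * ?n) powr p)"
    using n by (simp add: powr_mult ennreal_mult)
  also have "?S powr (q - p) * (2 * ?n) powr p = ?T powr q"
  proof -
    have e: "(?x powr (- (CARD('n) / (2 * p)))) powr (q - p) = ?x powr (- (CARD('n) / 2 * (1 / p - 1 / q)) * q)"
    proof -
      have "- (CARD('n) / (2 * p)) * (q - p) = - (CARD('n) / 2 * (1 / p - 1 / q)) * q"
        using pq by (simp add: field_simps)
      then show ?thesis by (simp only: powr_powr)
    qed
    have "?S powr (q - p) * (2 * ?n) powr p = (?x powr (- (CARD('n) / (2 * p)))) powr (q - p) * ((2 * ?n) powr (q - p) * (2 * ?n) powr p)"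
      using n by (simp add: powr_mult mult_ac)
    also have "(2 * ?n) powr (q - p) * (2 * ?n) powr p = (2 * ?n) powr q"
      by (simp flip: powr_add)
    finally show ?thesis
      unfolding e using n by (simp add: powr_mult powr_powr mult_ac)
  qed
  finally have L: "lpow q (heat \<tau> v) \<le> ennreal (?T powr q)" .
  have "heat \<tau> v \<in> borel_measurable lborel" by measurable
  then show H: "heat \<tau> v \<in> elems (Lp q)"
    using le_less_trans[OF L] by (simp add: Lp_elems_iff)
  show "fnorm (Lp q) (heat \<tau> v) \<le> ?T"
    using n pq by (intro fnorm_le_of_lpow_le[OF H _ L]) auto
qed

section \<open>Telescoping over dyadic scales\<close>

lemma heat_poly_monom_1:
  "heat_poly h [:0, 1:] u = heat h u"
  by (simp add: heat_poly_def fun_eq_iff)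

text \<open>Replacing X by X^2 multiplies (1 - X)^m by (1 + X)^m, so the difference is (1 - X)^m ((1
  + X)^m - 1), and the last factor vanishes at X = 0. The factor X extracted here becomes the
  operator \<open>heat h\<close>.\<close>

lemma approximation_poly_telescope:
  obtains Q :: "complex poly" where
    "(1 - [:1, -1:] ^ m) - pcompose (1 - [:1, -1:] ^ m) [:0, 0, 1:] = Q * ([:0, 1:] * [:1, -1:] ^ m)"
proof -
  have "poly ([:1, 1:] ^ m - 1) (0::complex) = 0" by (simp add: poly_power)
  then have "[:0, 1:] dvd ([:1, 1:] ^ m - 1 :: complex poly)"
    using poly_eq_0_iff_dvd[of "[:1, 1:] ^ m - 1" "0::complex"] by simp
  then obtain Q where Q: "[:1, 1:] ^ m - 1 = [:0, 1:] * (Q :: complex poly)" by (rule dvdE)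
  have D: "pcompose [:1, -1:] [:0, 0, 1:] = [:1, -1:] * ([:1, 1:] :: complex poly)"
    by (simp add: pcompose_pCons)
  have "pcompose ([:1, -1:] ^ m) [:0, 0, 1:] = ([:1, -1:] * ([:1, 1:] :: complex poly)) ^ m"
    by (induction m) (simp_all only: power_0 power_Suc pcompose_1 pcompose_mult D)
  then have P: "pcompose ([:1, -1:] ^ m) [:0, 0, 1:] = [:1, -1:] ^ m * ([:1, 1:] :: complex poly) ^ m"
    by (simp only: power_mult_distrib)
  have "(1 - a) - (1 - a * b) = a * (b - 1)" for a b :: "complex poly"
    by (simp add: algebra_simps)
  then have "(1 - [:1, -1:] ^ m) - pcompose (1 - [:1, -1:] ^ m) [:0, 0, 1:]
     = [:1, -1:] ^ m * ([:1, 1:] ^ m - 1 :: complex poly)"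
    by (simp only: pcompose_diff pcompose_1 P)
  also have "\<dots> = Q * ([:0, 1:] * [:1, -1:] ^ m)" unfolding Q by (simp only: mult_ac)
  finally show ?thesis by (rule that)
qed

text \<open>\<open>heat h\<close> is split in half: the inner \<open>heat (h / 2)\<close> stays with
  the difference, where Besov regularity is measured, and the outer one is left for the passage from
  L^p to L^q.\<close>

lemma heat_poly_telescope:
  assumes Q: "(1 - [:1, -1:] ^ m) - pcompose (1 - [:1, -1:] ^ m) [:0, 0, 1:] = Q * ([:0, 1:] * [:1, -1:] ^ m)"
    and u: "u \<in> elems (Lp p)" "1 < p" "0 < h"
  shows "heat_poly h (1 - [:1, -1:] ^ m) u x - heat_poly (2 * h) (1 - [:1, -1:] ^ m) u x
    = heat_poly h Q (heat (h / 2) (heat_poly h ([:1, -1:] ^ m) (heat (h / 2) u))) x"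
proof -
  let ?D = "[:1, -1:] ^ m :: complex poly"
  have D: "heat_poly h ?D u \<in> elems (Lp p)" using u by (intro heat_poly_Lp) auto
  have "heat_poly h (1 - ?D) u x - heat_poly (2 * h) (1 - ?D) u x = heat_poly h (Q * ([:0, 1:] * ?D)) u x"
    unfolding Q[symmetric] using u by (simp only: heat_poly_minus heat_poly_double[of u p h] less_imp_le)
  also have "\<dots> = heat_poly h Q (heat h (heat_poly h ?D u)) x"
    using u by (simp only: heat_poly_mult[of u p] heat_poly_monom_1 less_imp_le)
  also have "heat h (heat_poly h ?D u) = heat (h / 2) (heat (h / 2) (heat_poly h ?D u))"
    using u D by (simp add: heat_heat[of _ p])
  also have "heat (h / 2) (heat_poly h ?D u) = heat_poly h ?D (heat (h / 2) u)"
    using u by (intro heat_poly_heat[symmetric, of _ p]) auto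
  finally show ?thesis .
qed

text \<open>The power mean inequality for the counting measure with weights \<open>\<rho> ^ i\<close>.\<close>

lemma geometric_series_power_mean:
  fixes f :: "nat \<Rightarrow> complex"
  assumes \<rho>: "0 < \<rho>" "\<rho> < 1" and p: "1 < p" and a: "0 \<le> a" "ennreal a \<le> (\<Sum>i. ennreal (norm (f i)))"
  shows "ennreal (a powr p) \<le> ennreal (2 powr p * (1 / (1 - \<rho>)) powr (p - 1)) * (\<Sum>i. ennreal (\<rho> ^ i * (norm (f i) / \<rho> ^ i) powr p))"
proof -
  have "ennreal (a powr p) \<le> ennreal (2 powr p * (1 / (1 - \<rho>)) powr (p - 1))
      * (\<integral>\<^sup>+i. ennreal (\<rho> ^ i * (norm (f i) / \<rho> ^ i) powr p) \<partial>count_space UNIV)"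
  proof (rule weighted_power_mean_nn)
    show "(\<integral>\<^sup>+i. ennreal (\<rho> ^ i) \<partial>count_space UNIV) \<le> ennreal (1 / (1 - \<rho>))"
      unfolding nn_integral_count_space_nat
      using \<rho> by (subst suminf_ennreal2) (auto simp: suminf_geometric summable_geometric)
    show "ennreal a \<le> (\<integral>\<^sup>+i. ennreal (\<rho> ^ i * (norm (f i) / \<rho> ^ i)) \<partial>count_space UNIV)"
      unfolding nn_integral_count_space_nat using \<rho> a by simp
  qed (use \<rho> p a in auto)
  then show ?thesis by (simp add: nn_integral_count_space_nat)
qed

text \<open>The power mean divides the terms by the weights \<rho>^i, for which the decay
  \<rho>^(2i) compensates; the integrals are then dominated by the geometric series of the weights.
  The second claim allows any dominated F because it is applied both to a sum of absolute values and
  to a tail.\<close>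

lemma geometric_series_lpow:
  fixes f :: "nat \<Rightarrow> real^'n \<Rightarrow> complex"
  assumes [measurable]: "\<And>i. f i \<in> borel_measurable borel"
    and f: "\<And>i. lpow p (f i) \<le> ennreal ((A * \<rho> ^ (2 * i)) powr p)" and "0 \<le> A"
    and \<rho>: "0 < \<rho>" "\<rho> < 1" and p: "1 < p"
  shows "AE x in lborel. summable (\<lambda>i. norm (f i x))"
    and "(AE x in lborel. ennreal (norm (F x)) \<le> (\<Sum>i. ennreal (norm (f i x)))) \<longrightarrow> lpow p F \<le> ennreal ((2 * A / (1 - \<rho>)) powr p)"
proof -
  let ?c = "2 powr p * (1 / (1 - \<rho>)) powr (p - 1)"
  define G where "G x = (\<Sum>i. ennreal (\<rho> ^ i * (norm (f i x) / \<rho> ^ i) powr p))" for x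
  have [measurable]: "G \<in> borel_measurable borel" unfolding G_def by measurable
  have piece: "(\<integral>\<^sup>+x. ennreal (\<rho> ^ i * (norm (f i x) / \<rho> ^ i) powr p) \<partial>lborel) \<le> ennreal (A powr p * \<rho> ^ i)" for i
  proof -
    have "(\<integral>\<^sup>+x. ennreal (\<rho> ^ i * (norm (f i x) / \<rho> ^ i) powr p) \<partial>lborel)
       = (\<integral>\<^sup>+x. ennreal (\<rho> ^ i / (\<rho> ^ i) powr p) * ennreal (norm (f i x) powr p) \<partial>lborel)"
      using \<rho> by (intro nn_integral_cong) (simp add: powr_divide flip: ennreal_mult)
    also have "\<dots> = ennreal (\<rho> ^ i / (\<rho> ^ i) powr p) * lpow p (f i)"
      by (simp add: nn_integral_cmult lpow_def)
    also have "\<dots> \<le> ennreal (\<rho> ^ i / (\<rho> ^ i) powr p) * ennreal ((A * \<rho> ^ (2 * i)) powr p)"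
      by (intro mult_left_mono f) auto
    also have "\<dots> = ennreal (\<rho> ^ i / (\<rho> ^ i) powr p * (A * \<rho> ^ (2 * i)) powr p)"
      using \<rho> by (subst ennreal_mult) auto
    also have "\<dots> \<le> ennreal (A powr p * \<rho> ^ i)"
    proof (rule ennreal_leI)
      have "\<rho> ^ i / (\<rho> ^ i) powr p * (A * \<rho> ^ (2 * i)) powr p = \<rho> ^ i * A powr p * (\<rho> ^ i) powr p"
      proof -
        have r: "0 < \<rho> ^ i" using \<rho> by simp
        have "\<rho> ^ (2 * i) = \<rho> ^ i * \<rho> ^ i" by (simp add: mult_2 power_add)
        then have "(A * \<rho> ^ (2 * i)) powr p = A powr p * ((\<rho> ^ i) powr p * (\<rho> ^ i) powr p)"
          by (simp only: powr_mult)
        moreover have "(\<rho> ^ i) powr p \<noteq> 0" using r by (metis less_irrefl powr_gt_zero)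
        ultimately show ?thesis using \<rho> by simp
      qed
      also have "\<dots> \<le> \<rho> ^ i * A powr p * 1"
        using \<rho> p by (intro mult_left_mono powr_le1) (auto simp: power_le_one)
      finally show "\<rho> ^ i / (\<rho> ^ i) powr p * (A * \<rho> ^ (2 * i)) powr p \<le> A powr p * \<rho> ^ i" by (simp add: mult.commute)
    qed
    finally show ?thesis .
  qed
  have G: "(\<integral>\<^sup>+x. G x \<partial>lborel) \<le> ennreal (A powr p / (1 - \<rho>))"
  proof -
    have "(\<integral>\<^sup>+x. G x \<partial>lborel) = (\<Sum>i. \<integral>\<^sup>+x. ennreal (\<rho> ^ i * (norm (f i x) / \<rho> ^ i) powr p) \<partial>lborel)"
      unfolding G_def by (intro nn_integral_suminf) measurable
    also have "\<dots> \<le> (\<Sum>i. ennreal (A powr p * \<rho> ^ i))"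
      by (intro suminf_le piece) auto
    also have "\<dots> = ennreal (A powr p / (1 - \<rho>))"
      using \<rho> by (subst suminf_ennreal2) (auto simp: suminf_mult suminf_geometric summable_geometric)
    finally show ?thesis .
  qed
  have "(\<integral>\<^sup>+x. G x \<partial>lborel) \<noteq> \<infinity>" using G by (auto simp: top_unique)
  then have "AE x in lborel. G x \<noteq> \<infinity>" by (intro nn_integral_PInf_AE) auto
  then show "AE x in lborel. summable (\<lambda>i. norm (f i x))"
  proof eventually_elim
    case (elim x)
    then obtain g where g: "G x = ennreal g" "0 \<le> g" by (cases "G x") auto
    have "(\<Sum>i<n. norm (f i x)) \<le> (?c * g) powr (1 / p)" for n
    proof -
      let ?a = "\<Sum>i<n. norm (f i x)"
      have "ennreal ?a = (\<Sum>i<n. ennreal (norm (f i x)))" by (simp add: sum_ennreal)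
      also have "\<dots> \<le> (\<Sum>i. ennreal (norm (f i x)))" by (intro sum_le_suminf) auto
      finally have "ennreal (?a powr p) \<le> ennreal ?c * G x"
        unfolding G_def using \<rho> p by (intro geometric_series_power_mean) (auto simp: sum_nonneg)
      also have "\<dots> = ennreal (?c * g)" using g by (simp add: ennreal_mult)
      finally have "?a powr p \<le> ?c * g" using g by simp
      then have "(?a powr p) powr (1 / p) \<le> (?c * g) powr (1 / p)" using p by (intro powr_mono2) auto
      then show ?thesis using p by (simp add: powr_powr sum_nonneg)
    qed
    then show ?case by (intro summableI_nonneg_bounded) auto
  qed
  show "(AE x in lborel. ennreal (norm (F x)) \<le> (\<Sum>i. ennreal (norm (f i x)))) \<longrightarrow> lpow p F \<le> ennreal ((2 * A / (1 - \<rho>)) powr p)"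
  proof
    assume dom: "AE x in lborel. ennreal (norm (F x)) \<le> (\<Sum>i. ennreal (norm (f i x)))"
    have "lpow p F \<le> (\<integral>\<^sup>+x. ennreal ?c * G x \<partial>lborel)"
      unfolding lpow_def
    proof (rule nn_integral_mono_AE)
      show "AE x in lborel. ennreal (norm (F x) powr p) \<le> ennreal ?c * G x"
        using dom unfolding G_def
        by eventually_elim (rule geometric_series_power_mean[OF \<rho> p norm_ge_zero])
    qed
    also have "\<dots> = ennreal ?c * (\<integral>\<^sup>+x. G x \<partial>lborel)" by (intro nn_integral_cmult) measurable
    also have "\<dots> \<le> ennreal ?c * ennreal (A powr p / (1 - \<rho>))" by (intro mult_left_mono G) auto
    also have "\<dots> = ennreal (?c * (A powr p / (1 - \<rho>)))"
      using \<rho> by (subst ennreal_mult) auto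
    also have "?c * (A powr p / (1 - \<rho>)) = (2 * A / (1 - \<rho>)) powr p"
    proof -
      have "(1 / (1 - \<rho>)) powr (p - 1) * (1 / (1 - \<rho>)) powr 1 = (1 / (1 - \<rho>)) powr p"
        by (subst powr_add[symmetric]) simp
      then have d: "(1 / (1 - \<rho>)) powr (p - 1) * (1 / (1 - \<rho>)) = (1 / (1 - \<rho>)) powr p"
        using \<rho> by simp
      have "(2 * A / (1 - \<rho>)) powr p = (2 * A * (1 / (1 - \<rho>))) powr p" by simp
      also have "\<dots> = 2 powr p * A powr p * ((1 / (1 - \<rho>)) powr (p - 1) * (1 / (1 - \<rho>)))"
        unfolding d by (simp only: powr_mult)
      finally show ?thesis by simp
    qed
    finally show "lpow p F \<le> ennreal ((2 * A / (1 - \<rho>)) powr p)" .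
  qed
qed

lemma integrable_box_Lp:
  fixes u :: "real^'n \<Rightarrow> complex"
  assumes u: "u \<in> elems (Lp p)" and p: "1 < p"
  shows "integrable lborel (\<lambda>x. of_real (indicator (box a b) x) * u x)"
  unfolding integrable_iff_bounded
proof
  have [measurable]: "u \<in> borel_measurable borel" using u Lp_measurable by auto
  show "(\<lambda>x. of_real (indicator (box a b) x) * u x) \<in> borel_measurable lborel" by measurable
  have "(\<integral>\<^sup>+x. ennreal (norm (of_real (indicator (box a b) x) * u x)) \<partial>lborel)
     = (\<integral>\<^sup>+x. ennreal (indicator (box a b) x * norm (u x)) \<partial>lborel)"
    by (intro nn_integral_cong) (auto simp: indicator_def)
  also have "\<dots> \<le> (\<integral>\<^sup>+x. ennreal (indicator (box a b) x) \<partial>lborel) + ennreal 1 * lpow p u"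
    using p by (intro nn_integral_bounded_mult) (auto simp: indicator_def)
  also have "\<dots> = emeasure lborel (box a b) + lpow p u"
    by (simp add: ennreal_indicator)
  also have "\<dots> < \<infinity>" using u emeasure_lborel_box_finite[of a b] by (simp add: Lp_elems_iff)
  finally show "(\<integral>\<^sup>+x. ennreal (norm (of_real (indicator (box a b) x) * u x)) \<partial>lborel) < \<infinity>" .
qed

lemma Lp_AE_eqI:
  fixes u v :: "real^'n \<Rightarrow> complex"
  assumes u: "u \<in> elems (Lp p)" and v: "v \<in> elems (Lp p)" and p: "1 < p"
    and eq: "\<And>a b. (LINT x|lborel. of_real (indicator (box a b) x) * u x) = (LINT x|lborel. of_real (indicator (box a b) x) * v x)"
  shows "AE x in lborel. u x = v x"
proof -
  define w where "w x = u x - v x" for x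
  have w: "w \<in> elems (Lp p)" unfolding w_def using u v p by (intro Lp_diff) auto
  have [measurable]: "w \<in> borel_measurable borel" using w Lp_measurable by auto
  note int = integrable_box_Lp[OF w p]
  have zero: "(LINT x|lborel. of_real (indicator (box a b) x) * w x) = 0" for a b
    using eq[of a b] integrable_box_Lp[OF u p, of a b] integrable_box_Lp[OF v p, of a b]
    by (simp add: w_def right_diff_distrib)
  have "AE x in lborel. Re (w x) = 0"
  proof (rule AE_zero_of_box_integrals)
    show "integrable lborel (\<lambda>x. indicator (box a b) x * Re (w x))" for a b
      using integrable_Re[OF int[of a b]] by simp
    show "(LINT x|lborel. indicator (box a b) x * Re (w x)) = 0" for a b
      using integral_Re[OF int[of a b]] zero[of a b] by simp
  qed measurable
  moreover have "AE x in lborel. Im (w x) = 0"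
  proof (rule AE_zero_of_box_integrals)
    show "integrable lborel (\<lambda>x. indicator (box a b) x * Im (w x))" for a b
      using integrable_Im[OF int[of a b]] by simp
    show "(LINT x|lborel. indicator (box a b) x * Im (w x)) = 0" for a b
      using integral_Im[OF int[of a b]] zero[of a b] by simp
  qed measurable
  ultimately show ?thesis
    by eventually_elim (simp add: w_def complex_eq_iff)
qed

lemma fnorm_heat_poly_le:
  assumes "1 < p"
  obtains C where "0 < C" "\<And>u h. u \<in> elems (Lp p) \<Longrightarrow> 0 \<le> h \<Longrightarrow>
     fnorm (Lp p) (heat_poly h P (u::real^'n \<Rightarrow> complex)) \<le> C * fnorm (Lp p) u"
proof -
  obtain C where C: "0 < C" "\<And>u h. u \<in> elems (Lp p) \<Longrightarrow> 0 \<le> h \<Longrightarrow>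
     lpow p (heat_poly h P (u::real^'n \<Rightarrow> complex)) \<le> ennreal C * lpow p u"
    using lpow_heat_poly_le[OF assms, of P, where 'n='n] by blast
  have "fnorm (Lp p) (heat_poly h P u) \<le> C powr (1 / p) * fnorm (Lp p) u"
    if "u \<in> elems (Lp p)" "0 \<le> h" for u :: "real^'n \<Rightarrow> complex" and h
  proof (rule Lp_fnorm_le_mult)
    show "lpow p (heat_poly h P u) \<le> ennreal ((C powr (1 / p)) powr p) * lpow p u"
      using C that assms by (simp add: powr_powr)
  qed (use that assms in \<open>auto intro: heat_poly_Lp\<close>)
  then show ?thesis using that[of "C powr (1 / p)"] C(1) by simp
qed

lemma fnorm_heat_le:
  assumes "u \<in> elems (Lp p)" "0 \<le> \<tau>" "1 < p"
  shows "fnorm (Lp p) (heat \<tau> u) \<le> 2 * fnorm (Lp p) u"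
proof (rule Lp_fnorm_le_mult)
  have [measurable]: "u \<in> borel_measurable borel" using assms Lp_measurable by auto
  have "lpow p (heat \<tau> u) \<le> ennreal (2 powr p * exp (- \<tau>) powr p) * lpow p u"
    using assms by (intro lpow_heat_le) auto
  also have "\<dots> \<le> ennreal (2 powr p) * lpow p u"
    using assms by (intro mult_right_mono ennreal_leI mult_left_le powr_le1) auto
  finally show "lpow p (heat \<tau> u) \<le> ennreal (2 powr p) * lpow p u" .
qed (use assms in \<open>auto intro: heat_Lp\<close>)

text \<open>Each \<open>heat (i * h) u\<close> tends to u in the sense of box integrals, so the
  limit is u times the sum of the coefficients, and this sum is \<open>poly P 1\<close>.\<close>

lemma heat_poly_box_tendsto:
  fixes u :: "real^'n \<Rightarrow> complex"
  assumes u: "u \<in> elems (Lp p)" and p: "1 < p" and P: "poly P 1 = 1"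
  shows "(\<lambda>n. LINT x|lborel. of_real (indicator (box a b) x) * heat_poly ((1 / 2) ^ n) P u x)
    \<longlonglongrightarrow> (LINT x|lborel. of_real (indicator (box a b) x) * u x)"
proof -
  let ?I = "\<lambda>v. LINT x|lborel. of_real (indicator (box a b) x) * (v x :: complex)"
  have "?I (heat_poly ((1 / 2) ^ n) P u) = (\<Sum>i\<le>degree P. coeff P i * ?I (heat (of_nat i * (1 / 2) ^ n) u))" for n
  proof -
    have "?I (heat_poly ((1 / 2) ^ n) P u)
       = (LINT x|lborel. (\<Sum>i\<le>degree P. coeff P i * (of_real (indicator (box a b) x) * heat (of_nat i * (1 / 2) ^ n) u x)))"
      by (simp add: heat_poly_def sum_distrib_left mult_ac)
    also have "\<dots> = (\<Sum>i\<le>degree P. (LINT x|lborel. coeff P i * (of_real (indicator (box a b) x) * heat (of_nat i * (1 / 2) ^ n) u x)))"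
      using u p by (intro Bochner_Integration.integral_sum integrable_mult_right integrable_box_Lp heat_Lp) auto
    finally show ?thesis by simp
  qed
  moreover have "(\<lambda>n. \<Sum>i\<le>degree P. coeff P i * ?I (heat (of_nat i * (1 / 2) ^ n) u)) \<longlonglongrightarrow> (\<Sum>i\<le>degree P. coeff P i * ?I u)"
  proof (intro tendsto_sum tendsto_mult_left)
    fix i assume "i \<in> {..degree P}"
    show "(\<lambda>n. ?I (heat (of_nat i * (1 / 2) ^ n) u)) \<longlonglongrightarrow> ?I u"
    proof (cases "i = 0")
      case False
      have "(\<lambda>n. real i * (1 / 2) ^ n) \<longlonglongrightarrow> real i * 0"
        by (intro tendsto_mult_left LIMSEQ_power_zero) simp
      then show ?thesis
        using u p False by (intro heat_box_tendsto[where p=p]) auto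
    qed simp
  qed
  moreover have "(\<Sum>i\<le>degree P. coeff P i * ?I u) = ?I u"
    using P by (simp add: poly_altdef flip: sum_distrib_right)
  ultimately show ?thesis by simp
qed

text \<open>Each telescoping term gains h^(s/2) from the difference and loses h^(-(N/2)(1/p - 1/q))
  on the way to L^q; the net exponent \<kappa> is positive by assumption. The terms are summed in
  L^p as well, because there the sum can be compared with u.\<close>

lemma high_frequency_tail:
  fixes s p q :: real and m :: nat
  assumes pq: "1 < p" "p < q" and m: "0 < m" and s: "CARD('n::finite) * (1 / p - 1 / q) < s"
  obtains C \<rho> where "0 < C" "0 < \<rho>" "\<rho> < 1"
    "\<And>u B j. u \<in> elems (Lp p) \<Longrightarrow> 0 \<le> B \<Longrightarrow>
       (\<And>h. 0 < h \<Longrightarrow> h \<le> 1 \<Longrightarrow> fnorm (Lp p) (heat_poly h ([:1, -1:] ^ m) (heat (h / 2) (u::real^'n \<Rightarrow> complex))) \<le> B * h powr (s / 2)) \<Longrightarrow>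
       lpow q (\<lambda>x. u x - heat_poly ((1 / 2) ^ j) (1 - [:1, -1:] ^ m) u x) \<le> ennreal ((C * B * \<rho> ^ (2 * j)) powr q)"
proof -
  let ?D = "[:1, -1:] ^ m :: complex poly"
  let ?e = "CARD('n) / 2 * (1 / p - 1 / q)"
  define \<kappa> where "\<kappa> = s / 2 - ?e"
  have e: "0 \<le> ?e" using pq by (intro mult_nonneg_nonneg) (auto simp: field_simps)
  have \<kappa>: "0 < \<kappa>" "\<kappa> \<le> s / 2" using s e by (auto simp: \<kappa>_def)
  \<comment> \<open>Chosen so that (2^(-n))^\<kappa> = \<rho>^(2n), the form of decay that
    \<open>geometric_series_lpow\<close> expects.\<close>
  define \<rho> :: real where "\<rho> = 2 powr (- \<kappa> / 2)"
  have \<rho>: "0 < \<rho>" "\<rho> < 1"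
    using \<kappa> powr_less_mono[of "- \<kappa> / 2" 0 2] by (auto simp: \<rho>_def)
  have q1: "1 < q" using pq by simp
  obtain Q :: "complex poly" where Q: "(1 - ?D) - pcompose (1 - ?D) [:0, 0, 1:] = Q * ([:0, 1:] * ?D)"
    by (rule approximation_poly_telescope)
  obtain Cp where Cp: "0 < Cp" "\<And>u h. u \<in> elems (Lp p) \<Longrightarrow> 0 \<le> h \<Longrightarrow>
     fnorm (Lp p) (heat_poly h Q (u::real^'n \<Rightarrow> complex)) \<le> Cp * fnorm (Lp p) u"
    using fnorm_heat_poly_le[OF pq(1), of Q, where 'n='n] by blast
  obtain Cq where Cq: "0 < Cq" "\<And>u h. u \<in> elems (Lp q) \<Longrightarrow> 0 \<le> h \<Longrightarrow>
     fnorm (Lp q) (heat_poly h Q (u::real^'n \<Rightarrow> complex)) \<le> Cq * fnorm (Lp q) u"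
    using fnorm_heat_poly_le[OF q1, of Q, where 'n='n] by blast
  \<comment> \<open>Serves in L^p and in L^q; the 2 is the constant of the outer heat operator in
    either bound.\<close>
  define c where "c = 2 * (Cp + Cq)"
  have c: "0 < c" using Cp Cq by (simp add: c_def)
  define C where "C = 2 * c / (1 - \<rho>)"
  have C: "0 < C" using c \<rho> by (simp add: C_def)
  have "lpow q (\<lambda>x. u x - heat_poly ((1 / 2) ^ j) (1 - ?D) u x) \<le> ennreal ((C * B * \<rho> ^ (2 * j)) powr q)"
    if u: "u \<in> elems (Lp p)" and B: "0 \<le> B"
      and high: "\<And>h. 0 < h \<Longrightarrow> h \<le> 1 \<Longrightarrow> fnorm (Lp p) (heat_poly h ?D (heat (h / 2) u)) \<le> B * h powr (s / 2)"
    for u :: "real^'n \<Rightarrow> complex" and B and j :: nat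
  proof -
    have [measurable]: "u \<in> borel_measurable borel" using u Lp_measurable by auto
    define R where "R n = heat_poly ((1 / 2) ^ n) (1 - ?D) u" for n :: nat
    define \<Delta> where "\<Delta> n x = R (Suc n) x - R n x" for n x
    have R: "R n \<in> elems (Lp p)" for n unfolding R_def using u pq by (intro heat_poly_Lp) auto
    have \<Delta>_Lp: "\<Delta> n \<in> elems (Lp p)" for n
      using R pq unfolding \<Delta>_def[abs_def] by (intro Lp_diff) auto
    have meas [measurable]: "R n \<in> borel_measurable borel" "\<Delta> n \<in> borel_measurable borel" for n
      using R \<Delta>_Lp Lp_measurable by auto
    define A where "A = c * B"
    have A: "0 \<le> A" using c B by (simp add: A_def)
    have bounds: "fnorm (Lp p) (\<Delta> n) \<le> A * \<rho> ^ (2 * n)" "\<Delta> n \<in> elems (Lp q)" "fnorm (Lp q) (\<Delta> n) \<le> A * \<rho> ^ (2 * n)" for n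
    proof -
      \<comment> \<open>\<open>\<Delta> n\<close> compares the scales (1/2)^(n+1) and (1/2)^n, that
        is h and 2 h.\<close>
      define h where "h = (1 / 2 :: real) ^ Suc n"
      have h: "0 < h" "h \<le> 1" "2 * h = (1 / 2) ^ n" using power_le_one[of "1 / 2 :: real" n] by (auto simp: h_def)
      let ?V = "heat_poly h ?D (heat (h / 2) u)"
      have V: "?V \<in> elems (Lp p)" using u h pq by (intro heat_poly_Lp heat_Lp) auto
      have \<Delta>: "\<Delta> n = heat_poly h Q (heat (h / 2) ?V)"
        using heat_poly_telescope[OF Q u pq(1) h(1)] h(3)
        unfolding \<Delta>_def[abs_def] R_def h_def[symmetric] by (simp add: fun_eq_iff)
      have Vn: "fnorm (Lp p) ?V \<le> B * h powr (s / 2)" using high h by simp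
      have h\<kappa>: "h powr \<kappa> \<le> \<rho> ^ (2 * n)"
      proof -
        have "h powr \<kappa> \<le> ((1 / 2) ^ n) powr \<kappa>"
          using h \<kappa> by (intro powr_mono2) (auto simp: h_def)
        also have "\<dots> = \<rho> ^ (2 * n)"
        proof -
          have "(1 / 2 :: real) ^ n = 2 powr (- real n)"
            by (simp add: powr_minus powr_realpow power_one_over inverse_eq_divide)
          then have "((1 / 2 :: real) ^ n) powr \<kappa> = 2 powr (- real n * \<kappa>)" by (simp only: powr_powr)
          moreover have "\<rho> ^ (2 * n) = 2 powr (- \<kappa> / 2 * real (2 * n))"
            unfolding powr_realpow[OF \<rho>(1), symmetric] unfolding \<rho>_def by (simp only: powr_powr)
          ultimately show ?thesis by (simp add: mult_ac)
        qed
        finally show ?thesis .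
      qed
      have hs: "h powr (s / 2) \<le> h powr \<kappa>" using h \<kappa> by (intro powr_mono') auto
      have "fnorm (Lp p) (\<Delta> n) \<le> Cp * (2 * (B * h powr (s / 2)))"
        unfolding \<Delta> using V h pq Cp(1) Vn
        by (intro order.trans[OF Cp(2)] mult_left_mono order.trans[OF fnorm_heat_le]) (auto intro: heat_Lp)
      also have "\<dots> \<le> Cp * (2 * (B * \<rho> ^ (2 * n)))"
        using Cp(1) B order.trans[OF hs h\<kappa>] by (intro mult_left_mono) auto
      also have "\<dots> \<le> A * \<rho> ^ (2 * n)"
        using Cq(1) B \<rho> by (simp add: A_def c_def algebra_simps)
      finally show "fnorm (Lp p) (\<Delta> n) \<le> A * \<rho> ^ (2 * n)" .
      have hV: "heat (h / 2) ?V \<in> elems (Lp q)" using heat_Lq(1)[OF V pq] h by simp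
      show "\<Delta> n \<in> elems (Lp q)"
        unfolding \<Delta> using hV h q1 by (intro heat_poly_Lp) auto
      have "fnorm (Lp q) (heat (h / 2) ?V) \<le> 2 * (4 * pi * (h / 2)) powr (- ?e) * fnorm (Lp p) ?V"
        using h by (intro heat_Lq(2)[OF V pq]) simp
      also have "\<dots> \<le> 2 * h powr (- ?e) * (B * h powr (s / 2))"
      proof (rule mult_mono[OF _ Vn])
        have "h * 1 \<le> h * (2 * pi)" using h(1) pi_ge_two by (intro mult_left_mono) auto
        then have "h \<le> 4 * pi * (h / 2)" by (simp add: mult_ac)
        then show "2 * (4 * pi * (h / 2)) powr (- ?e) \<le> 2 * h powr (- ?e)"
          using h(1) e by (intro mult_left_mono powr_mono2') auto
      qed (use h B in \<open>auto simp: Lp_fnorm_nonneg\<close>)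
      also have "\<dots> = 2 * (B * h powr \<kappa>)"
      proof -
        have "h powr (- ?e) * h powr (s / 2) = h powr \<kappa>"
          unfolding \<kappa>_def by (subst powr_add[symmetric]) (simp add: algebra_simps)
        then show ?thesis by (simp add: mult_ac)
      qed
      finally have hV': "fnorm (Lp q) (heat (h / 2) ?V) \<le> 2 * (B * h powr \<kappa>)" .
      have "fnorm (Lp q) (\<Delta> n) \<le> Cq * fnorm (Lp q) (heat (h / 2) ?V)"
        unfolding \<Delta> using hV h by (intro Cq(2)) auto
      also have "\<dots> \<le> Cq * (2 * (B * \<rho> ^ (2 * n)))"
        using Cq(1) B h\<kappa> by (intro mult_left_mono order.trans[OF hV']) auto
      also have "\<dots> \<le> A * \<rho> ^ (2 * n)"
        using Cp(1) B \<rho> by (simp add: A_def c_def algebra_simps)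
      finally show "fnorm (Lp q) (\<Delta> n) \<le> A * \<rho> ^ (2 * n)" .
    qed
    have lp: "lpow p (\<Delta> n) \<le> ennreal ((A * \<rho> ^ (2 * n)) powr p)" for n
      using bounds(1)[of n] pq lpow_eq_fnorm[OF \<Delta>_Lp, of n]
      by (simp add: Lp_fnorm_nonneg powr_mono2)
    have lq: "lpow q (\<Delta> n) \<le> ennreal ((A * \<rho> ^ (2 * n)) powr q)" for n
      using bounds(3)[of n] q1 lpow_eq_fnorm[OF bounds(2), of n]
      by (simp add: Lp_fnorm_nonneg powr_mono2)
    note series = geometric_series_lpow[of \<Delta> p A \<rho>, OF meas(2) lp A \<rho> pq(1)]
    define v where "v x = R 0 x + (\<Sum>n. \<Delta> n x)" for x
    \<comment> \<open>Almost everywhere a majorant of all R n and of their limit v, and itself in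
      L^p.\<close>
    define W where "W x = complex_of_real (norm (R 0 x)) + of_real (\<Sum>n. norm (\<Delta> n x))" for x
    have [measurable]: "v \<in> borel_measurable borel" unfolding v_def by measurable
    have W: "W \<in> elems (Lp p)"
    proof -
      have "(\<lambda>x. complex_of_real (\<Sum>n. norm (\<Delta> n x))) \<in> elems (Lp p)"
      proof -
        have "lpow p (\<lambda>x. complex_of_real (\<Sum>n. norm (\<Delta> n x))) \<le> ennreal ((2 * A / (1 - \<rho>)) powr p)"
        proof (rule series(2)[rule_format])
          show "AE x in lborel. ennreal (norm (complex_of_real (\<Sum>n. norm (\<Delta> n x)))) \<le> (\<Sum>n. ennreal (norm (\<Delta> n x)))"
            using series(1) by eventually_elim (simp add: suminf_nonneg suminf_ennreal2)
        qed
        then show ?thesis by (auto simp: Lp_elems_iff intro: le_less_trans)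
      qed
      moreover have "(\<lambda>x. complex_of_real (norm (R 0 x))) \<in> elems (Lp p)"
        using R[of 0] by (auto simp: Lp_elems_iff lpow_def)
      ultimately show ?thesis unfolding W_def using pq by (intro Lp_add) auto
    qed
    have conv: "(\<lambda>n. R n x) \<longlonglongrightarrow> v x" "norm (R n x) \<le> norm (W x)" "norm (v x) \<le> norm (W x)"
      if sm: "summable (\<lambda>n. norm (\<Delta> n x))" for x n
    proof -
      have Rn: "R n x = R 0 x + (\<Sum>i<n. \<Delta> i x)" for n
        by (simp add: \<Delta>_def sum_lessThan_telescope[of "\<lambda>n. R n x"])
      have "(\<lambda>n. \<Sum>i<n. \<Delta> i x) \<longlonglongrightarrow> (\<Sum>i. \<Delta> i x)"
        using summable_norm_cancel[OF sm] by (rule summable_LIMSEQ)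
      then have "(\<lambda>n. R 0 x + (\<Sum>i<n. \<Delta> i x)) \<longlonglongrightarrow> v x"
        unfolding v_def by (rule tendsto_add[OF tendsto_const])
      then show lim: "(\<lambda>n. R n x) \<longlonglongrightarrow> v x" by (simp only: Rn[symmetric])
      have nW: "norm (W x) = norm (R 0 x) + (\<Sum>n. norm (\<Delta> n x))"
      proof -
        have "W x = of_real (norm (R 0 x) + (\<Sum>n. norm (\<Delta> n x)))" by (simp add: W_def)
        then show ?thesis using suminf_nonneg[OF sm] by (simp only: norm_of_real) simp
      qed
      show RW: "norm (R n x) \<le> norm (W x)" for n
      proof -
        have "norm (R n x) \<le> norm (R 0 x) + norm (\<Sum>i<n. \<Delta> i x)"
          unfolding Rn[of n] by (rule norm_triangle_ineq)
        also have "norm (\<Sum>i<n. \<Delta> i x) \<le> (\<Sum>i<n. norm (\<Delta> i x))" by (rule norm_sum)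
        also have "\<dots> \<le> (\<Sum>n. norm (\<Delta> n x))" using sm by (intro sum_le_suminf) auto
        finally show ?thesis using nW by simp
      qed
      show "norm (v x) \<le> norm (W x)"
        using RW by (intro LIMSEQ_le_const2[OF tendsto_norm[OF lim]]) auto
    qed
    have v: "v \<in> elems (Lp p)"
    proof -
      have "lpow p v \<le> lpow p W"
        unfolding lpow_def
      proof (rule nn_integral_mono_AE)
        show "AE x in lborel. ennreal (norm (v x) powr p) \<le> ennreal (norm (W x) powr p)"
          using series(1) by eventually_elim (use pq conv(3) in \<open>auto intro!: ennreal_leI powr_mono2\<close>)
      qed
      then show ?thesis using W by (auto simp: Lp_elems_iff intro: le_less_trans)
    qed
    \<comment> \<open>Tested on boxes, R n tends to u because its polynomial has value 1 at 1, and
      to v by dominated convergence.\<close>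
    have uv: "AE x in lborel. u x = v x"
    proof (rule Lp_AE_eqI[OF u v pq(1)])
      fix a b :: "real^'n"
      have "(\<lambda>n. LINT x|lborel. of_real (indicator (box a b) x) * R n x) \<longlonglongrightarrow> (LINT x|lborel. of_real (indicator (box a b) x) * u x)"
        unfolding R_def using u pq m by (intro heat_poly_box_tendsto[where p=p]) (auto simp: poly_power)
      moreover have "(\<lambda>n. LINT x|lborel. of_real (indicator (box a b) x) * R n x) \<longlonglongrightarrow> (LINT x|lborel. of_real (indicator (box a b) x) * v x)"
      proof (rule integral_dominated_convergence)
        show "integrable lborel (\<lambda>x. norm (of_real (indicator (box a b) x) * W x))"
          by (intro integrable_norm integrable_box_Lp[OF W pq(1)])
        show "AE x in lborel. (\<lambda>n. of_real (indicator (box a b) x) * R n x) \<longlonglongrightarrow> of_real (indicator (box a b) x) * v x"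
          using series(1) by eventually_elim (intro tendsto_intros conv(1))
        show "AE x in lborel. norm (of_real (indicator (box a b) x) * R n x) \<le> norm (of_real (indicator (box a b) x) * W x)" for n
          using series(1) by eventually_elim (auto simp: norm_mult intro!: mult_left_mono conv(2))
      qed measurable
      ultimately show "(LINT x|lborel. of_real (indicator (box a b) x) * u x) = (LINT x|lborel. of_real (indicator (box a b) x) * v x)"
        by (rule LIMSEQ_unique)
    qed
    \<comment> \<open>u - R j is the tail of the series from j on, whose terms share the factor
      \<rho>^(2j).\<close>
    have "lpow q (\<lambda>x. u x - R j x) \<le> ennreal ((2 * (A * \<rho> ^ (2 * j)) / (1 - \<rho>)) powr q)"
    proof (rule geometric_series_lpow(2)[of "\<lambda>n. \<Delta> (n + j)" q "A * \<rho> ^ (2 * j)" \<rho>, rule_format])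
      show "lpow q (\<Delta> (n + j)) \<le> ennreal ((A * \<rho> ^ (2 * j) * \<rho> ^ (2 * n)) powr q)" for n
        using lq[of "n + j"] by (simp add: power_add mult_ac distrib_left)
      show "AE x in lborel. ennreal (norm (u x - R j x)) \<le> (\<Sum>n. ennreal (norm (\<Delta> (n + j) x)))"
        using uv series(1)
      proof eventually_elim
        case (elim x)
        have "(\<lambda>n. R (n + j) x) \<longlonglongrightarrow> v x"
          using conv(1)[OF elim(2)] by (rule LIMSEQ_ignore_initial_segment)
        then have "(\<lambda>n. R (Suc n + j) x - R (n + j) x) sums (v x - R (0 + j) x)"
          by (rule telescope_sums)
        then have sums: "(\<lambda>n. \<Delta> (n + j) x) sums (u x - R j x)"
          using elim(1) by (simp add: \<Delta>_def)
        have sm: "summable (\<lambda>n. norm (\<Delta> (n + j) x))"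
          using elim(2) by (simp add: summable_iff_shift[of "\<lambda>n. norm (\<Delta> n x)"])
        have "norm (u x - R j x) \<le> (\<Sum>n. norm (\<Delta> (n + j) x))"
          using summable_norm[OF sm] sums_unique[OF sums] by simp
        then have "ennreal (norm (u x - R j x)) \<le> ennreal (\<Sum>n. norm (\<Delta> (n + j) x))" by (rule ennreal_leI)
        also have "\<dots> = (\<Sum>n. ennreal (norm (\<Delta> (n + j) x)))"
          using sm by (intro suminf_ennreal2[symmetric]) auto
        finally show ?case .
      qed
    qed (use A \<rho> q1 meas in auto)
    also have "2 * (A * \<rho> ^ (2 * j)) / (1 - \<rho>) = C * B * \<rho> ^ (2 * j)"
      by (simp add: A_def C_def)
    finally show ?thesis unfolding R_def .
  qed
  then show ?thesis using that[OF C \<rho>] by blast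
qed

section \<open>Uniform boundedness\<close>

text \<open>The proof is a gliding hump. The dual space needs no completeness argument: the
  functional that yields the contradiction is a pointwise convergent series. Additivity is required
  on \<open>V\<close> rather than on \<open>elems A\<close>, since \<open>elems A\<close> need not be known to be closed under sums.\<close>

lemma uniform_boundedness:
  fixes A :: "'x fspace" and u :: "nat \<Rightarrow> 'x \<Rightarrow> complex"
  assumes AV: "elems A \<subseteq> V" and u: "\<And>k. u k \<in> elems A" and w: "w \<in> elems A"
    and V: "\<And>f g. f \<in> V \<Longrightarrow> g \<in> V \<Longrightarrow> (\<lambda>x. f x + g x) \<in> V" "\<And>f c. f \<in> V \<Longrightarrow> (\<lambda>x. c * f x) \<in> V"
    and weak: "weakly_convergent A (\<lambda>k x. u k x - w x) (\<lambda>x. 0)"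
    and \<Lambda>_add: "\<And>l f g. l \<in> \<Lambda> \<Longrightarrow> f \<in> V \<Longrightarrow> g \<in> V \<Longrightarrow> l (\<lambda>x. f x + g x) = l f + l g"
    and \<Lambda>_cmult: "\<And>l c f. l \<in> \<Lambda> \<Longrightarrow> f \<in> V \<Longrightarrow> l (\<lambda>x. c * f x) = c * l f"
    and \<Lambda>_bound: "\<And>l f. l \<in> \<Lambda> \<Longrightarrow> f \<in> elems A \<Longrightarrow> norm (l f) \<le> C * fnorm A f"
  shows "\<exists>B. \<forall>l\<in>\<Lambda>. \<forall>k. norm (l (u k)) \<le> B"
proof (rule ccontr)
  assume "\<not> (\<exists>B. \<forall>l\<in>\<Lambda>. \<forall>k. norm (l (u k)) \<le> B)"
  then have unb: "\<exists>k. \<exists>l\<in>\<Lambda>. B < norm (l (u k))" for B by (meson not_le)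
  then have ne: "\<Lambda> \<noteq> {}" by blast
  \<comment> \<open>The size of u k as seen by \<Lambda>: finite for each k by the bound on
    \<Lambda>, unbounded in k by the assumption to be refuted.\<close>
  define N where "N k = (SUP l\<in>\<Lambda>. norm (l (u k)))" for k
  have bdd: "bdd_above ((\<lambda>l. norm (l (u k))) ` \<Lambda>)" for k
    using \<Lambda>_bound u by (intro bdd_aboveI2[of _ _ "C * fnorm A (u k)"]) auto
  have N: "norm (l (u k)) \<le> N k" if "l \<in> \<Lambda>" for l k
    unfolding N_def using that bdd by (intro cSUP_upper) auto
  \<comment> \<open>The growth 4^n outruns the weights 3^(-n) of the series below, and the factor
    2/3 leaves room for its tail.\<close>
  have "\<exists>k l. l \<in> \<Lambda> \<and> 4 ^ n < N k \<and> 2 / 3 * N k \<le> norm (l (u k))" for n :: nat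
  proof -
    obtain k l where kl: "l \<in> \<Lambda>" "4 ^ n < norm (l (u k))" using unb by blast
    then have k: "4 ^ n < N k" using N[OF kl(1), of k] by simp
    have "(0::real) < 4 ^ n" by simp
    then have "2 / 3 * N k < N k" using k by linarith
    then have "\<exists>l\<in>\<Lambda>. 2 / 3 * N k < norm (l (u k))"
      unfolding N_def[of k] using ne bdd[of k] by (subst (asm) less_cSUP_iff) auto
    then show ?thesis using k less_imp_le by blast
  qed
  then obtain \<kappa> and l :: "nat \<Rightarrow> ('x \<Rightarrow> complex) \<Rightarrow> complex" where
    l: "\<And>n. l n \<in> \<Lambda>" "\<And>n. 4 ^ n < N (\<kappa> n)" "\<And>n. 2 / 3 * N (\<kappa> n) \<le> norm (l n (u (\<kappa> n)))"
    by metis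
  \<comment> \<open>Partial sums of the series, built together with their signs, because the sign of
    the n-th term depends on the value of the preceding sum at u (\<kappa> n).\<close>
  define L where "L = rec_nat (\<lambda>f. 0) (\<lambda>n F f. F f +
     (if norm (l n (u (\<kappa> n)) * (1 / 3) ^ n) \<le> norm (F (u (\<kappa> n)) + l n (u (\<kappa> n)) * (1 / 3) ^ n) then 1 else - 1) * (l n f * (1 / 3) ^ n))"
  define e :: "nat \<Rightarrow> complex" where "e n =
    (if norm (l n (u (\<kappa> n)) * (1 / 3) ^ n) \<le> norm (L n (u (\<kappa> n)) + l n (u (\<kappa> n)) * (1 / 3) ^ n) then 1 else - 1)" for n
  have L0: "L 0 f = 0" and LS: "L (Suc n) f = L n f + e n * (l n f * (1 / 3) ^ n)" for n f
    by (simp_all add: L_def e_def)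
  have e: "norm (e n) = 1" for n by (simp add: e_def)
  have L: "L n f = (\<Sum>i<n. e i * (l i f * (1 / 3) ^ i))" for n f
    by (induction n) (simp_all add: L0 LS)
  have lower: "2 / 3 * N (\<kappa> n) * (1 / 3) ^ n \<le> norm (L (Suc n) (u (\<kappa> n)))" for n
  proof -
    let ?b = "l n (u (\<kappa> n)) * (1 / 3) ^ n" and ?a = "L n (u (\<kappa> n))"
    have "norm ?b \<le> norm (?a + e n * ?b)"
    proof (cases "norm ?b \<le> norm (?a + ?b)")
      case True
      then show ?thesis by (simp add: e_def)
    next
      case False
      \<comment> \<open>One of a + b and a - b has norm at least that of b, so a suitable sign
        always exists.\<close>
      have "2 * norm ?b = norm ((?a + ?b) - (?a - ?b))" by (simp add: norm_mult)
      also have "\<dots> \<le> norm (?a + ?b) + norm (?a - ?b)" by (rule norm_triangle_ineq4)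
      finally have "norm ?b \<le> norm (?a - ?b)" using False by linarith
      then show ?thesis using False by (simp add: e_def)
    qed
    moreover have "norm ?b = norm (l n (u (\<kappa> n))) * (1 / 3) ^ n"
      by (simp add: norm_mult norm_power norm_divide)
    moreover have "2 / 3 * N (\<kappa> n) * (1 / 3) ^ n \<le> norm (l n (u (\<kappa> n))) * (1 / 3) ^ n"
      by (intro mult_right_mono l) simp
    ultimately show ?thesis unfolding LS by linarith
  qed
  define F where "F f = (\<Sum>i. e i * (l i f * (1 / 3) ^ i))" for f
  have geo: "summable (\<lambda>i. c * (1 / 3) ^ i)" for c :: real
    by (intro summable_mult summable_geometric) simp
  have term_le: "norm (e i * (l i f * (1 / 3) ^ i)) \<le> C * fnorm A f * (1 / 3) ^ i" if "f \<in> elems A" for f i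
    using \<Lambda>_bound[OF l(1) that, of i] by (simp add: norm_mult e norm_power norm_divide mult_right_mono)
  have sm: "summable (\<lambda>i. e i * (l i f * (1 / 3) ^ i))" if "f \<in> elems A" for f
    using term_le[OF that] by (intro summable_comparison_test'[OF geo]) auto
  have "bounded_functional A F"
    unfolding bounded_functional_def
  proof (intro conjI ballI allI)
    fix f g assume fg: "f \<in> elems A" "g \<in> elems A"
    then have "f \<in> V" "g \<in> V" using AV by auto
    then have "e i * (l i (\<lambda>x. f x + g x) * (1 / 3) ^ i) = e i * (l i f * (1 / 3) ^ i) + e i * (l i g * (1 / 3) ^ i)" for i
      by (simp add: \<Lambda>_add[OF l(1)] algebra_simps)
    then show "F (\<lambda>x. f x + g x) = F f + F g"
      unfolding F_def by (simp add: suminf_add[OF sm[OF fg(1)] sm[OF fg(2)]])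
  next
    fix c f assume f: "f \<in> elems A"
    then have "f \<in> V" using AV by auto
    then have "e i * (l i (\<lambda>x. c * f x) * (1 / 3) ^ i) = c * (e i * (l i f * (1 / 3) ^ i))" for i
      by (simp add: \<Lambda>_cmult[OF l(1)] algebra_simps)
    then show "F (\<lambda>x. c * f x) = c * F f"
      unfolding F_def by (simp only: suminf_mult[OF sm[OF f]])
  next
    show "\<exists>K. \<forall>f\<in>elems A. norm (F f) \<le> K * fnorm A f"
    proof (intro exI ballI)
      fix f assume f: "f \<in> elems A"
      have "norm (F f) \<le> (\<Sum>i. C * fnorm A f * (1 / 3) ^ i)"
        unfolding F_def by (rule norm_suminf_le[OF term_le[OF f] geo])
      also have "\<dots> = C * fnorm A f * (3 / 2)"
        by (subst suminf_mult) (simp_all add: suminf_geometric)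
      finally show "norm (F f) \<le> C * (3 / 2) * fnorm A f" by (simp add: mult_ac)
    qed
  qed
  then have lim: "(\<lambda>k. F (\<lambda>x. u k x - w x)) \<longlonglongrightarrow> F (\<lambda>x. 0)"
    using weak by (simp add: weakly_convergent_def)
  have "F (\<lambda>x. u k x - w x) = F (u k) - F w" for k
  proof -
    have uV: "u k \<in> V" "w \<in> V" using AV u w by auto
    have d: "l i (\<lambda>x. u k x - w x) = l i (u k) - l i w" for i
      using \<Lambda>_add[OF l(1) uV(1) V(2)[OF uV(2), of "-1"], of i] \<Lambda>_cmult[OF l(1) uV(2), of i "-1"] by simp
    have "e i * (l i (\<lambda>x. u k x - w x) * (1 / 3) ^ i) = e i * (l i (u k) * (1 / 3) ^ i) - e i * (l i w * (1 / 3) ^ i)" for i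
      by (simp only: d left_diff_distrib right_diff_distrib)
    then show ?thesis
      unfolding F_def by (simp add: suminf_diff[OF sm[OF u] sm[OF w]])
  qed
  with lim have "(\<lambda>k. F (u k) - F w) \<longlonglongrightarrow> F (\<lambda>x. 0)" by simp
  then have "Bseq (\<lambda>k. F (u k) - F w)" by (intro convergent_imp_Bseq convergentI)
  then obtain K where "\<And>k. norm (F (u k) - F w) \<le> K" by (auto simp: Bseq_def)
  then have bound: "norm (F (u k)) \<le> K + norm (F w)" for k
    by (smt (verit) norm_triangle_ineq2)
  have grow: "1 / 6 * (4 / 3) ^ n \<le> K + norm (F w)" for n :: nat
  proof -
    let ?v = "u (\<kappa> n)"
    have tail: "F ?v - L (Suc n) ?v = (\<Sum>i. e (i + Suc n) * (l (i + Suc n) ?v * (1 / 3) ^ (i + Suc n)))"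
      unfolding F_def L by (subst suminf_split_initial_segment[OF sm[OF u], of _ "Suc n"]) simp
    \<comment> \<open>The later functionals also belong to \<Lambda>, so on this vector they are
      bounded by N (\<kappa> n). The tail of the weights is (1/2) 3^(-n), and 2/3 - 1/2 = 1/6
      remains.\<close>
    have "norm (F ?v - L (Suc n) ?v) \<le> (\<Sum>i. N (\<kappa> n) * (1 / 3) ^ Suc n * (1 / 3) ^ i)"
      unfolding tail
    proof (rule norm_suminf_le[OF _ geo])
      fix i
      have "norm (l (i + Suc n) ?v) * (1 / 3) ^ (i + Suc n) \<le> N (\<kappa> n) * (1 / 3) ^ (i + Suc n)"
        by (intro mult_right_mono N l) simp
      then show "norm (e (i + Suc n) * (l (i + Suc n) ?v * (1 / 3) ^ (i + Suc n))) \<le> N (\<kappa> n) * (1 / 3) ^ Suc n * (1 / 3) ^ i"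
        by (simp add: norm_mult e norm_power norm_divide power_add mult_ac)
    qed
    also have "\<dots> = 1 / 2 * N (\<kappa> n) * (1 / 3) ^ n"
      by (subst suminf_mult) (simp_all add: suminf_geometric)
    finally have "norm (L (Suc n) ?v) - norm (F ?v) \<le> 1 / 2 * N (\<kappa> n) * (1 / 3) ^ n"
      by (smt (verit) norm_triangle_ineq2 norm_minus_commute)
    then have "1 / 6 * N (\<kappa> n) * (1 / 3) ^ n \<le> norm (F ?v)"
      using lower[of n] by simp
    moreover have "1 / 6 * 4 ^ n * (1 / 3) ^ n \<le> 1 / 6 * N (\<kappa> n) * (1 / 3) ^ n"
      using l(2)[of n] by (intro mult_right_mono) auto
    moreover have "1 / 6 * 4 ^ n * (1 / 3) ^ n = 1 / 6 * (4 / 3 :: real) ^ n"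
      by (simp add: power_divide)
    ultimately show ?thesis using bound[of "\<kappa> n"] by linarith
  qed
  obtain n :: nat where "6 * (K + norm (F w)) < (4 / 3) ^ n"
    using real_arch_pow[of "4 / 3" "6 * (K + norm (F w))"] by auto
  moreover have False if "1 / 6 * a \<le> b" "6 * b < a" for a b :: real
    using that by linarith
  ultimately show False using grow[of n] by blast
qed

text \<open>The usual extremal function conj(sgn F) |F|^(p - 1), scaled by the norm c of F. The
  inequality \<open>young\<close>, with constant 1 on both terms, is used in place of Hoelder's,
  hence the factor 2.\<close>

lemma Lp_norming_function:
  fixes F :: "real^'n \<Rightarrow> complex"
  assumes F: "F \<in> elems (Lp p)" and p: "1 < p"
  obtains \<psi> where "\<And>G. G \<in> elems (Lp p) \<Longrightarrow> integrable lborel (\<lambda>x. G x * \<psi> x)"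
    "\<And>G. G \<in> elems (Lp p) \<Longrightarrow> norm (LINT x|lborel. G x * \<psi> x) \<le> 2 * fnorm (Lp p) G"
    "(LINT x|lborel. F x * \<psi> x) = of_real (fnorm (Lp p) F)"
proof (cases "fnorm (Lp p) F = 0")
  case True
  then show ?thesis using that[of "\<lambda>x. 0"] by (simp add: Lp_fnorm_nonneg)
next
  case False
  define c where "c = fnorm (Lp p) F"
  have c: "0 < c" using False Lp_fnorm_nonneg[of p F] by (simp add: c_def)
  have Fm [measurable]: "F \<in> borel_measurable borel" using F Lp_measurable by auto
  define \<psi> where "\<psi> x = cnj (sgn (F x)) * of_real ((norm (F x) / c) powr (p - 1))" for x
  have [measurable]: "cnj \<in> borel_measurable borel"
    by (intro borel_measurable_continuous_onI continuous_intros)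
  have [measurable]: "\<psi> \<in> borel_measurable borel" unfolding \<psi>_def complex_sgn_def by measurable
  have n\<psi>: "norm (\<psi> x) \<le> (norm (F x) / c) powr (p - 1)" for x
    by (simp add: \<psi>_def norm_mult norm_sgn)
  have young: "a * b powr (p - 1) \<le> a powr p + b powr p" if "0 \<le> a" "0 \<le> b" for a b :: real
  proof (cases "a \<le> b")
    case True
    have "a * b powr (p - 1) \<le> b * b powr (p - 1)" using True that by (intro mult_right_mono) auto
    also have "\<dots> = b powr p" using that powr_mult_base[of b "p - 1"] by simp
    finally show ?thesis by (simp add: add_increasing)
  next
    case False
    have "a * b powr (p - 1) \<le> a * a powr (p - 1)"
      using False that p by (intro mult_left_mono powr_mono2) auto
    also have "\<dots> = a powr p" using that powr_mult_base[of a "p - 1"] by simp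
    finally show ?thesis by (simp add: add_increasing2)
  qed
  \<comment> \<open>t stands for the norm of G but stays positive even if G vanishes almost
    everywhere; in the end it decreases to the norm.\<close>
  have bound: "(\<integral>\<^sup>+x. ennreal (norm (G x * \<psi> x)) \<partial>lborel) \<le> ennreal (2 * t)"
    if G: "G \<in> elems (Lp p)" and t: "0 < t" "fnorm (Lp p) G \<le> t" for G t
  proof -
    have [measurable]: "G \<in> borel_measurable borel" using G Lp_measurable by auto
    have "(\<integral>\<^sup>+x. ennreal (norm (G x * \<psi> x)) \<partial>lborel)
       \<le> (\<integral>\<^sup>+x. ennreal (t / t powr p) * ennreal (norm (G x) powr p) + ennreal (t / c powr p) * ennreal (norm (F x) powr p) \<partial>lborel)"
    proof (rule nn_integral_mono)
      fix x
      have "norm (G x * \<psi> x) \<le> norm (G x) * (norm (F x) / c) powr (p - 1)"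
        unfolding norm_mult by (intro mult_left_mono n\<psi>) auto
      also have "\<dots> = t * ((norm (G x) / t) * (norm (F x) / c) powr (p - 1))" using t by simp
      also have "\<dots> \<le> t * ((norm (G x) / t) powr p + (norm (F x) / c) powr p)"
        using t c by (intro mult_left_mono young) auto
      also have "\<dots> = t / t powr p * norm (G x) powr p + t / c powr p * norm (F x) powr p"
        using t c by (simp add: powr_divide distrib_left)
      finally show "ennreal (norm (G x * \<psi> x)) \<le> ennreal (t / t powr p) * ennreal (norm (G x) powr p) + ennreal (t / c powr p) * ennreal (norm (F x) powr p)"
        using t c by (simp add: ennreal_leI flip: ennreal_mult ennreal_plus)
    qed
    also have "\<dots> = ennreal (t / t powr p) * lpow p G + ennreal (t / c powr p) * lpow p F"
      unfolding lpow_def by (subst nn_integral_add) (auto simp: nn_integral_cmult)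
    also have "\<dots> \<le> ennreal (t / t powr p) * ennreal (t powr p) + ennreal (t / c powr p) * ennreal (c powr p)"
      using G F p t Lp_fnorm_nonneg[of p G] by (intro add_mono mult_left_mono) (auto simp: lpow_eq_fnorm c_def intro!: ennreal_leI powr_mono2)
    also have "\<dots> = ennreal (2 * t)"
      using t c by (simp flip: ennreal_mult ennreal_plus)
    finally show ?thesis .
  qed
  show ?thesis
  proof (rule that)
    fix G :: "real^'n \<Rightarrow> complex" assume G: "G \<in> elems (Lp p)"
    have [measurable]: "G \<in> borel_measurable borel" using G Lp_measurable by auto
    show int: "integrable lborel (\<lambda>x. G x * \<psi> x)"
      unfolding integrable_iff_bounded
      using le_less_trans[OF bound[OF G, of "fnorm (Lp p) G + 1"]] Lp_fnorm_nonneg[of p G] by simp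
    have "norm (LINT x|lborel. G x * \<psi> x) / 2 \<le> t" if "fnorm (Lp p) G < t" for t
    proof -
      have t: "0 < t" using that Lp_fnorm_nonneg[of p G] by linarith
      have "ennreal (norm (LINT x|lborel. G x * \<psi> x)) \<le> ennreal (2 * t)"
        using integral_norm_bound_ennreal[OF int] bound[OF G t less_imp_le[OF that]] by (rule order_trans)
      then show ?thesis using t by simp
    qed
    then have "norm (LINT x|lborel. G x * \<psi> x) / 2 \<le> fnorm (Lp p) G" by (rule dense_ge)
    then show "norm (LINT x|lborel. G x * \<psi> x) \<le> 2 * fnorm (Lp p) G" by simp
  next
    have "F x * \<psi> x = of_real (c / c powr p * norm (F x) powr p)" for x
    proof -
      have "F x * cnj (sgn (F x)) = of_real (norm (F x))"
        by (cases "F x = 0") (simp_all add: sgn_eq complex_norm_square[symmetric] power2_eq_square flip: of_real_divide of_real_mult)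
      then have "F x * \<psi> x = of_real (norm (F x) * (norm (F x) / c) powr (p - 1))"
        by (simp add: \<psi>_def mult.assoc[symmetric])
      also have "norm (F x) * (norm (F x) / c) powr (p - 1) = c / c powr p * norm (F x) powr p"
      proof -
        have "norm (F x) * norm (F x) powr (p - 1) = norm (F x) powr p"
          using powr_mult_base[of "norm (F x)" "p - 1"] by simp
        then have "norm (F x) * (norm (F x) / c) powr (p - 1) = norm (F x) powr p / c powr (p - 1)"
          using c by (simp add: powr_divide)
        then show ?thesis using c by (simp add: powr_diff)
      qed
      finally show ?thesis .
    qed
    then have "(LINT x|lborel. F x * \<psi> x) = of_real (LINT x|lborel. c / c powr p * norm (F x) powr p)"
      by (simp only: integral_complex_of_real)
    also have "(LINT x|lborel. c / c powr p * norm (F x) powr p) = c / c powr p * enn2real (lpow p F)"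
      unfolding lpow_def by (subst integral_mult_right_zero, subst integral_eq_nn_integral) auto
    also have "enn2real (lpow p F) = c powr p"
      using F p by (simp add: lpow_eq_fnorm c_def)
    finally show "(LINT x|lborel. F x * \<psi> x) = of_real (fnorm (Lp p) F)"
      using c by (simp add: c_def)
  qed
qed

text \<open>For every admissible T, 1/c times the integral of T f against \<psi> is a functional of
  f in one set \<Lambda> that is defined without reference to T. Uniform boundedness on \<Lambda>
  therefore yields a single B for all T, in particular for all smoothing times and all scales
  h.\<close>

lemma D_weakly_convergent_uniform_bound:
  fixes A :: "(real^'n) fspace"
  assumes A: "elems A \<subseteq> elems (Lp p)" and p: "1 < p" and u: "\<And>k. u k \<in> elems A" and w: "w \<in> elems A"
    and weak: "weakly_convergent A (\<lambda>k x. u k x - w x) (\<lambda>x. 0)"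
  obtains B where "0 \<le> B"
    "\<And>(T :: (real^'n \<Rightarrow> complex) \<Rightarrow> real^'n \<Rightarrow> complex) c k. 0 < c \<Longrightarrow> (\<And>f. f \<in> elems (Lp p) \<Longrightarrow> T f \<in> elems (Lp p)) \<Longrightarrow>
      (\<And>f g. f \<in> elems (Lp p) \<Longrightarrow> g \<in> elems (Lp p) \<Longrightarrow> T (\<lambda>x. f x + g x) = (\<lambda>x. T f x + T g x)) \<Longrightarrow>
      (\<And>a f. f \<in> elems (Lp p) \<Longrightarrow> T (\<lambda>x. a * f x) = (\<lambda>x. a * T f x)) \<Longrightarrow>
      (\<And>f. f \<in> elems A \<Longrightarrow> fnorm (Lp p) (T f) \<le> c * fnorm A f) \<Longrightarrow>
      fnorm (Lp p) (T (\<lambda>x. u k x - w x)) \<le> c * B"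
proof -
  let ?V = "elems (Lp p) :: (real^'n \<Rightarrow> complex) set"
  define \<Lambda> where "\<Lambda> = {l. (\<forall>f\<in>?V. \<forall>g\<in>?V. l (\<lambda>x. f x + g x) = l f + l g) \<and>
     (\<forall>c. \<forall>f\<in>?V. l (\<lambda>x. c * f x) = c * (l f :: complex)) \<and> (\<forall>f\<in>elems A. norm (l f) \<le> 2 * fnorm A f)}"
  have "\<exists>B. \<forall>l\<in>\<Lambda>. \<forall>k. norm (l (u k)) \<le> B"
    using p by (intro uniform_boundedness[OF A u w _ _ weak, of \<Lambda> 2]) (auto simp: \<Lambda>_def intro: Lp_add Lp_cmult)
  then obtain B0 where B0: "\<And>l k. l \<in> \<Lambda> \<Longrightarrow> norm (l (u k)) \<le> B0" by blast
  \<comment> \<open>The 4 is the factor of the triangle inequality for T (u k) - T w; the absolute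
    values make B nonnegative.\<close>
  define B where "B = 4 * (\<bar>B0\<bar> + \<bar>fnorm A w\<bar>)"
  show ?thesis
  proof (rule that[of B])
    fix T :: "(real^'n \<Rightarrow> complex) \<Rightarrow> real^'n \<Rightarrow> complex" and c :: real and k
    assume c: "0 < c" and T: "\<And>f. f \<in> ?V \<Longrightarrow> T f \<in> ?V"
      and T_add: "\<And>f g. f \<in> ?V \<Longrightarrow> g \<in> ?V \<Longrightarrow> T (\<lambda>x. f x + g x) = (\<lambda>x. T f x + T g x)"
      and T_cmult: "\<And>a f. f \<in> ?V \<Longrightarrow> T (\<lambda>x. a * f x) = (\<lambda>x. a * T f x)"
      and T_bound: "\<And>f. f \<in> elems A \<Longrightarrow> fnorm (Lp p) (T f) \<le> c * fnorm A f"
    have uw: "u k \<in> ?V" "w \<in> ?V" using A u w by auto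
    obtain \<psi> where \<psi>: "\<And>G. G \<in> ?V \<Longrightarrow> integrable lborel (\<lambda>x. G x * \<psi> x)"
      "\<And>G. G \<in> ?V \<Longrightarrow> norm (LINT x|lborel. G x * \<psi> x) \<le> 2 * fnorm (Lp p) G"
      "(LINT x|lborel. T (u k) x * \<psi> x) = of_real (fnorm (Lp p) (T (u k)))"
      by (rule Lp_norming_function[OF T[OF uw(1)] p]) (rule that)
    define l where "l f = of_real (1 / c) * (LINT x|lborel. T f x * \<psi> x)" for f
    have "l \<in> \<Lambda>"
      unfolding \<Lambda>_def
    proof (intro CollectI conjI ballI allI)
      fix f g assume "f \<in> ?V" "g \<in> ?V"
      then show "l (\<lambda>x. f x + g x) = l f + l g"
        using \<psi>(1) T by (simp add: l_def T_add distrib_right distrib_left)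
    next
      fix a f assume "f \<in> ?V"
      then show "l (\<lambda>x. a * f x) = a * l f"
        by (simp add: l_def T_cmult mult.assoc mult.left_commute)
    next
      fix f assume f: "f \<in> elems A"
      have "norm (l f) = 1 / c * norm (LINT x|lborel. T f x * \<psi> x)"
        using c by (simp add: l_def norm_mult norm_divide)
      also have "\<dots> \<le> 1 / c * (2 * (c * fnorm A f))"
        using c f A by (intro mult_left_mono order.trans[OF \<psi>(2)] T T_bound) auto
      finally show "norm (l f) \<le> 2 * fnorm A f" using c by simp
    qed
    then have "norm (l (u k)) \<le> B0" by (rule B0)
    moreover have "norm (l (u k)) = fnorm (Lp p) (T (u k)) / c"
      using c by (simp add: l_def \<psi>(3) norm_mult norm_divide Lp_fnorm_nonneg)
    ultimately have Tu: "fnorm (Lp p) (T (u k)) \<le> c * B0" using c by (simp add: divide_le_eq mult.commute)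
    have "T (\<lambda>x. u k x - w x) = (\<lambda>x. T (u k) x + (-1) * T w x)"
      using T_add[OF uw(1) Lp_cmult[OF uw(2), of "-1"]] T_cmult[OF uw(2), of "-1"] by simp
    then have "fnorm (Lp p) (T (\<lambda>x. u k x - w x)) \<le> 4 * (fnorm (Lp p) (T (u k)) + fnorm (Lp p) (\<lambda>x. (-1) * T w x))"
      using T uw p by (simp only:) (intro Lp_fnorm_add_le Lp_cmult, auto)
    also have "fnorm (Lp p) (\<lambda>x. (-1) * T w x) = fnorm (Lp p) (T w)" by (simp add: Lp_def)
    also have "4 * (fnorm (Lp p) (T (u k)) + fnorm (Lp p) (T w)) \<le> 4 * (c * B0 + c * fnorm A w)"
      using Tu T_bound[OF w] by simp
    also have "\<dots> = c * (4 * (B0 + fnorm A w))" by (simp add: algebra_simps)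
    also have "\<dots> \<le> c * B" unfolding B_def using c by (intro mult_left_mono) auto
    finally show "fnorm (Lp p) (T (\<lambda>x. u k x - w x)) \<le> c * B" .
  qed (simp add: B_def)
qed

section \<open>Vanishing and cocompactness\<close>

text \<open>|y|^2 \<le> 2 |z|^2 + 2 |z - y|^2 trades half of the decay in z - y for decay in y,
  uniformly for z in a bounded set.\<close>

lemma heat_kernel_translates_le:
  assumes "0 < \<tau>" "(norm z)\<^sup>2 \<le> b"
  shows "heat_kernel \<tau> (z - y)
    \<le> exp (- \<tau>) * (4 * pi * \<tau>) powr (- (CARD('n) / 2)) * exp (b / (4 * \<tau>)) * exp (- (1 / (8 * \<tau>)) * (norm (y::real^'n))\<^sup>2)"
proof -
  have "(norm y)\<^sup>2 \<le> (norm z + norm (z - y))\<^sup>2"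
    using norm_triangle_sub[of y z] by (intro power_mono) (auto simp: norm_minus_commute)
  also have "\<dots> \<le> 2 * (norm z)\<^sup>2 + 2 * (norm (z - y))\<^sup>2"
    using sum_squares_bound[of "norm z" "norm (z - y)"] by (simp add: power2_sum)
  finally have "(norm y)\<^sup>2 / 2 - b \<le> (norm (z - y))\<^sup>2" using assms(2) by simp
  then have "- (norm (z - y))\<^sup>2 / (4 * \<tau>) \<le> (b - (norm y)\<^sup>2 / 2) / (4 * \<tau>)"
    using assms(1) by (intro divide_right_mono) auto
  also have "\<dots> = b / (4 * \<tau>) + (- (1 / (8 * \<tau>)) * (norm y)\<^sup>2)"
    using assms(1) by (simp add: field_simps)
  finally have "exp (- (norm (z - y))\<^sup>2 / (4 * \<tau>)) \<le> exp (b / (4 * \<tau>)) * exp (- (1 / (8 * \<tau>)) * (norm y)\<^sup>2)"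
    by (subst exp_add[symmetric]) simp
  then show ?thesis
    unfolding heat_kernel_def mult.assoc by (intro mult_left_mono) auto
qed

text \<open>A point sequence \<open>x k\<close> is split into a lattice part, absorbed by the shifts, and a part in the
  unit cube, over which the kernels \<open>heat_kernel \<tau> (z - y)\<close> have a common integrable majorant.\<close>

lemma heat_vanishing_along_sequences:
  fixes v :: "nat \<Rightarrow> real^'n \<Rightarrow> complex"
  assumes v: "\<And>k. v k \<in> elems (Lp p)" and p: "1 < p" and \<tau>: "0 < \<tau>"
    and bound: "\<And>k. fnorm (Lp p) (heat \<tau> (v k)) \<le> B"
    and shifts: "\<And>z y. (\<And>k i. y k $ i \<in> \<int>) \<Longrightarrow> (\<lambda>k. heat (2 * \<tau>) (v k) (z + y k)) \<longlonglongrightarrow> 0"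
  shows "(\<lambda>k. heat (3 * \<tau>) (v k) (x k)) \<longlonglongrightarrow> 0"
proof -
  have vm [measurable]: "v k \<in> borel_measurable borel" for k using v Lp_measurable by auto
  define y :: "nat \<Rightarrow> real^'n" where "y k = (\<chi> i. of_int \<lfloor>x k $ i\<rfloor>)" for k
  define z where "z k = x k - y k" for k
  have z: "(norm (z k))\<^sup>2 \<le> CARD('n)" for k
  proof -
    have "(norm (z k))\<^sup>2 = (\<Sum>i\<in>UNIV. (z k $ i)\<^sup>2)"
      unfolding power2_norm_eq_inner inner_vec_def by (simp add: power2_eq_square)
    also have "\<dots> \<le> (\<Sum>i\<in>(UNIV::'n set). 1)"
    proof (rule sum_mono)
      fix i
      have "0 \<le> z k $ i" "z k $ i \<le> 1" unfolding z_def y_def by (simp_all, linarith+)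
      then show "(z k $ i)\<^sup>2 \<le> 1" by (rule power_le_one)
    qed
    finally show ?thesis by simp
  qed
  \<comment> \<open>Of the time 3 \<tau>, one \<tau> carries the assumed L^p bound, the second makes
    F uniformly bounded, and the third is the kernel against which F is averaged.\<close>
  define F where "F k t = heat (2 * \<tau>) (v k) (t + y k)" for k t
  have [measurable]: "F k \<in> borel_measurable borel" for k unfolding F_def by measurable
  have F0: "(\<lambda>k. F k t) \<longlonglongrightarrow> 0" for t
    unfolding F_def by (intro shifts) (simp add: y_def)
  define S where "S = 2 * (4 * pi * \<tau>) powr (- (CARD('n) / (2 * p))) * B"
  have FS: "norm (F k t) \<le> S" for k t
  proof -
    have "heat (2 * \<tau>) (v k) = heat \<tau> (heat \<tau> (v k))"
      using v p \<tau> by (simp add: heat_heat[where p=p])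
    then have "norm (F k t) \<le> 2 * (4 * pi * \<tau>) powr (- (CARD('n) / (2 * p))) * fnorm (Lp p) (heat \<tau> (v k))"
      unfolding F_def using v p \<tau> by (simp only:) (intro heat_norm_le heat_Lp, auto)
    also have "\<dots> \<le> S" unfolding S_def using bound by (intro mult_left_mono) auto
    finally show ?thesis .
  qed
  have eq: "heat (3 * \<tau>) (v k) (x k) = (LINT t|lborel. of_real (heat_kernel \<tau> (z k - t)) * F k t)" for k
  proof -
    have "heat (3 * \<tau>) (v k) (x k) = heat \<tau> (heat (2 * \<tau>) (v k)) (z k + y k)"
      using v p \<tau> by (simp add: heat_heat[where p=p] z_def)
    also have "\<dots> = heat \<tau> (F k) (z k)"
      unfolding F_def by (intro heat_translate[symmetric]) measurable
    finally show ?thesis using \<tau> by (simp add: heat_def)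
  qed
  define c where "c = exp (- \<tau>) * (4 * pi * \<tau>) powr (- (CARD('n) / 2)) * exp (CARD('n) / (4 * \<tau>))"
  define H where "H t = c * exp (- (1 / (8 * \<tau>)) * (norm t)\<^sup>2)" for t :: "real^'n"
  have c: "0 \<le> c" by (simp add: c_def)
  have KH: "heat_kernel \<tau> (z k - t) \<le> H t" for k t
    unfolding H_def c_def using \<tau> z by (rule heat_kernel_translates_le)
  have H0: "0 \<le> H t" for t using c by (simp add: H_def)
  have H: "integrable lborel H"
    unfolding integrable_iff_bounded
  proof
    show "H \<in> borel_measurable lborel" unfolding H_def by measurable
    have "(\<integral>\<^sup>+t. ennreal (norm (H t)) \<partial>lborel) = ennreal c * (\<integral>\<^sup>+t. ennreal (exp (- (1 / (8 * \<tau>)) * (norm (t::real^'n))\<^sup>2)) \<partial>lborel)"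
      using c by (subst nn_integral_cmult[symmetric]) (auto simp: H_def ennreal_mult intro!: nn_integral_cong)
    also have "\<dots> < \<infinity>"
      using \<tau> nn_integral_gaussian[of "1 / (8 * \<tau>)", where 'a="real^'n"] by (simp add: ennreal_mult_less_top)
    finally show "(\<integral>\<^sup>+t. ennreal (norm (H t)) \<partial>lborel) < \<infinity>" .
  qed
  have HF: "integrable lborel (\<lambda>t. H t * norm (F k t))" for k
  proof (rule Bochner_Integration.integrable_bound)
    show "integrable lborel (\<lambda>t. H t * S)" using H by simp
    show "AE t in lborel. norm (H t * norm (F k t)) \<le> norm (H t * S)"
      using FS[of k] c order.trans[OF norm_ge_zero FS] by (intro AE_I2) (auto simp: H_def abs_mult intro!: mult_left_mono)
    show "(\<lambda>t. H t * norm (F k t)) \<in> borel_measurable lborel"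
      unfolding H_def by measurable
  qed
  \<comment> \<open>The kernels centred at z k vary with k, so dominated convergence is applied with
    the fixed majorant H in their place.\<close>
  have "(\<lambda>k. LINT t|lborel. H t * norm (F k t)) \<longlonglongrightarrow> (LINT t|(lborel :: (real^'n) measure). 0)"
  proof (rule integral_dominated_convergence)
    show "integrable lborel (\<lambda>t. H t * S)" using H by simp
    show "AE t in lborel. (\<lambda>k. H t * norm (F k t)) \<longlonglongrightarrow> 0"
    proof (rule AE_I2)
      fix t
      have "(\<lambda>k. H t * norm (F k t)) \<longlonglongrightarrow> H t * 0"
        by (intro tendsto_mult_left tendsto_norm_zero F0)
      then show "(\<lambda>k. H t * norm (F k t)) \<longlonglongrightarrow> 0" by simp
    qed
    show "AE t in lborel. norm (H t * norm (F k t)) \<le> H t * S" for k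
      using FS c by (intro AE_I2) (auto simp: H_def abs_mult intro!: mult_left_mono)
  qed (auto simp: H_def)
  then have lim: "(\<lambda>k. LINT t|lborel. H t * norm (F k t)) \<longlonglongrightarrow> 0" by simp
  show ?thesis
  proof (rule Lim_null_comparison[OF always_eventually lim], rule allI)
    fix k
    have "norm (heat (3 * \<tau>) (v k) (x k)) \<le> (LINT t|lborel. H t * norm (F k t))"
      unfolding eq
    proof (rule order.trans[OF integral_norm_bound])
      show "(LINT t|lborel. norm (of_real (heat_kernel \<tau> (z k - t)) * F k t)) \<le> (LINT t|lborel. H t * norm (F k t))"
        using KH H0 by (intro integral_mono_AE' HF AE_I2) (auto simp: norm_mult heat_kernel_nonneg intro!: mult_right_mono mult_nonneg_nonneg)
    qed
    then show "norm (heat (3 * \<tau>) (v k) (x k)) \<le> (LINT t|lborel. H t * norm (F k t))" .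
  qed
qed

text \<open>Points that violate the bound, wherever there are any, form one sequence, which reduces
  uniformity to sequences. For k without such a point the choice is arbitrary and the bound holds
  anyway.\<close>

lemma eventually_uniform_of_sequences:
  fixes F :: "nat \<Rightarrow> 'a \<Rightarrow> complex"
  assumes "\<And>x. (\<lambda>k. F k (x k)) \<longlonglongrightarrow> 0" "0 < e"
  shows "\<forall>\<^sub>F k in sequentially. \<forall>x. norm (F k x) \<le> e"
proof -
  define x where "x k = (SOME x. e < norm (F k x))" for k
  have "\<forall>\<^sub>F k in sequentially. norm (F k (x k)) < e"
    using tendstoD[OF assms(1)[of x] assms(2)] by simp
  then show ?thesis
  proof eventually_elim
    case (elim k)
    show ?case
    proof (rule ccontr)
      assume "\<not> (\<forall>x. norm (F k x) \<le> e)"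
      then have "\<exists>x. e < norm (F k x)" by (simp add: not_le)
      then have "e < norm (F k (x k))" unfolding x_def by (rule someI_ex)
      with elim show False by simp
    qed
  qed
qed

text \<open>Subcriticality in the form that makes the net exponent of the telescoping series
  positive. For s p \<ge> N it follows from 1/q > 0.\<close>

lemma subcritical_exponent:
  assumes "0 < s" "1 < p" "p < q" "ereal q < critical_exponent N s p"
  shows "real N * (1 / p - 1 / q) < s"
proof (cases "s * p < real N")
  case True
  then have "q < p * real N / (real N - s * p)" using assms by (simp add: critical_exponent_def)
  then have "q * (real N - s * p) < p * real N" using True by (simp add: pos_less_divide_eq)
  then have "real N * (q - p) < s * (p * q)" by (simp add: algebra_simps)
  then have "real N * (q - p) / (p * q) < s" using assms by (simp add: pos_divide_less_eq)
  then show ?thesis using assms by (simp add: diff_divide_distrib right_diff_distrib mult.commute)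
next
  case False
  have "real N * (1 / p - 1 / q) \<le> s * p * (1 / p - 1 / q)"
    using False assms by (intro mult_right_mono) (auto simp: field_simps)
  also have "\<dots> < s * p * (1 / p)"
    using assms by (intro mult_strict_left_mono) auto
  also have "\<dots> = s" using assms by simp
  finally show ?thesis .
qed

theorem theorem2p8:
  fixes s p q0 q s0 s1 :: real
  assumes "s > 0" and "1 < p"
    and "p < q0" and "q0 \<le> q" and "ereal q < critical_exponent CARD('n::finite) s p"
    and "0 \<le> s0" and "s0 < s" and "s < s1"
  shows "cocompact_imbedding lattice_shifts
           (besov s0 s1 s p q0 :: (real^'n) fspace) (Lp q)"
proof -
  let ?A = "besov s0 s1 s p q0 :: (real^'n) fspace"
  \<comment> \<open>This m serves both endpoint spaces, as s0 < s1.\<close>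
  obtain m :: nat where m: "s1 / 2 < of_nat m" using reals_Archimedean2 by blast
  then have m0: "0 < m" using assms by (cases m) auto
  have pq: "1 < p" "p < q" "1 < q" using assms by auto
  interpret besov_setting s p q0 s0 s1 m
    using assms m m0 by unfold_locales auto
  let ?D = "[:1, -1:] ^ m :: complex poly"
  obtain Ct where Ct: "0 < Ct" "\<And>u \<tau>. u \<in> elems ?A \<Longrightarrow> 0 < \<tau> \<Longrightarrow> fnorm (Lp p) (heat \<tau> u) \<le> Ct * fnorm ?A u"
    using besov_heat_le[where 'n='n] by blast
  obtain Cd where Cd: "0 < Cd" "\<And>u h. u \<in> elems ?A \<Longrightarrow> 0 < h \<Longrightarrow>
      fnorm (Lp p) (heat_poly h ?D (heat (h / 2) u)) \<le> Cd * h powr (s / 2) * fnorm ?A u"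
    using besov_difference_le[where 'n='n] by blast
  obtain C \<rho> where C: "0 < C" and \<rho>: "0 < \<rho>" "\<rho> < 1" and tail:
    "\<And>u B j. u \<in> elems (Lp p) \<Longrightarrow> 0 \<le> B \<Longrightarrow>
       (\<And>h. 0 < h \<Longrightarrow> h \<le> 1 \<Longrightarrow> fnorm (Lp p) (heat_poly h ?D (heat (h / 2) (u::real^'n \<Rightarrow> complex))) \<le> B * h powr (s / 2)) \<Longrightarrow>
       lpow q (\<lambda>x. u x - heat_poly ((1 / 2) ^ j) (1 - ?D) u x) \<le> ennreal ((C * B * \<rho> ^ (2 * j)) powr q)"
    using high_frequency_tail[OF pq(1,2) m0 subcritical_exponent[OF assms(1) pq(1,2) assms(5)]] by blast
  \<comment> \<open>1 - (1 - X)^m has no constant term, so R_h contains a factor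
    \<open>heat h\<close> and is itself smoothing.\<close>
  have D0: "poly (1 - ?D) 0 = 0" by (simp add: poly_power)
  then have "[:0, 1:] dvd (1 - ?D)" using poly_eq_0_iff_dvd[of "1 - ?D" 0] by simp
  then obtain P where P: "1 - ?D = P * [:0, 1:]" by (metis dvdE mult.commute)
  have RP: "heat_poly h (1 - ?D) u = heat_poly h P (heat h u)" if "u \<in> elems (Lp p)" "0 \<le> h" for h and u :: "real^'n \<Rightarrow> complex"
    unfolding P using that pq by (simp only: heat_poly_mult[of u p] heat_poly_monom_1)
  have split: "fnorm (Lp q) v \<le> 4 * (fnorm (Lp q) (\<lambda>x. v x - R x) + fnorm (Lp q) R)" "v \<in> elems (Lp q)"
    if "(\<lambda>x. v x - R x) \<in> elems (Lp q)" "R \<in> elems (Lp q)" for v R :: "real^'n \<Rightarrow> complex"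
    using Lp_fnorm_add_le[OF that pq(3)] Lp_add[OF that] pq by simp_all
  have tail_Lq: "(\<lambda>x. u x - heat_poly ((1 / 2) ^ j) (1 - ?D) u x) \<in> elems (Lp q)"
      "fnorm (Lp q) (\<lambda>x. u x - heat_poly ((1 / 2) ^ j) (1 - ?D) u x) \<le> C * B * \<rho> ^ (2 * j)"
    if "u \<in> elems (Lp p)" "0 \<le> B" "\<And>h. 0 < h \<Longrightarrow> h \<le> 1 \<Longrightarrow> fnorm (Lp p) (heat_poly h ?D (heat (h / 2) u)) \<le> B * h powr (s / 2)"
    for u :: "real^'n \<Rightarrow> complex" and B and j :: nat
  proof -
    have [measurable]: "u \<in> borel_measurable borel" using that Lp_measurable by auto
    note t = tail[OF that, of j]
    have "(\<lambda>x. u x - heat_poly ((1 / 2) ^ j) (1 - ?D) u x) \<in> borel_measurable lborel" by measurable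
    then show L: "(\<lambda>x. u x - heat_poly ((1 / 2) ^ j) (1 - ?D) u x) \<in> elems (Lp q)"
      using t by (auto simp: Lp_elems_iff intro: le_less_trans)
    show "fnorm (Lp q) (\<lambda>x. u x - heat_poly ((1 / 2) ^ j) (1 - ?D) u x) \<le> C * B * \<rho> ^ (2 * j)"
      using t that C \<rho> pq by (intro fnorm_le_of_lpow_le[OF L]) auto
  qed
  obtain CP where CP: "0 < CP" "\<And>u h. u \<in> elems (Lp p) \<Longrightarrow> 0 \<le> h \<Longrightarrow>
     fnorm (Lp p) (heat_poly h P (u::real^'n \<Rightarrow> complex)) \<le> CP * fnorm (Lp p) u"
    using fnorm_heat_poly_le[OF pq(1), of P, where 'n='n] by blast
  obtain CQ where CQ: "0 < CQ" "\<And>u h. u \<in> elems (Lp q) \<Longrightarrow> 0 \<le> h \<Longrightarrow>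
     fnorm (Lp q) (heat_poly h P (u::real^'n \<Rightarrow> complex)) \<le> CQ * fnorm (Lp q) u"
    using fnorm_heat_poly_le[OF pq(3), of P, where 'n='n] by blast
  have low_Lq: "heat_poly h (1 - ?D) u \<in> elems (Lp q)" if u: "u \<in> elems (Lp p)" and "0 < h" for h and u :: "real^'n \<Rightarrow> complex"
    unfolding RP[OF u less_imp_le[OF that(2)]] using heat_Lq(1)[OF u pq(1,2) that(2)] that pq
    by (intro heat_poly_Lp) auto
  have "continuous_imbedding ?A (Lp q)"
  proof -
    define c where "c = 2 * (4 * pi * (1 / 2)) powr (- (CARD('n) / 2 * (1 / p - 1 / q)))"
    have c: "0 < c" by (simp add: c_def)
    have "u \<in> elems (Lp q) \<and> fnorm (Lp q) u \<le> 4 * (C * Cd + CQ * (c * Ct)) * fnorm ?A u" if u: "u \<in> elems ?A" for u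
    proof -
      have uL: "u \<in> elems (Lp p)" using u by (rule besov_Lp)
      have hu: "heat (1 / 2) u \<in> elems (Lp p)" using uL pq by (intro heat_Lp) auto
      have B: "0 \<le> Cd * fnorm ?A u" using Cd(1) by (simp add: besov_fnorm_nonneg)
      have "fnorm (Lp p) (heat_poly h ?D (heat (h / 2) u)) \<le> Cd * fnorm ?A u * h powr (s / 2)" if "0 < h" for h
        using Cd(2)[OF u that] by (simp add: mult_ac)
      \<comment> \<open>Scale j = 0, that is h = 1. The part R_1 u is bounded by spending
        \<open>heat 1\<close> in two halves, one for the L^p bound and one for the passage to
        L^q.\<close>
      note t = tail_Lq[OF uL B this, of 0]
      have "heat 1 u = heat (1 / 2) (heat (1 / 2) u)" using uL pq by (simp add: heat_heat[where p=p])
      then have h1: "heat 1 u \<in> elems (Lp q)" "fnorm (Lp q) (heat 1 u) \<le> c * fnorm (Lp p) (heat (1 / 2) u)"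
        using heat_Lq[OF hu pq(1,2), of "1 / 2"] by (simp_all only: c_def)
      have "fnorm (Lp q) (heat_poly 1 (1 - ?D) u) \<le> CQ * fnorm (Lp q) (heat 1 u)"
        using RP[OF uL, of 1] CQ(2)[OF h1(1), of 1] by simp
      also have "\<dots> \<le> CQ * (c * (Ct * fnorm ?A u))"
        using CQ(1) c Ct(2)[OF u, of "1 / 2"] by (intro mult_left_mono order.trans[OF h1(2)]) auto
      finally have low: "fnorm (Lp q) (heat_poly 1 (1 - ?D) u) \<le> CQ * (c * (Ct * fnorm ?A u))" .
      have R: "heat_poly 1 (1 - ?D) u \<in> elems (Lp q)" using uL by (intro low_Lq) auto
      have "fnorm (Lp q) u \<le> 4 * (C * (Cd * fnorm ?A u) + CQ * (c * (Ct * fnorm ?A u)))"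
        using split(1)[of u "heat_poly 1 (1 - ?D) u"] t low R by simp
      moreover have "u \<in> elems (Lp q)"
        using split(2)[of u "heat_poly 1 (1 - ?D) u"] t R by simp
      ultimately show ?thesis by (simp add: algebra_simps)
    qed
    then show ?thesis unfolding continuous_imbedding_def by blast
  qed
  moreover have "norm_convergent (Lp q) u w"
    if u: "\<And>k. u k \<in> elems ?A" and w: "w \<in> elems ?A" and weak: "D_weakly_convergent ?A lattice_shifts u w"
    for u :: "nat \<Rightarrow> real^'n \<Rightarrow> complex" and w
  proof -
    define v where "v k x = u k x - w x" for k x
    have uL: "u k \<in> elems (Lp p)" "w \<in> elems (Lp p)" for k using u w besov_Lp by auto
    have v: "v k \<in> elems (Lp p)" for k unfolding v_def[abs_def] using uL pq by (intro Lp_diff) auto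
    have [measurable]: "v k \<in> borel_measurable borel" for k using v Lp_measurable by auto
    \<comment> \<open>It is D-weak convergence that permits a different lattice vector y k for each
      k; the group element used is the translation by -y k.\<close>
    have shift: "weakly_convergent ?A (\<lambda>k x. v k (x + y k)) (\<lambda>x. 0)" if y: "\<And>k i. y k $ i \<in> \<int>" for y
    proof -
      have "(\<lambda>f x. f (x - (- y k))) \<in> (lattice_shifts :: ((real^'n \<Rightarrow> complex) \<Rightarrow> real^'n \<Rightarrow> complex) set)" for k
        unfolding lattice_shifts_def using y by fastforce
      then have "weakly_convergent ?A (\<lambda>k. (\<lambda>f x. f (x - (- y k))) (\<lambda>x. u k x - w x)) (\<lambda>x. 0)"
        using weak[unfolded D_weakly_convergent_def, rule_format, of "\<lambda>k f x. f (x - (- y k))"] by blast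
      then show ?thesis by (simp add: v_def)
    qed
    have weak0: "weakly_convergent ?A (\<lambda>k x. u k x - w x) (\<lambda>x. 0)"
      using shift[of "\<lambda>k. 0"] by (simp add: v_def)
    have AL: "elems ?A \<subseteq> elems (Lp p)" using besov_Lp by blast
    obtain B where B: "0 \<le> B"
    "\<And>(T :: (real^'n \<Rightarrow> complex) \<Rightarrow> real^'n \<Rightarrow> complex) c k. 0 < c \<Longrightarrow> (\<And>f. f \<in> elems (Lp p) \<Longrightarrow> T f \<in> elems (Lp p)) \<Longrightarrow>
      (\<And>f g. f \<in> elems (Lp p) \<Longrightarrow> g \<in> elems (Lp p) \<Longrightarrow> T (\<lambda>x. f x + g x) = (\<lambda>x. T f x + T g x)) \<Longrightarrow>
      (\<And>a f. f \<in> elems (Lp p) \<Longrightarrow> T (\<lambda>x. a * f x) = (\<lambda>x. a * T f x)) \<Longrightarrow>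
      (\<And>f. f \<in> elems ?A \<Longrightarrow> fnorm (Lp p) (T f) \<le> c * fnorm ?A f) \<Longrightarrow>
      fnorm (Lp p) (T (\<lambda>x. u k x - w x)) \<le> c * B"
      using D_weakly_convergent_uniform_bound[OF AL pq(1) u w weak0] by blast
    have heat_v: "fnorm (Lp p) (heat \<tau> (v k)) \<le> Ct * B" if "0 < \<tau>" for \<tau> k
      unfolding v_def[abs_def] using that pq Ct
      by (intro B(2)) (auto intro: heat_Lp simp: heat_add[where p=p] heat_cmult)
    have diff_v: "fnorm (Lp p) (heat_poly h ?D (heat (h / 2) (v k))) \<le> Cd * B * h powr (s / 2)" if h: "0 < h" for h k
    proof -
      have "fnorm (Lp p) (heat_poly h ?D (heat (h / 2) (v k))) \<le> Cd * h powr (s / 2) * B"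
        unfolding v_def[abs_def] using h pq Cd
        by (intro B(2)) (auto intro!: heat_poly_Lp heat_Lp simp: heat_add[where p=p] heat_cmult heat_poly_add[where p=p] heat_poly_cmult heat_Lp)
      then show ?thesis by (simp add: mult_ac)
    qed
    have shifts: "(\<lambda>k. heat \<tau> (v k) (z + y k)) \<longlonglongrightarrow> 0" if \<tau>: "0 < \<tau>" and y: "\<And>k i. y k $ i \<in> \<int>" for \<tau> z y
    proof -
      define c where "c = 2 * (4 * pi * (\<tau> / 2)) powr (- (CARD('n) / (2 * p)))"
      \<comment> \<open>Point evaluation after smoothing is continuous on the Besov space: half of
        the time gives the L^p bound and half the uniform one. The shifted sequence can then be
        tested with it.\<close>
      have "bounded_functional ?A (\<lambda>f. heat \<tau> f z)"
        unfolding bounded_functional_def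
      proof (intro conjI ballI allI)
        fix f g assume "f \<in> elems ?A" "g \<in> elems ?A"
        then show "heat \<tau> (\<lambda>x. f x + g x) z = heat \<tau> f z + heat \<tau> g z"
          using AL \<tau> pq by (subst heat_add[where p=p]) auto
      next
        fix a f
        show "heat \<tau> (\<lambda>x. a * f x) z = a * heat \<tau> f z" by (simp add: heat_cmult)
      next
        show "\<exists>K. \<forall>f\<in>elems ?A. norm (heat \<tau> f z) \<le> K * fnorm ?A f"
        proof (intro exI ballI)
          fix f assume f: "f \<in> elems ?A"
          have fL: "f \<in> elems (Lp p)" using f AL by auto
          have "heat \<tau> f = heat (\<tau> / 2) (heat (\<tau> / 2) f)" using fL \<tau> pq by (simp add: heat_heat[where p=p])
          then have "norm (heat \<tau> f z) \<le> c * fnorm (Lp p) (heat (\<tau> / 2) f)"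
            unfolding c_def using fL \<tau> pq by (simp only:) (intro heat_norm_le heat_Lp, auto)
          also have "\<dots> \<le> c * (Ct * fnorm ?A f)"
            using f \<tau> by (intro mult_left_mono Ct(2)) (auto simp: c_def)
          finally show "norm (heat \<tau> f z) \<le> c * Ct * fnorm ?A f" by simp
        qed
      qed
      moreover have "weakly_convergent ?A (\<lambda>k x. v k (x + y k)) (\<lambda>x. 0)"
        by (rule shift) (rule y)
      ultimately have "(\<lambda>k. heat \<tau> (\<lambda>x. v k (x + y k)) z) \<longlonglongrightarrow> heat \<tau> (\<lambda>x. 0) z"
        unfolding weakly_convergent_def by blast
      moreover have "heat \<tau> (\<lambda>x. 0) z = 0" using heat_cmult[of \<tau> 0 "\<lambda>x::real^'n. 0"] by simp
      ultimately show ?thesis by (simp add: heat_translate)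
    qed
    have heat_seq: "(\<lambda>k. heat \<tau> (v k) (x k)) \<longlonglongrightarrow> 0" if \<tau>: "0 < \<tau>" for \<tau> x
    proof -
      have "(\<lambda>k. heat (3 * (\<tau> / 3)) (v k) (x k)) \<longlonglongrightarrow> 0"
        using \<tau> by (intro heat_vanishing_along_sequences[OF v pq(1) _ heat_v] shifts) auto
      then show ?thesis by simp
    qed
    have "(\<lambda>k. fnorm (Lp q) (v k)) \<longlonglongrightarrow> 0"
    proof (rule LIMSEQ_I)
      fix r :: real assume r: "0 < r"
      \<comment> \<open>The final estimate is 4 (e + e) = r/2.\<close>
      define e where "e = r / 16"
      have e: "0 < e" using r by (simp add: e_def)
      have "(\<lambda>j. C * (Cd * B) * \<rho> ^ (2 * j)) \<longlonglongrightarrow> C * (Cd * B) * 0"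
        using \<rho> by (intro tendsto_mult_left) (simp add: power_mult LIMSEQ_power_zero power_less_one_iff abs_square_less_1)
      \<comment> \<open>The scale is fixed uniformly in k before k is taken large for the remaining
        part R k.\<close>
      then obtain j where j: "C * (Cd * B) * \<rho> ^ (2 * j) < e"
        using order_tendstoD(2)[of _ "C * (Cd * B) * 0" sequentially e] e by (auto simp: eventually_sequentially)
      define h where "h = (1 / 2 :: real) ^ j"
      have h: "0 < h" by (simp add: h_def)
      define R where "R k = heat_poly h (1 - ?D) (v k)" for k
      \<comment> \<open>Adding 1 keeps b positive, so that the definition of \<delta> can divide by
        its power.\<close>
      define b where "b = CP * (Ct * B) + 1"
      have b: "0 < b" unfolding b_def using CP Ct B by (intro add_nonneg_pos) auto
      have Rb: "fnorm (Lp p) (R k) \<le> b" for k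
      proof -
        have "fnorm (Lp p) (R k) \<le> CP * fnorm (Lp p) (heat h (v k))"
          unfolding R_def RP[OF v less_imp_le[OF h]] using v h pq by (intro CP(2) heat_Lp) auto
        also have "\<dots> \<le> CP * (Ct * B)" using CP(1) heat_v[OF h] by (intro mult_left_mono) auto
        finally show ?thesis by (simp add: b_def)
      qed
      have RL: "R k \<in> elems (Lp p)" "R k \<in> elems (Lp q)" for k
        unfolding R_def using v h pq by (auto intro: heat_poly_Lp low_Lq)
      have Rseq: "(\<lambda>k. R k (x k)) \<longlonglongrightarrow> 0" for x
      proof -
        have "(\<lambda>k. \<Sum>i\<le>degree (1 - ?D). coeff (1 - ?D) i * heat (of_nat i * h) (v k) (x k)) \<longlonglongrightarrow> (\<Sum>i\<le>degree (1 - ?D). 0)"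
        proof (rule tendsto_sum)
          fix i
          show "(\<lambda>k. coeff (1 - ?D) i * heat (of_nat i * h) (v k) (x k)) \<longlonglongrightarrow> 0"
          proof (cases "i = 0")
            \<comment> \<open>The constant coefficient vanishes, so no unsmoothed v k occurs, whose
              values at points need not converge.\<close>
            case True
            then show ?thesis using D0 by (simp add: poly_0_coeff_0)
          next
            case False
            then show ?thesis using h by (intro tendsto_mult_right_zero heat_seq) auto
          qed
        qed
        then show ?thesis by (simp add: R_def heat_poly_def)
      qed
      \<comment> \<open>Solves \<delta>^(q - p) b^p = e^q, which is possible because q > p.\<close>
      define \<delta> where "\<delta> = (e powr q / b powr p) powr (1 / (q - p))"
      have \<delta>: "0 < \<delta>" "\<delta> powr (q - p) * b powr p = e powr q"
        using e b pq by (auto simp: \<delta>_def powr_powr)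
      have "\<forall>\<^sub>F k in sequentially. \<forall>x. norm (R k x) \<le> \<delta>"
        using Rseq \<delta>(1) by (rule eventually_uniform_of_sequences)
      then obtain K where K: "\<And>k x. K \<le> k \<Longrightarrow> norm (R k x) \<le> \<delta>" by (auto simp: eventually_sequentially)
      show "\<exists>K. \<forall>k\<ge>K. norm (fnorm (Lp q) (v k) - 0) < r"
      proof (intro exI allI impI)
        fix k assume k: "K \<le> k"
        have [measurable]: "R k \<in> borel_measurable borel" using RL Lp_measurable by auto
        have "lpow q (R k) \<le> ennreal (\<delta> powr (q - p)) * lpow p (R k)"
          using K[OF k] pq by (intro lpow_le_of_bounded) auto
        also have "\<dots> \<le> ennreal (\<delta> powr (q - p)) * ennreal (b powr p)"
          using RL Rb pq by (intro mult_left_mono) (auto simp: lpow_eq_fnorm Lp_fnorm_nonneg intro!: ennreal_leI powr_mono2)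
        also have "\<dots> = ennreal (e powr q)" using \<delta>(2) by (simp flip: ennreal_mult)
        finally have low: "fnorm (Lp q) (R k) \<le> e"
          using RL e pq by (intro fnorm_le_of_lpow_le) auto
        have Bd: "0 \<le> Cd * B" using Cd B by simp
        have t: "(\<lambda>x. v k x - R k x) \<in> elems (Lp q)"
          "fnorm (Lp q) (\<lambda>x. v k x - R k x) \<le> C * (Cd * B) * \<rho> ^ (2 * j)"
          unfolding R_def h_def by (rule tail_Lq[OF v Bd diff_v], assumption)+
        have "fnorm (Lp q) (v k) \<le> 4 * (fnorm (Lp q) (\<lambda>x. v k x - R k x) + fnorm (Lp q) (R k))"
          using t RL by (intro split(1)) auto
        also have "\<dots> \<le> 4 * (e + e)"
          using low t(2) j by (intro mult_left_mono add_mono) auto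
        also have "\<dots> < r" using r by (simp add: e_def)
        finally show "norm (fnorm (Lp q) (v k) - 0) < r" by (simp add: Lp_fnorm_nonneg)
      qed
    qed
    then show ?thesis by (simp add: norm_convergent_def v_def[abs_def])
  qed
  ultimately show ?thesis unfolding cocompact_imbedding_def by blast
qed

end
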